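(* Let $m>0$, $A=\begin{pmatrix}\alpha&\beta\\\gamma&\delta\end{pmatrix}\in\mathbb{C}^{2\times2}$, and let $z\in\mathbb{C}\setminus[0,+\infty)$ satisfy $$4-\det(A)+\frac{2i}{\mu(z)}\alpha+2i\mu(z)\delta\neq0.$$ For $c>0$ let $A_c=\begin{pmatrix}\frac{\alpha}{2mc}&\beta\\\gamma&2mc\,\delta\end{pmatrix}$. Then for all sufficiently large $c$, $z$ lies in the resolvent set of $D^{m,c}_{A_c}-mc^2$, and $$\lim_{c\to+\infty}\Big\|(D^{m,c}_{A_c}-mc^2-z)^{-1}-\begin{pmatrix}1&0\\0&0\end{pmatrix}\otimes(H_A-z)^{-1}\Big\|=0$$ in operator norm on $L^2(\mathbb{R};\mathbb{C}^2)$, where $\begin{pmatrix}1&0\\0&0\end{pmatrix}\otimes(H_A-z)^{-1}$ maps $(\psi_1,\psi_2)\mapsto((H_A-z)^{-1}\psi_1,0)$.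
   Context: Let $\sigma_1=\begin{pmatrix}0&1\\1&0\end{pmatrix}$, $\sigma_3=\begin{pmatrix}1&0\\0&-1\end{pmatrix}$. For $m\in\mathbb{R}$, $c>0$, $B\in\mathbb{C}^{2\times2}$, $D^{m,c}_B$ is the operator in $L^2(\mathbb{R};\mathbb{C}^2)$ with domain $\{\psi=\psi_-\oplus\psi_+\in H^1(\mathbb{R}_-;\mathbb{C}^2)\oplus H^1(\mathbb{R}_+;\mathbb{C}^2): (2i\sigma_1-B)\psi(0_+)=(2i\sigma_1+B)\psi(0_-)\}$ ($\psi(0_\pm)$ the one-sided traces) acting on each half-line by $\psi_\pm\mapsto -ic\sigma_1\psi_\pm'+mc^2\sigma_3\psi_\pm$. Branch convention: $\mathrm{Im}\sqrt{w}>0$ for $w\in\mathbb{C}\setminus[0,+\infty)$; $\mu(z)=\sqrt{2mz}$. $H_A$ is the operator in $L^2(\mathbb{R})$ with domain consisting of $\psi=\psi_-\oplus\psi_+\in H^2(\mathbb{R}_-)\oplus H^2(\mathbb{R}_+)$ such that $\psi'(0_+)-\psi'(0_-)=\alpha\frac{\psi(0_+)+\psi(0_-)}{2}-i\beta\frac{\psi'(0_+)+\psi'(0_-)}{2}$ and $\psi(0_+)-\psi(0_-)=-i\gamma\frac{\psi(0_+)+\psi(0_-)}{2}-\delta\frac{\psi'(0_+)+\psi'(0_-)}{2}$, acting by $H_A\psi=-\frac{1}{2m}\psi_-''\oplus-\frac{1}{2m}\psi_+''$. *)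

theory Defs
  imports "HOL-Analysis.Analysis"
begin

text \<open>Elements of L2 are represented by functions; everything below is
  invariant under changes on null sets.\<close>

definition L2 :: "real set \<Rightarrow> (real \<Rightarrow> 'a::{banach,second_countable_topology}) \<Rightarrow> bool" where
  "L2 S f \<longleftrightarrow> set_borel_measurable lebesgue S f \<and>
     set_integrable lebesgue S (\<lambda>x. (norm (f x))\<^sup>2)"

definition L2norm :: "(real \<Rightarrow> 'a::{banach,second_countable_topology}) \<Rightarrow> real" where
  "L2norm f = sqrt (\<integral>x. (norm (f x))\<^sup>2 \<partial>lebesgue)"

definition ae_eq :: "(real \<Rightarrow> 'a) \<Rightarrow> (real \<Rightarrow> 'a) \<Rightarrow> bool" where
  "ae_eq f g \<longleftrightarrow> (AE x in lebesgue. f x = g x)"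

definition test_fun :: "real set \<Rightarrow> (real \<Rightarrow> real) \<Rightarrow> bool" where
  "test_fun S \<phi> \<longleftrightarrow> (\<forall>k x. (deriv ^^ k) \<phi> differentiable (at x)) \<and>
     compact (closure {x. \<phi> x \<noteq> 0}) \<and> closure {x. \<phi> x \<noteq> 0} \<subseteq> S"

definition weak_deriv :: "real set \<Rightarrow> (real \<Rightarrow> 'a::{banach,second_countable_topology})
    \<Rightarrow> (real \<Rightarrow> 'a) \<Rightarrow> bool" where
  "weak_deriv S u g \<longleftrightarrow> (\<forall>\<phi>. test_fun S \<phi> \<longrightarrow>
     (LINT x:S|lebesgue. deriv \<phi> x *\<^sub>R u x) = - (LINT x:S|lebesgue. \<phi> x *\<^sub>R g x))"

text \<open>A (linear) operator T on L2(R) is given by its graph G. The operator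
  T is boundedly invertible (0 is in the resolvent set of T) iff T is a bijection
  from its domain onto L2 with bounded inverse.\<close>

definition invertible_graph :: "((real \<Rightarrow> 'a::{banach,second_countable_topology}) \<times> (real \<Rightarrow> 'a)) set \<Rightarrow> bool" where
  "invertible_graph G \<longleftrightarrow>
     (\<forall>f. L2 UNIV f \<longrightarrow> (\<exists>\<psi> \<phi>. (\<psi>, \<phi>) \<in> G \<and> ae_eq \<phi> f)) \<and>
     (\<forall>\<psi> \<phi>. (\<psi>, \<phi>) \<in> G \<and> ae_eq \<phi> (\<lambda>x. 0) \<longrightarrow> ae_eq \<psi> (\<lambda>x. 0)) \<and>
     (\<exists>C. \<forall>\<psi> \<phi>. (\<psi>, \<phi>) \<in> G \<longrightarrow> L2norm \<psi> \<le> C * L2norm \<phi>)"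

definition inv_graph :: "((real \<Rightarrow> 'a) \<times> (real \<Rightarrow> 'a)) set \<Rightarrow> (real \<Rightarrow> 'a) \<Rightarrow> (real \<Rightarrow> 'a)" where
  "inv_graph G f = (SOME \<psi>. \<exists>\<phi>. (\<psi>, \<phi>) \<in> G \<and> ae_eq \<phi> f)"

definition opnorm_diff :: "((real \<Rightarrow> 'a::{banach,second_countable_topology}) \<Rightarrow> (real \<Rightarrow> 'a))
    \<Rightarrow> ((real \<Rightarrow> 'a) \<Rightarrow> (real \<Rightarrow> 'a)) \<Rightarrow> real" where
  "opnorm_diff R S = Sup {L2norm (\<lambda>x. R f x - S f x) | f. L2 UNIV f \<and> L2norm f \<le> 1}"

definition mat2 :: "complex \<Rightarrow> complex \<Rightarrow> complex \<Rightarrow> complex \<Rightarrow> complex^2^2" where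
  "mat2 a b c d = vector [vector [a, b], vector [c, d]]"

definition sigma1 :: "complex^2^2" where "sigma1 = mat2 0 1 1 0"
definition sigma3 :: "complex^2^2" where "sigma3 = mat2 1 0 0 (-1)"

definition cmat_scale :: "complex \<Rightarrow> complex^2^2 \<Rightarrow> complex^2^2" where
  "cmat_scale s M = (\<chi> i j. s * M $ i $ j)"

text \<open>Graph of D^{m,c}_B on L2(R;C^2). psi(0+), psi(0-) are the values at 0 of the
  continuous representatives up, um of the H^1 half-line restrictions.\<close>
definition dirac_graph :: "real \<Rightarrow> real \<Rightarrow> complex^2^2 \<Rightarrow>
    ((real \<Rightarrow> complex^2) \<times> (real \<Rightarrow> complex^2)) set" where
  "dirac_graph m c B = {(\<psi>, \<phi>). L2 UNIV \<psi> \<and> L2 UNIV \<phi> \<and>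
     (\<exists>up um gp gm.
        continuous_on {0..} up \<and> continuous_on {..0} um \<and>
        (AE x in lebesgue. x > 0 \<longrightarrow> \<psi> x = up x) \<and>
        (AE x in lebesgue. x < 0 \<longrightarrow> \<psi> x = um x) \<and>
        L2 {0<..} gp \<and> L2 {..<0} gm \<and>
        weak_deriv {0<..} up gp \<and> weak_deriv {..<0} um gm \<and>
        (cmat_scale (2 * \<i>) sigma1 - B) *v up 0 = (cmat_scale (2 * \<i>) sigma1 + B) *v um 0 \<and>
        (AE x in lebesgue. x > 0 \<longrightarrow> \<phi> x =
            (- \<i> * complex_of_real c) *s (sigma1 *v gp x) + complex_of_real (m * c\<^sup>2) *s (sigma3 *v up x)) \<and>
        (AE x in lebesgue. x < 0 \<longrightarrow> \<phi> x =
            (- \<i> * complex_of_real c) *s (sigma1 *v gm x) + complex_of_real (m * c\<^sup>2) *s (sigma3 *v um x)))}"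

definition dirac_shift_graph :: "real \<Rightarrow> real \<Rightarrow> complex^2^2 \<Rightarrow> complex \<Rightarrow>
    ((real \<Rightarrow> complex^2) \<times> (real \<Rightarrow> complex^2)) set" where
  "dirac_shift_graph m c B z =
     {(\<psi>, \<lambda>x. \<phi> x - (complex_of_real (m * c\<^sup>2) + z) *s \<psi> x) | \<psi> \<phi>. (\<psi>, \<phi>) \<in> dirac_graph m c B}"

definition schr_graph :: "real \<Rightarrow> complex \<Rightarrow> complex \<Rightarrow> complex \<Rightarrow> complex \<Rightarrow>
    ((real \<Rightarrow> complex) \<times> (real \<Rightarrow> complex)) set" where
  "schr_graph m \<alpha> \<beta> \<gamma> \<delta> = {(\<psi>, \<phi>). L2 UNIV \<psi> \<and> L2 UNIV \<phi> \<and>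
     (\<exists>up um vp vm wp wm.
        continuous_on {0..} up \<and> continuous_on {..0} um \<and>
        continuous_on {0..} vp \<and> continuous_on {..0} vm \<and>
        (AE x in lebesgue. x > 0 \<longrightarrow> \<psi> x = up x) \<and>
        (AE x in lebesgue. x < 0 \<longrightarrow> \<psi> x = um x) \<and>
        L2 {0<..} vp \<and> L2 {..<0} vm \<and> L2 {0<..} wp \<and> L2 {..<0} wm \<and>
        weak_deriv {0<..} up vp \<and> weak_deriv {..<0} um vm \<and>
        weak_deriv {0<..} vp wp \<and> weak_deriv {..<0} vm wm \<and>
        vp 0 - vm 0 = \<alpha> * (up 0 + um 0) / 2 - \<i> * \<beta> * (vp 0 + vm 0) / 2 \<and>
        up 0 - um 0 = - \<i> * \<gamma> * (up 0 + um 0) / 2 - \<delta> * (vp 0 + vm 0) / 2 \<and>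
        (AE x in lebesgue. x > 0 \<longrightarrow> \<phi> x = - wp x / complex_of_real (2 * m)) \<and>
        (AE x in lebesgue. x < 0 \<longrightarrow> \<phi> x = - wm x / complex_of_real (2 * m)))}"

definition schr_shift_graph :: "real \<Rightarrow> complex \<Rightarrow> complex \<Rightarrow> complex \<Rightarrow> complex \<Rightarrow> complex \<Rightarrow>
    ((real \<Rightarrow> complex) \<times> (real \<Rightarrow> complex)) set" where
  "schr_shift_graph m \<alpha> \<beta> \<gamma> \<delta> z =
     {(\<psi>, \<lambda>x. \<phi> x - z * \<psi> x) | \<psi> \<phi>. (\<psi>, \<phi>) \<in> schr_graph m \<alpha> \<beta> \<gamma> \<delta>}"

text \<open>Branch with Im sqrt w > 0 for w not in [0,+oo).\<close>
definition sqrt_up :: "complex \<Rightarrow> complex" where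
  "sqrt_up w = (if Im (csqrt w) > 0 then csqrt w else - csqrt w)"

definition mu :: "real \<Rightarrow> complex \<Rightarrow> complex" where
  "mu m z = sqrt_up (2 * complex_of_real m * z)"

end

theory Submission
  imports Defs
begin

text \<open>
  Write \<open>u = \<psi>1\<close>, \<open>v = 2 m c i \<psi>2\<close> and \<open>\<kappa> = 1 + z / (2 m c^2)\<close>. The resolvent equation of the Dirac
  operator with data \<open>(f1, f2)\<close> becomes \<open>u' = \<kappa> v + i f2 / c\<close>, \<open>v' = - 2 m z u - 2 m f1\<close>, and the
  scaling of \<open>A_c\<close> turns its boundary condition into exactly the transmission condition of \<open>H_A\<close>
  for \<open>(u, v)\<close>. The resolvent equation of \<open>H_A\<close> is the same system with \<open>\<kappa> = 1\<close> and without the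
  term \<open>i f2 / c\<close>. So it suffices to have one a priori bound for \<open>\<kappa> = 1\<close>: a solution for another
  \<open>\<kappa>\<close> solves the \<open>\<kappa> = 1\<close> problem with source \<open>i f2 / c + (\<kappa> - 1) v\<close>, which tends to zero.

  For the bound and for existence, reflect the left half-line to the right one and diagonalise:
  \<open>u + v / \<nu>\<close> decays and \<open>u - v / \<nu>\<close> grows, where \<open>\<kappa> \<nu>^2 = - 2 m z\<close> and \<open>Re (\<kappa> \<nu>) < 0\<close>. Energy
  estimates control both in terms of the data and of the two free initial values, and these are
  given by a 2 by 2 linear system whose determinant is, up to a nonzero factor, the quantity
  assumed not to vanish.
\<close>

section \<open>Smooth step functions\<close>

text \<open>The graphs speak of weak derivatives, while the estimates need a product rule and values
  at 0. Both come from reading a weak derivative as an integrand: \<open>u x - u 0\<close> is the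
  integral of \<open>g\<close>, and to justify this explicit test functions have to be built. Energy
  identities replace resolvent kernels: they need no integral operators and control values at 0
  together with norms. The constants they give depend on \<open>\<kappa>\<close>, hence on
  \<open>c\<close>. Uniformity in \<open>c\<close> is possible because
  \<open>\<kappa> * \<nu>^2\<close> is kept equal to \<open>- 2 m z\<close>: all
  \<open>\<kappa>\<close> then share the second equation, and the bound for
  \<open>\<kappa> = 1\<close> serves every large \<open>c\<close>. At the actual
  \<open>\<kappa>\<close> only existence is proved, where constants do not matter. The lower
  component disappears in the limit because \<open>\<psi>2 = v / (2 m c i)\<close> with
  \<open>v\<close> bounded in L2. The resulting bound on the norm of the difference is of order
  \<open>1 / c\<close>.\<close>

definition smooth_fun :: "(real \<Rightarrow> real) \<Rightarrow> bool" where
  "smooth_fun f \<longleftrightarrow> (\<forall>k x. (deriv ^^ k) f differentiable (at x))"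

text \<open>A formula for all iterated derivatives is avoided: it suffices to exhibit a class of
  functions in which every member has a derivative that is again a member, since the class then
  contains each \<open>(deriv ^^ k) f\<close>.\<close>

lemma smooth_fun_coinduct:
  assumes "F f"
    and step: "\<And>f. F f \<Longrightarrow> \<exists>f'. F f' \<and> (\<forall>x. (f has_real_derivative f' x) (at x))"
  shows "smooth_fun f"
proof -
  have "F ((deriv ^^ k) f)" for k
  proof (induction k)
    case (Suc k)
    obtain f' where f': "F f'" "\<And>x. ((deriv ^^ k) f has_real_derivative f' x) (at x)"
      using step[OF Suc] by blast
    have "deriv ((deriv ^^ k) f) = f'"
      using f'(2) DERIV_imp_deriv by blast
    then show ?case using f'(1) by simp
  qed (use assms(1) in simp)
  then show ?thesis
    unfolding smooth_fun_def by (meson step real_differentiable_def)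
qed

lemma smooth_fun_DERIV:
  assumes "smooth_fun f"
  shows "(f has_real_derivative deriv f x) (at x)"
proof -
  have "(deriv ^^ 0) f differentiable (at x)"
    using assms unfolding smooth_fun_def by blast
  then show ?thesis by (simp add: DERIV_deriv_iff_real_differentiable)
qed

lemma smooth_fun_deriv:
  assumes "smooth_fun f" shows "smooth_fun (deriv f)"
  unfolding smooth_fun_def
proof (intro allI)
  fix k x
  have "(deriv ^^ Suc k) f differentiable (at x)"
    using assms unfolding smooth_fun_def by blast
  then show "(deriv ^^ k) (deriv f) differentiable (at x)"
    by (simp add: funpow_Suc_right del: funpow.simps)
qed

lemma smooth_fun_continuous: "smooth_fun f \<Longrightarrow> continuous_on S f"
  by (rule DERIV_continuous_on[OF has_field_derivative_at_within[OF smooth_fun_DERIV]])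

lemma deriv_eq_0_open:
  fixes f :: "real \<Rightarrow> real"
  assumes "open U" "x \<in> U" "\<And>y. y \<in> U \<Longrightarrow> f y = c"
  shows "deriv f x = 0"
proof -
  have "((\<lambda>x. c) has_real_derivative 0) (at x)" by simp
  then have "(f has_real_derivative 0) (at x)"
    by (rule has_field_derivative_transform_within_open[OF _ assms(1,2)]) (simp add: assms(3))
  then show ?thesis by (rule DERIV_imp_deriv)
qed

text \<open>Adjoining \<open>S\<close> to the smooth functions gives a class closed under
  differentiation.\<close>

lemma smooth_fun_antideriv:
  assumes "smooth_fun f" and S: "\<And>x. (S has_real_derivative f x) (at x)"
  shows "smooth_fun S"
proof (rule smooth_fun_coinduct[where F = "\<lambda>g. g = S \<or> smooth_fun g"])
  fix g assume "g = S \<or> smooth_fun g"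
  then show "\<exists>f'. (f' = S \<or> smooth_fun f') \<and> (\<forall>x. (g has_real_derivative f' x) (at x))"
  proof
    assume "g = S"
    then show ?thesis using assms by (intro exI[of _ f]) auto
  next
    assume "smooth_fun g"
    then show ?thesis
      by (intro exI[of _ "deriv g"] conjI disjI2 allI smooth_fun_deriv smooth_fun_DERIV)
  qed
qed simp

text \<open>One statement covers both uses: differences of two rescaled steps, and the reflection
  \<open>\<phi> (- x)\<close> with second coefficient 0. The coefficients \<open>c\<close> and
  \<open>d\<close> are quantified inside the class because each differentiation multiplies them by
  \<open>a\<close> and \<open>p\<close>.\<close>

lemma smooth_fun_affine_comb:
  assumes "smooth_fun f" "smooth_fun g"
  shows "smooth_fun (\<lambda>x. c * f (a * x + b) + d * g (p * x + q))"
proof -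
  define F where "F h \<longleftrightarrow> (\<exists>f g c d. smooth_fun f \<and> smooth_fun g \<and>
      h = (\<lambda>x. c * f (a * x + b) + d * g (p * x + q)))" for h
  show ?thesis
  proof (rule smooth_fun_coinduct[where F = F])
    fix h assume "F h"
    then obtain f g c d where fg: "smooth_fun f" "smooth_fun g"
      and h: "h = (\<lambda>x. c * f (a * x + b) + d * g (p * x + q))"
      unfolding F_def by blast
    have "F (\<lambda>x. (c * a) * deriv f (a * x + b) + (d * p) * deriv g (p * x + q))"
      unfolding F_def using smooth_fun_deriv[OF fg(1)] smooth_fun_deriv[OF fg(2)] by blast
    moreover have "(h has_real_derivative (c * a) * deriv f (a * x + b) + (d * p) * deriv g (p * x + q)) (at x)" for x
    proof -
      have 1: "((\<lambda>x. f (a * x + b)) has_real_derivative deriv f (a * x + b) * a) (at x)"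
        by (rule DERIV_chain2[OF smooth_fun_DERIV[OF fg(1)]]) (auto intro!: derivative_eq_intros)
      have 2: "((\<lambda>x. g (p * x + q)) has_real_derivative deriv g (p * x + q) * p) (at x)"
        by (rule DERIV_chain2[OF smooth_fun_DERIV[OF fg(2)]]) (auto intro!: derivative_eq_intros)
      show ?thesis unfolding h
        by (rule derivative_eq_intros DERIV_cmult 1 2 refl)+ simp
    qed
    ultimately show "\<exists>f'. F f' \<and> (\<forall>x. (h has_real_derivative f' x) (at x))" by blast
  qed (use assms in \<open>auto simp: F_def\<close>)
qed

section \<open>Smooth bumps and steps built from exp (- 1 / x)\<close>

definition flat :: "real poly \<Rightarrow> real \<Rightarrow> real" where
  "flat P x = (if x > 0 then poly P (1 / x) * exp (- (1 / x)) else 0)"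

text \<open>The free power \<open>k\<close> makes the induction over the coefficients work, since
  each step moves one factor \<open>y\<close> from the polynomial into it. The case
  \<open>k = 1\<close> with \<open>y = 1 / h\<close> is the difference quotient of a flat function
  at 0.\<close>

lemma poly_over_exp_tendsto_0: "((\<lambda>y. y ^ k * poly P y / exp y) \<longlongrightarrow> (0::real)) at_top"
proof (induction P arbitrary: k)
  case (pCons a P)
  have "((\<lambda>y. a * (y ^ k / exp y) + y ^ Suc k * poly P y / exp y) \<longlongrightarrow> a * 0 + 0) at_top"
    by (intro tendsto_intros pCons.IH tendsto_power_div_exp_0)
  then show ?case by (simp add: algebra_simps add_divide_distrib)
qed simp

text \<open>With \<open>y = 1 / x\<close> one has \<open>y' = - y^2\<close>, so
  \<open>P(y) exp (- y)\<close> has derivative \<open>y^2 (P - P')(y) exp (- y)\<close>; the factor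
  \<open>[:0, 0, 1:]\<close> is \<open>y^2\<close>. Allowing all polynomials makes the family around
  \<open>exp (- 1 / x)\<close> closed under differentiation, across 0 as well.\<close>

lemma flat_DERIV:
  "(flat P has_real_derivative flat ([:0, 0, 1:] * (P - pderiv P)) x) (at x)"
proof -
  consider "x < 0" | "x = 0" | "x > 0" by linarith
  then show ?thesis
  proof cases
    case 1
    have "((\<lambda>x. 0) has_real_derivative 0) (at x)" by simp
    then have "(flat P has_real_derivative 0) (at x)"
      by (rule has_field_derivative_transform_within_open[where S = "{..<0}"])
        (use 1 in \<open>auto simp: flat_def\<close>)
    then show ?thesis using 1 by (simp add: flat_def)
  next
    case 2
    have R: "((\<lambda>h. flat P h / h) \<longlongrightarrow> 0) (at_right 0)"
    proof -
      have "((\<lambda>h. inverse h ^ 1 * poly P (inverse h) / exp (inverse h)) \<longlongrightarrow> (0::real)) (at_right 0)"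
        by (rule filterlim_compose[OF poly_over_exp_tendsto_0 filterlim_inverse_at_top_right])
      moreover have "\<forall>\<^sub>F h in at_right 0. inverse h ^ 1 * poly P (inverse h) / exp (inverse h) = flat P h / h"
        by (auto simp: eventually_at_filter flat_def divide_inverse exp_minus)
      ultimately show ?thesis by (rule Lim_transform_eventually)
    qed
    have L: "((\<lambda>h. flat P h / h) \<longlongrightarrow> 0) (at_left 0)"
      by (rule tendsto_eventually) (auto simp: eventually_at_filter flat_def)
    show ?thesis
      using filterlim_split_at[OF L R] unfolding 2 DERIV_def by (simp add: flat_def)
  next
    case 3
    have "((\<lambda>x. poly P (1 / x) * exp (- (1 / x))) has_real_derivative
        poly ([:0, 0, 1:] * (P - pderiv P)) (1 / x) * exp (- (1 / x))) (at x)"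
      by (rule derivative_eq_intros poly_DERIV[THEN DERIV_chain2] refl | use 3 in force)+
        (use 3 in \<open>simp add: field_simps power2_eq_square\<close>)
    then have "(flat P has_real_derivative
        poly ([:0, 0, 1:] * (P - pderiv P)) (1 / x) * exp (- (1 / x))) (at x)"
      by (rule has_field_derivative_transform_within_open[where S = "{0<..}"])
        (use 3 in \<open>auto simp: flat_def\<close>)
    then show ?thesis using 3 by (simp add: flat_def)
  qed
qed

text \<open>Differentiating a product gives two products, so products alone are not closed under
  differentiation, but their sums are. Each member vanishes outside the open interval from 0 to
  1.\<close>

inductive bump_span :: "(real \<Rightarrow> real) \<Rightarrow> bool" where
  "bump_span (\<lambda>x. flat P x * flat Q (1 - x))"
| "bump_span f \<Longrightarrow> bump_span g \<Longrightarrow> bump_span (\<lambda>x. f x + g x)"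

lemma smooth_fun_bump: "smooth_fun (\<lambda>x. flat P x * flat Q (1 - x))"
proof (rule smooth_fun_coinduct[where F = bump_span])
  fix f assume "bump_span f"
  then show "\<exists>f'. bump_span f' \<and> (\<forall>x. (f has_real_derivative f' x) (at x))"
  proof induction
    case (1 P Q)
    define P' where "P' = [:0, 0, 1:] * (P - pderiv P)"
    define Q' where "Q' = [:0, 0, 1:] * (Q - pderiv Q)"
    have neg: "flat (- R) y = - flat R y" for R y by (simp add: flat_def)
    have E: "((\<lambda>x. flat Q (1 - x)) has_real_derivative flat Q' (1 - x) * (-1)) (at x)" for x
      unfolding Q'_def by (rule DERIV_chain2[OF flat_DERIV]) (auto intro!: derivative_eq_intros)
    have "((\<lambda>x. flat P x * flat Q (1 - x)) has_real_derivative
        flat P' x * flat Q (1 - x) + flat P x * flat (- Q') (1 - x)) (at x)" for x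
      using DERIV_mult[OF flat_DERIV[of P x, folded P'_def] E[of x]]
      by (simp add: neg mult.commute)
    moreover have "bump_span (\<lambda>x. flat P' x * flat Q (1 - x) + flat P x * flat (- Q') (1 - x))"
      by (intro bump_span.intros)
    ultimately show ?case by blast
  next
    case (2 f g)
    then obtain f' g' where "bump_span f'" "bump_span g'"
      and "\<And>x. (f has_real_derivative f' x) (at x)" "\<And>x. (g has_real_derivative g' x) (at x)"
      by blast
    then show ?case
      by (intro exI[of _ "\<lambda>x. f' x + g' x"] conjI allI bump_span.intros(2) DERIV_add)
  qed
qed (rule bump_span.intros)

text \<open>The step is a primitive of the bump \<open>exp (- 1 / x - 1 / (1 - x))\<close>,
  normalised to rise from 0 to 1. Monotonicity is recorded because the rescaled derivatives have to
  be nonnegative kernels.\<close>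

lemma smooth_step_exists:
  obtains S :: "real \<Rightarrow> real" where "smooth_fun S" "\<And>x. x \<le> 0 \<Longrightarrow> S x = 0" "\<And>x. 1 \<le> x \<Longrightarrow> S x = 1" "mono S"
proof -
  \<comment> \<open>The constant polynomial \<open>c\<close> keeps scaled bumps in the same form, so
    that smoothness of the normalised derivative \<open>\<rho> (1 / (T 1 - T 0))\<close> is an
    instance of the same lemma.\<close>
  define \<rho> where "\<rho> c x = flat [:c:] x * flat [:1:] (1 - x)" for c x
  have sm: "smooth_fun (\<rho> c)" for c unfolding \<rho>_def by (rule smooth_fun_bump)
  have "isCont (\<rho> 1) x" for x
    using sm smooth_fun_DERIV DERIV_isCont by blast
  then obtain T where T: "\<And>x. (T has_real_derivative \<rho> 1 x) (at x)"
    using einterval_antiderivative[of "-\<infinity>" "\<infinity>" "\<rho> 1"]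
    by (auto simp: has_real_derivative_iff_has_vector_derivative)
  have pos: "\<rho> 1 x > 0" if "0 < x" "x < 1" for x using that by (simp add: \<rho>_def flat_def)
  have nonneg: "\<rho> 1 x \<ge> 0" for x by (simp add: \<rho>_def flat_def)
  have "T 0 < T 1"
  proof -
    have "\<exists>z. 0 < z \<and> z < 1 \<and> T 1 - T 0 = (1 - 0) * \<rho> 1 z"
      by (rule MVT2) (use T in auto)
    then show ?thesis using pos by fastforce
  qed
  define S where "S x = (T x - T 0) / (T 1 - T 0)" for x
  have S: "(S has_real_derivative \<rho> (1 / (T 1 - T 0)) x) (at x)" for x
  proof -
    have "(S has_real_derivative \<rho> 1 x / (T 1 - T 0)) (at x)"
      unfolding S_def by (rule DERIV_cdivide) (auto intro!: derivative_eq_intros T)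
    then show ?thesis by (simp add: \<rho>_def flat_def split: if_splits)
  qed
  have mono_T: "T x \<le> T y" if "x \<le> y" for x y
    by (rule DERIV_nonneg_imp_nondecreasing[OF that]) (use T nonneg in blast)
  have T0: "T x = T 0" if "x \<le> 0" for x
  proof -
    have "T 0 \<le> T x"
      by (rule DERIV_nonpos_imp_nonincreasing[OF that]) (use T in \<open>force simp: \<rho>_def flat_def\<close>)
    then show ?thesis using mono_T[OF that] by simp
  qed
  have T1: "T x = T 1" if "1 \<le> x" for x
  proof -
    have "T x \<le> T 1"
      by (rule DERIV_nonpos_imp_nonincreasing[OF that]) (use T in \<open>force simp: \<rho>_def flat_def\<close>)
    then show ?thesis using mono_T[OF that] by simp
  qed
  show thesis
  proof
    show "smooth_fun S" by (rule smooth_fun_antideriv[OF sm S])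
    show "S x = 0" if "x \<le> 0" for x using T0[OF that] by (simp add: S_def)
    show "S x = 1" if "1 \<le> x" for x using T1[OF that] \<open>T 0 < T 1\<close> by (simp add: S_def)
    show "mono S" using mono_T \<open>T 0 < T 1\<close> by (auto simp: mono_def S_def divide_le_cancel)
  qed
qed

section \<open>Primitives of integrable functions\<close>

text \<open>Local absolute continuity on the closed half-line in integral form: no pointwise
  derivative is asked for, so Lebesgue's differentiation theorem never enters. Absolute
  integrability allows products with continuous functions and domination by
  \<open>norm (g x)\<close>.\<close>

definition is_primitive :: "(real \<Rightarrow> complex) \<Rightarrow> (real \<Rightarrow> complex) \<Rightarrow> bool" where
  "is_primitive u g \<longleftrightarrow>
     (\<forall>x\<ge>0. g absolutely_integrable_on {0..x} \<and> (g has_integral (u x - u 0)) {0..x})"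

lemma is_primitiveD:
  assumes "is_primitive u g" "0 \<le> x" "x \<le> y"
  shows "g absolutely_integrable_on {x..y}" "(g has_integral (u y - u x)) {x..y}"
proof -
  show A: "g absolutely_integrable_on {x..y}"
  proof (rule absolutely_integrable_on_subinterval)
    show "g absolutely_integrable_on {0..y}"
      using assms unfolding is_primitive_def by (meson order_trans)
  qed (use assms in simp)
  then obtain j where j: "(g has_integral j) {x..y}"
    using set_lebesgue_integral_eq_integral(1) by blast
  have "(g has_integral (u x - u 0)) {0..x}" "(g has_integral (u y - u 0)) {0..y}"
    using assms unfolding is_primitive_def by (meson order_trans)+
  moreover from this(1) j have "(g has_integral (u x - u 0 + j)) {0..y}"
    using assms by (intro has_integral_combine[of 0 x y])
  ultimately have "u y - u 0 = u x - u 0 + j" using has_integral_unique by blast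
  then have "j = u y - u x" by (simp add: algebra_simps)
  then show "(g has_integral (u y - u x)) {x..y}" using j by simp
qed

lemma is_primitive_integral:
  assumes "is_primitive u g" "0 \<le> x"
  shows "u x = u 0 + integral {0..x} g"
  using is_primitiveD(2)[OF assms(1), of 0 x] assms by (simp add: integral_unique)

lemma is_primitive_continuous:
  assumes "is_primitive u g"
  shows "continuous_on {0..} u"
proof -
  have *: "continuous_on {0..R} u" if "R \<ge> 0" for R
  proof -
    have "g integrable_on {0..R}"
      using is_primitiveD(2)[OF assms, of 0 R] that by blast
    then have "continuous_on {0..R} (\<lambda>x. u 0 + integral {0..x} g)"
      by (intro continuous_on_add[OF continuous_on_const] indefinite_integral_continuous_1)
    then show ?thesis
      by (rule continuous_on_eq) (simp add: is_primitive_integral[OF assms, symmetric])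
  qed
  show ?thesis
    unfolding continuous_on_eq_continuous_within
  proof
    fix x :: real assume x: "x \<in> {0..}"
    have "continuous (at x within {0..x + 1}) u"
      using *[of "x + 1"] x by (auto simp: continuous_on_eq_continuous_within)
    moreover have "at x within {0..x + 1} = at x within {0..}"
      by (rule at_within_nhd[of _ "{..<x + 1}"]) auto
    ultimately show "continuous (at x within {0..}) u"
      by (simp add: continuous_within)
  qed
qed

lemma absolutely_integrable_mult_continuous:
  fixes f v :: "real \<Rightarrow> complex"
  assumes "f absolutely_integrable_on {a..b}" "continuous_on {a..b} v"
  shows "(\<lambda>x. v x * f x) absolutely_integrable_on {a..b}"
    "(\<lambda>x. f x * v x) absolutely_integrable_on {a..b}"
proof -
  show "(\<lambda>x. v x * f x) absolutely_integrable_on {a..b}"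
  proof (rule absolutely_integrable_bounded_measurable_product[OF bilinear_times])
    show "v \<in> borel_measurable (lebesgue_on {a..b})"
      by (rule continuous_imp_measurable_on_sets_lebesgue[OF assms(2)]) simp
    show "bounded (v ` {a..b})"
      using assms(2) by (simp add: compact_imp_bounded compact_continuous_image)
  qed (use assms in simp_all)
  then show "(\<lambda>x. f x * v x) absolutely_integrable_on {a..b}"
    by (simp add: mult.commute)
qed

text \<open>A Riemann-Stieltjes type argument: over a partition of mesh below the modulus of
  continuity the error of the product rule is at most \<open>\<epsilon>\<close> times the total variation.\<close>

lemma is_primitive_mult:
  assumes u: "is_primitive u g" and v: "is_primitive v h"
  shows "is_primitive (\<lambda>x. u x * v x) (\<lambda>x. g x * v x + u x * h x)"
  unfolding is_primitive_def
proof (intro allI impI conjI)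
  fix R :: real assume R: "0 \<le> R"
  define k where "k x = g x * v x + u x * h x" for x
  have cont: "continuous_on {0..R} u" "continuous_on {0..R} v"
    using is_primitive_continuous[OF u] is_primitive_continuous[OF v] by (auto elim: continuous_on_subset)
  have gh: "g absolutely_integrable_on {0..R}" "h absolutely_integrable_on {0..R}"
    using is_primitiveD(1)[OF u _ R] is_primitiveD(1)[OF v _ R] by simp_all
  have k_abs: "k absolutely_integrable_on {0..R}"
    unfolding k_def by (intro set_integral_add absolutely_integrable_mult_continuous gh cont)
  then show "(\<lambda>x. g x * v x + u x * h x) absolutely_integrable_on {0..R}"
    by (simp add: k_def[abs_def])
  define w where "w t = norm (g t) + norm (h t)" for t
  have w_int: "w integrable_on {0..R}"
    unfolding w_def using gh by (intro integrable_add) (auto simp: absolutely_integrable_on_def)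
  have k_int: "k integrable_on {0..R}" by (rule set_lebesgue_integral_eq_integral(1)[OF k_abs])
  \<comment> \<open>\<open>F\<close> is the defect in the product rule; the aim is that it takes the
    same value at 0 and at \<open>R\<close>.\<close>
  define F where "F x = u x * v x - integral {0..x} k" for x
  define W where "W x = integral {0..x} w" for x
  have bound: "norm (F R - F 0) \<le> \<epsilon> * W R" if "\<epsilon> > 0" for \<epsilon>
  proof -
    obtain \<delta> where "\<delta> > 0" and \<delta>: "\<And>x y. \<lbrakk>x \<in> {0..R}; y \<in> {0..R}; \<bar>y - x\<bar> < \<delta>\<rbrakk> \<Longrightarrow>
        norm (u y - u x) \<le> \<epsilon> \<and> norm (v y - v x) \<le> \<epsilon>"
    proof -
      have uc: "uniformly_continuous_on {0..R} u" "uniformly_continuous_on {0..R} v"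
        using cont by (auto intro: compact_uniformly_continuous)
      obtain d1 where "d1 > 0"
        "\<And>x y. \<lbrakk>x \<in> {0..R}; y \<in> {0..R}; dist y x < d1\<rbrakk> \<Longrightarrow> dist (u y) (u x) < \<epsilon>"
        by (rule uniformly_continuous_onE[OF uc(1) \<open>\<epsilon> > 0\<close>]) blast
      moreover obtain d2 where "d2 > 0"
        "\<And>x y. \<lbrakk>x \<in> {0..R}; y \<in> {0..R}; dist y x < d2\<rbrakk> \<Longrightarrow> dist (v y) (v x) < \<epsilon>"
        by (rule uniformly_continuous_onE[OF uc(2) \<open>\<epsilon> > 0\<close>]) blast
      ultimately show ?thesis
        by (intro that[of "min d1 d2"]) (auto simp: dist_norm less_imp_le)
    qed
    have step: "norm (F y - F x) \<le> \<epsilon> * (W y - W x)"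
      if xy: "0 \<le> x" "x \<le> y" "y \<le> R" "y - x < \<delta>" for x y
    proof -
      have sub: "k integrable_on {x..y}" "w integrable_on {x..y}" "k integrable_on {0..y}" "w integrable_on {0..y}"
        by (rule integrable_on_subinterval[OF k_int] integrable_on_subinterval[OF w_int]; use xy in auto)+
      have ik: "integral {x..y} k = integral {0..y} k - integral {0..x} k"
        and iw: "integral {x..y} w = W y - W x"
        using Henstock_Kurzweil_Integration.integral_combine[OF xy(1,2) sub(3)]
          Henstock_Kurzweil_Integration.integral_combine[OF xy(1,2) sub(4)]
        by (simp_all add: W_def algebra_simps)
      \<comment> \<open>The increment of the product is split as
        \<open>(u y - u x) v y + u x (v y - v x)\<close>. Subtracting the integral of
        \<open>k\<close> leaves in each term one oscillation over \<open>{x..y}\<close>, at most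
        \<open>\<epsilon>\<close>, against \<open>g\<close> or \<open>h\<close>.\<close>
      have "((\<lambda>t. g t * v y + u x * h t - k t) has_integral
          ((u y - u x) * v y + u x * (v y - v x) - integral {x..y} k)) {x..y}"
        using is_primitiveD(2)[OF u xy(1,2)] is_primitiveD(2)[OF v xy(1,2)] sub(1)
        by (intro has_integral_diff has_integral_add has_integral_mult_left has_integral_mult_right integrable_integral)
      then have I: "((\<lambda>t. g t * (v y - v t) + (u x - u t) * h t) has_integral (F y - F x)) {x..y}"
        by (simp add: k_def F_def ik algebra_simps)
      have "norm (integral {x..y} (\<lambda>t. g t * (v y - v t) + (u x - u t) * h t))
          \<le> integral {x..y} (\<lambda>t. \<epsilon> * w t)"
      proof (rule Henstock_Kurzweil_Integration.integral_norm_bound_integral)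
        fix t assume t: "t \<in> {x..y}"
        have "norm (v y - v t) \<le> \<epsilon>" "norm (u x - u t) \<le> \<epsilon>"
          using \<delta>[of t y] \<delta>[of t x] t xy by auto
        then have "norm (g t * (v y - v t)) \<le> norm (g t) * \<epsilon>" "norm ((u x - u t) * h t) \<le> \<epsilon> * norm (h t)"
          by (auto simp: norm_mult intro: mult_left_mono mult_right_mono)
        then show "norm (g t * (v y - v t) + (u x - u t) * h t) \<le> \<epsilon> * w t"
          unfolding w_def distrib_left using norm_triangle_mono by (metis mult.commute)
      next
        show "(\<lambda>t. g t * (v y - v t) + (u x - u t) * h t) integrable_on {x..y}"
          using I by blast
        show "(\<lambda>t. \<epsilon> * w t) integrable_on {x..y}"
          by (rule integrable_on_mult_right[OF sub(2)])
      qed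
      then show ?thesis by (simp add: integral_unique[OF I] iw)
    qed
    obtain n :: nat where n: "n > 0" "R / real n < \<delta>"
    proof -
      obtain n :: nat where "R / \<delta> < real n" using reals_Archimedean2 by blast
      then have less: "R < \<delta> * real n" using \<open>\<delta> > 0\<close> by (simp add: field_simps)
      then have "n > 0" using R by (auto intro: Nat.gr0I)
      then show ?thesis using less by (intro that[of n]) (simp_all add: divide_less_eq)
    qed
    define t where "t i = R * real i / real n" for i
    have t: "t 0 = 0" "t n = R" using n by (simp_all add: t_def)
    have "norm (F R - F 0) = norm (\<Sum>i<n. F (t (Suc i)) - F (t i))"
      by (simp add: sum_lessThan_telescope[of "\<lambda>i. F (t i)"] t)
    also have "\<dots> \<le> (\<Sum>i<n. \<epsilon> * (W (t (Suc i)) - W (t i)))"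
    proof (rule sum_norm_le)
      fix i assume i: "i \<in> {..<n}"
      have "R * real (Suc i) \<le> R * real n" using i R by (intro mult_left_mono) auto
      then have "t (Suc i) \<le> R" using n by (simp add: t_def field_simps)
      moreover have "t (Suc i) - t i = R / real n"
        by (simp add: t_def distrib_left add_divide_distrib)
      ultimately show "norm (F (t (Suc i)) - F (t i)) \<le> \<epsilon> * (W (t (Suc i)) - W (t i))"
        using n R by (intro step) (auto simp: t_def divide_right_mono mult_left_mono)
    qed
    also have "\<dots> = \<epsilon> * W R"
      by (simp add: sum_distrib_left[symmetric] sum_lessThan_telescope[of "\<lambda>i. W (t i)"] t) (simp add: W_def)
    finally show ?thesis .
  qed
  have "norm (F R - F 0) \<le> 0"
  proof (rule ccontr)
    assume neg: "\<not> ?thesis"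
    define N where "N = norm (F R - F 0)"
    have "W R \<ge> 0" unfolding W_def w_def by (rule integral_nonneg[OF w_int[unfolded w_def]]) simp
    have "N > 0" using neg by (simp add: N_def)
    \<comment> \<open>The choice \<open>\<epsilon> = N / (W R + 1)\<close> gives
      \<open>N (W R + 1) \<le> N W R\<close>; the summand 1 also covers
      \<open>W R = 0\<close>.\<close>
    have "N \<le> N / (W R + 1) * W R"
      unfolding N_def using bound[of "N / (W R + 1)"] \<open>N > 0\<close> \<open>W R \<ge> 0\<close> by (simp add: N_def)
    then show False using \<open>N > 0\<close> \<open>W R \<ge> 0\<close> by (simp add: field_simps)
  qed
  then have "integral {0..R} k = u R * v R - u 0 * v 0"
    by (simp add: F_def algebra_simps)
  then show "((\<lambda>x. g x * v x + u x * h x) has_integral (u R * v R - u 0 * v 0)) {0..R}"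
    using integrable_integral[OF k_int] by (simp add: k_def[abs_def])
qed

lemma is_primitive_add:
  assumes "is_primitive u g" "is_primitive v h"
  shows "is_primitive (\<lambda>x. u x + v x) (\<lambda>x. g x + h x)"
  unfolding is_primitive_def
proof (intro allI impI conjI)
  fix x :: real assume "0 \<le> x"
  then have 1: "g absolutely_integrable_on {0..x}" "(g has_integral (u x - u 0)) {0..x}"
    "h absolutely_integrable_on {0..x}" "(h has_integral (v x - v 0)) {0..x}"
    using assms unfolding is_primitive_def by blast+
  show "(\<lambda>x. g x + h x) absolutely_integrable_on {0..x}"
    by (rule set_integral_add(1)[OF 1(1,3)])
  show "((\<lambda>x. g x + h x) has_integral (u x + v x - (u 0 + v 0))) {0..x}"
    using has_integral_add[OF 1(2,4)] by (simp add: add_diff_add)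
qed

lemma is_primitive_const: "is_primitive (\<lambda>x. c) (\<lambda>x. 0)"
  by (simp add: is_primitive_def)

lemma is_primitive_cmult:
  assumes "is_primitive u g"
  shows "is_primitive (\<lambda>x. c * u x) (\<lambda>x. c * g x)"
  using is_primitive_mult[OF is_primitive_const assms, of c] by simp

lemma is_primitive_cnj:
  assumes "is_primitive u g"
  shows "is_primitive (\<lambda>x. cnj (u x)) (\<lambda>x. cnj (g x))"
  unfolding is_primitive_def
proof (intro allI impI conjI)
  fix x :: real assume "0 \<le> x"
  then have 1: "g absolutely_integrable_on {0..x}" "(g has_integral (u x - u 0)) {0..x}"
    using assms unfolding is_primitive_def by blast+
  show "(\<lambda>x. cnj (g x)) absolutely_integrable_on {0..x}"
    using absolutely_integrable_linear[OF 1(1) bounded_linear_cnj] by (simp add: o_def)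
  show "((\<lambda>x. cnj (g x)) has_integral (cnj (u x) - cnj (u 0))) {0..x}"
    using has_integral_linear[OF 1(2) bounded_linear_cnj] by (simp add: o_def)
qed

text \<open>The operator graphs identify derivatives only almost everywhere and off 0, hence the
  exceptional set \<open>insert 0 N\<close>. The functions \<open>u\<close> and \<open>u'\<close>
  have to agree at every point of the half-line, since their endpoint values enter.\<close>

lemma is_primitive_cong_AE:
  assumes "is_primitive u g" and "\<And>x. x \<ge> 0 \<Longrightarrow> u' x = u x"
    and AE: "AE x in lebesgue. x > 0 \<longrightarrow> g' x = g x"
  shows "is_primitive u' g'"
proof -
  obtain N where N: "N \<in> null_sets lebesgue" "{x. \<not> (x > 0 \<longrightarrow> g' x = g x)} \<subseteq> N"
    using AE by (auto simp: eventually_ae_filter)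
  have neg: "negligible (insert 0 N)"
    using N(1) by (simp add: negligible_iff_null_sets[symmetric])
  have eq: "g' x = g x" if "x \<in> {0..y} - insert 0 N" for x y
  proof -
    have "x > 0" "x \<notin> N" using that by auto
    then show ?thesis using N(2) by blast
  qed
  show ?thesis unfolding is_primitive_def
  proof (intro allI impI conjI)
    fix y :: real assume y: "0 \<le> y"
    then have 1: "g absolutely_integrable_on {0..y}" "(g has_integral (u y - u 0)) {0..y}"
      using assms unfolding is_primitive_def by blast+
    show "g' absolutely_integrable_on {0..y}"
      using absolutely_integrable_spike[OF 1(1) neg eq] .
    show "(g' has_integral (u' y - u' 0)) {0..y}"
      unfolding assms(2)[OF y] assms(2)[OF order_refl]
      by (rule has_integral_spike[OF neg eq 1(2)])
  qed
qed

lemma is_primitive_C1: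
  assumes "\<And>x. (f has_vector_derivative f' x) (at x)" "continuous_on UNIV f'"
  shows "is_primitive f f'"
  unfolding is_primitive_def
proof (intro allI impI conjI)
  fix x :: real assume "0 \<le> x"
  show "f' absolutely_integrable_on {0..x}"
    by (rule absolutely_integrable_continuous_real[OF continuous_on_subset[OF assms(2) subset_UNIV]])
  show "(f' has_integral (f x - f 0)) {0..x}"
    by (rule fundamental_theorem_of_calculus[OF \<open>0 \<le> x\<close> has_vector_derivative_at_within[OF assms(1)]])
qed

lemma is_primitive_exists:
  assumes "\<And>x. x \<ge> 0 \<Longrightarrow> g absolutely_integrable_on {0..x}"
  shows "is_primitive (\<lambda>x. a + integral {0..x} g) g"
  unfolding is_primitive_def
proof (intro allI impI conjI)
  fix x :: real assume "0 \<le> x"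
  then show "g absolutely_integrable_on {0..x}" by (rule assms)
  then show "(g has_integral (a + integral {0..x} g - (a + integral {0..0} g))) {0..x}"
    by (simp add: integrable_integral set_lebesgue_integral_eq_integral(1))
qed

section \<open>Weak derivatives and primitives\<close>

lemma test_fun_smooth: "test_fun S \<phi> \<Longrightarrow> smooth_fun \<phi>"
  by (simp add: test_fun_def smooth_fun_def)

lemma continuous_on_rescaled_deriv:
  assumes "smooth_fun S"
  shows "continuous_on A (\<lambda>x. real n * deriv S (real n * (x - c)))"
  by (intro continuous_on_mult[OF continuous_on_const]
      continuous_on_compose2[OF smooth_fun_continuous[OF smooth_fun_deriv[OF assms], of UNIV]] continuous_intros) auto

text \<open>\<open>n S'(n (x - c))\<close> is a nonnegative kernel of mass 1 supported in
  \<open>[c, c + 1 / n]\<close>. It lies to the right of \<open>c\<close>, so only values of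
  \<open>u\<close> on the half-line are sampled, and \<open>c + 1 \<le> R\<close> keeps the support
  inside the interval for every \<open>n \<ge> 1\<close>.\<close>

lemma step_approx_identity:
  fixes u :: "real \<Rightarrow> complex"
  assumes S: "smooth_fun S" "\<And>x. x \<le> 0 \<Longrightarrow> S x = 0" "\<And>x. 1 \<le> x \<Longrightarrow> S x = 1" "mono S"
    and u: "continuous_on {0..} u" and c: "0 \<le> c" "c + 1 \<le> R"
  shows "(\<lambda>n. integral {0..R} (\<lambda>x. (real n * deriv S (real n * (x - c))) *\<^sub>R u x)) \<longlonglongrightarrow> u c"
proof (rule LIMSEQ_I)
  fix \<epsilon> :: real assume "\<epsilon> > 0"
  \<comment> \<open>Averaging against the kernel only gives a weak inequality; half of
    \<open>\<epsilon>\<close> makes the final one strict.\<close>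
  define e where "e = \<epsilon> / 2"
  have "e > 0" "e < \<epsilon>" using \<open>\<epsilon> > 0\<close> by (auto simp: e_def)
  obtain \<delta> where "\<delta> > 0" and \<delta>: "\<And>x. 0 \<le> x \<Longrightarrow> dist x c < \<delta> \<Longrightarrow> dist (u x) (u c) < e"
    using u c(1) \<open>e > 0\<close> unfolding continuous_on_iff by (meson atLeast_iff)
  obtain N :: nat where N: "1 / \<delta> < real N" using reals_Archimedean2 by blast
  have "norm (integral {0..R} (\<lambda>x. (real n * deriv S (real n * (x - c))) *\<^sub>R u x) - u c) < \<epsilon>"
    if n: "n \<ge> Suc N" for n
  proof -
    have "n > 0" using n by simp
    define k where "k x = real n * deriv S (real n * (x - c))" for x
    have dS: "(S has_real_derivative deriv S x) (at x)" for x
      by (rule smooth_fun_DERIV[OF S(1)])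
    have S'0: "deriv S y = 0" if "y < 0 \<or> y > 1" for y
      using that deriv_eq_0_open[of "{..<0}" y S 0] deriv_eq_0_open[of "{1<..}" y S 1] S(2,3) by auto
    have S'_nonneg: "deriv S y \<ge> 0" for y
      by (rule mono_on_imp_deriv_nonneg[of UNIV S]) (use S(4) dS in \<open>auto simp: mono_def monotone_on_def\<close>)
    have k_nonneg: "k x \<ge> 0" for x unfolding k_def using S'_nonneg by simp
    have k_cont: "continuous_on A k" for A
      unfolding k_def by (rule continuous_on_rescaled_deriv[OF S(1)])
    have kint: "(k has_integral 1) {0..R}"
    proof -
      have "((\<lambda>x. S (real n * (x - c))) has_real_derivative deriv S (real n * (x - c)) * real n) (at x)" for x
        by (rule DERIV_chain2[OF dS]) (auto intro!: derivative_eq_intros)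
      then have "((\<lambda>x. S (real n * (x - c))) has_vector_derivative k x) (at x within {0..R})" for x
        unfolding k_def has_real_derivative_iff_has_vector_derivative
        by (metis mult.commute has_vector_derivative_at_within)
      then have "(k has_integral (S (real n * (R - c)) - S (real n * (0 - c)))) {0..R}"
        using c by (intro fundamental_theorem_of_calculus) auto
      moreover have "S (real n * (R - c)) = 1"
      proof (rule S(3))
        have "1 * 1 \<le> real n * (R - c)" using c \<open>n > 0\<close> by (intro mult_mono) auto
        then show "1 \<le> real n * (R - c)" by simp
      qed
      moreover have "S (real n * (0 - c)) = 0" by (rule S(2)) (use c in simp)
      ultimately show ?thesis by simp
    qed
    have uR: "continuous_on {0..R} u" using u by (rule continuous_on_subset) auto
    have i1: "(\<lambda>x. k x *\<^sub>R u x) integrable_on {0..R}"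
      by (intro integrable_continuous_real continuous_on_scaleR k_cont uR)
    have "((\<lambda>x. k x *\<^sub>R u x - k x *\<^sub>R u c) has_integral
        (integral {0..R} (\<lambda>x. k x *\<^sub>R u x) - 1 *\<^sub>R u c)) {0..R}"
      by (intro has_integral_diff integrable_integral i1 has_integral_scaleR_left kint)
    then have I: "((\<lambda>x. k x *\<^sub>R (u x - u c)) has_integral
        (integral {0..R} (\<lambda>x. k x *\<^sub>R u x) - u c)) {0..R}"
      by (simp add: scaleR_diff_right)
    have "norm (integral {0..R} (\<lambda>x. k x *\<^sub>R (u x - u c))) \<le> integral {0..R} (\<lambda>x. k x * e)"
    proof (rule Henstock_Kurzweil_Integration.integral_norm_bound_integral)
      show "(\<lambda>x. k x *\<^sub>R (u x - u c)) integrable_on {0..R}" using I by blast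
      show "(\<lambda>x. k x * e) integrable_on {0..R}"
        by (rule integrable_on_mult_left) (use kint in blast)
      fix x assume x: "x \<in> {0..R}"
      show "norm (k x *\<^sub>R (u x - u c)) \<le> k x * e"
      proof (cases "0 \<le> real n * (x - c) \<and> real n * (x - c) \<le> 1")
        case True
        have "0 \<le> x - c" using True \<open>n > 0\<close> by (simp add: zero_le_mult_iff)
        moreover have "x - c < \<delta>"
        proof -
          have "x - c \<le> 1 / real n" using True \<open>n > 0\<close> by (simp add: field_simps)
          also have "\<dots> < \<delta>"
          proof -
            have "1 / \<delta> < real n" using N n by linarith
            then show ?thesis using \<open>\<delta> > 0\<close> \<open>n > 0\<close> by (simp add: field_simps)
          qed
          finally show ?thesis .
        qed
        ultimately have "dist (u x) (u c) < e" using x by (intro \<delta>) (auto simp: dist_real_def)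
        then have "norm (u x - u c) \<le> e" by (simp add: dist_norm)
        then show ?thesis using k_nonneg[of x] by (simp add: mult_left_mono)
      next
        case False
        then have "k x = 0" using S'0 by (auto simp: k_def not_le)
        then show ?thesis by simp
      qed
    qed
    also have "integral {0..R} (\<lambda>x. k x * e) = e"
      using integral_unique[OF has_integral_mult_left[OF kint, of e]] by simp
    finally show ?thesis using \<open>e < \<epsilon>\<close> unfolding integral_unique[OF I] by (simp add: k_def)
  qed
  then show "\<exists>no. \<forall>n\<ge>no. norm (integral {0..R} (\<lambda>x. (real n * deriv S (real n * (x - c))) *\<^sub>R u x) - u c) < \<epsilon>"
    by blast
qed

text \<open>Weak derivatives are stated with Lebesgue set integrals over the open half-line, the
  calculus with gauge integrals over compact intervals. \<open>f 0 = 0\<close> makes the two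
  integrands agree at every point rather than almost everywhere.\<close>

lemma set_integral_eq_integral_support:
  fixes f :: "real \<Rightarrow> complex"
  assumes "f absolutely_integrable_on {0..R}" and "f 0 = 0" "\<And>x. x > R \<Longrightarrow> f x = 0"
  shows "(LINT x:{0<..}|lebesgue. f x) = integral {0..R} f"
proof -
  have "(LINT x:{0<..}|lebesgue. f x) = (LINT x:{0..R}|lebesgue. f x)"
    unfolding set_lebesgue_integral_def
  proof (rule Bochner_Integration.integral_cong)
    fix x :: real
    consider "x < 0" | "x = 0" | "0 < x" "x \<le> R" | "x > R" "x > 0" by linarith
    then show "indicator {0<..} x *\<^sub>R f x = indicator {0..R} x *\<^sub>R f x"
      by cases (use assms(2,3) in \<open>auto simp: indicator_def\<close>)
  qed simp
  then show ?thesis using set_lebesgue_integral_eq_integral(2)[OF assms(1)] by simp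
qed

text \<open>The tests are smoothed indicators of \<open>(a, b]\<close>: their derivatives are two
  approximate point masses and produce \<open>u a - u b\<close>, while the other side tends to minus
  the integral of \<open>g\<close>. This fixes \<open>u\<close> up to a constant on the open
  half-line, and continuity carries the identity to 0.\<close>

lemma weak_deriv_imp_is_primitive:
  fixes u g :: "real \<Rightarrow> complex"
  assumes u: "continuous_on {0..} u" and g: "\<And>x. x \<ge> 0 \<Longrightarrow> g absolutely_integrable_on {0..x}"
    and weak: "weak_deriv {0<..} u g"
  shows "is_primitive u g"
proof -
  obtain S :: "real \<Rightarrow> real" where S: "smooth_fun S" "\<And>x. x \<le> 0 \<Longrightarrow> S x = 0"
    "\<And>x. 1 \<le> x \<Longrightarrow> S x = 1" "mono S"
    by (rule smooth_step_exists) blast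
  have S01: "0 \<le> S x" "S x \<le> 1" for x
    using S(2)[of "min x 0"] S(3)[of "max x 1"] monoD[OF S(4), of "min x 0" x] monoD[OF S(4), of x "max x 1"]
    by auto
  have increment: "u b - u a = integral {a..b} g" if ab: "0 < a" "a < b" for a b
  proof -
    \<comment> \<open>The descent of \<open>\<phi> n\<close> ends at \<open>b + 1 / n\<close>, so
      this \<open>R\<close> bounds all supports with \<open>n \<ge> 1\<close>.\<close>
    define R where "R = b + 1"
    have R: "0 \<le> R" "b < R" using ab by (auto simp: R_def)
    define \<phi> where "\<phi> n x = S (real n * (x - a)) - S (real n * (x - b))" for n :: nat and x
    have sm: "smooth_fun (\<phi> n)" for n
      using smooth_fun_affine_comb[OF S(1) S(1), of 1 "real n" "- real n * a" "-1" "real n" "- real n * b"]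
      by (simp add: \<phi>_def[abs_def] algebra_simps)
    have supp: "\<phi> n x = 0" if "x \<notin> {a..R}" "n > 0" for n x
    proof (cases "x < a")
      case True
      then show ?thesis using ab \<open>n > 0\<close>
        by (simp add: \<phi>_def S(2) mult_nonneg_nonpos)
    next
      case False
      then have "x > R" using that by auto
      then have "1 * 1 \<le> real n * (x - a)" "1 * 1 \<le> real n * (x - b)"
        using ab \<open>n > 0\<close> by (intro mult_mono; simp add: R_def)+
      then show ?thesis by (simp add: \<phi>_def S(3))
    qed
    have \<phi>_bound: "\<bar>\<phi> n x\<bar> \<le> 1" for n x
      using S01[of "real n * (x - a)"] S01[of "real n * (x - b)"] unfolding \<phi>_def by linarith
    have test: "test_fun {0<..} (\<phi> n)" if "n > 0" for n
    proof -
      have sub: "{x. \<phi> n x \<noteq> 0} \<subseteq> {a..R}"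
        using supp[OF _ that] by blast
      then have "closure {x. \<phi> n x \<noteq> 0} \<subseteq> {a..R}"
        by (intro closure_minimal) auto
      moreover have "compact (closure {x. \<phi> n x \<noteq> 0})"
        using bounded_subset[OF bounded_closed_interval sub] by simp
      ultimately show ?thesis
        using sm ab unfolding test_fun_def smooth_fun_def by force
    qed
    have dphi: "deriv (\<phi> n) x = real n * deriv S (real n * (x - a)) - real n * deriv S (real n * (x - b))" for n x
    proof -
      have "((\<lambda>x. S (real n * (x - c))) has_real_derivative deriv S (real n * (x - c)) * real n) (at x)" for c
        by (rule DERIV_chain2[OF smooth_fun_DERIV[OF S(1)]]) (auto intro!: derivative_eq_intros)
      from DERIV_diff[OF this[of a] this[of b]] show ?thesis
        unfolding \<phi>_def by (intro DERIV_imp_deriv) (simp add: mult.commute)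
    qed
    have uR: "continuous_on {0..R} u" using u by (rule continuous_on_subset) auto
    have gR: "g absolutely_integrable_on {0..R}" using g R by simp
    have \<phi>g_abs: "(\<lambda>x. \<phi> n x *\<^sub>R g x) absolutely_integrable_on {0..R}" for n
      using absolutely_integrable_mult_continuous(1)[OF gR, of "\<lambda>x. complex_of_real (\<phi> n x)"]
      by (simp add: scaleR_conv_of_real continuous_on_of_real smooth_fun_continuous[OF sm])
    have eq: "integral {0..R} (\<lambda>x. (real n * deriv S (real n * (x - a))) *\<^sub>R u x)
        - integral {0..R} (\<lambda>x. (real n * deriv S (real n * (x - b))) *\<^sub>R u x)
        = - integral {0..R} (\<lambda>x. \<phi> n x *\<^sub>R g x)" if "n > 0" for n
    proof -
      have zero: "deriv (\<phi> n) x = 0" if "x \<notin> {a..R}" for x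
        by (rule deriv_eq_0_open[of "- {a..R}" _ _ 0]) (use that supp[OF _ \<open>n > 0\<close>] in auto)
      have abs': "(\<lambda>x. deriv (\<phi> n) x *\<^sub>R u x) absolutely_integrable_on {0..R}"
        by (intro absolutely_integrable_continuous_real continuous_on_scaleR uR
            smooth_fun_continuous smooth_fun_deriv sm)
      have "integral {0..R} (\<lambda>x. deriv (\<phi> n) x *\<^sub>R u x)
          = (LINT x:{0<..}|lebesgue. deriv (\<phi> n) x *\<^sub>R u x)"
        using ab zero by (intro set_integral_eq_integral_support[symmetric] abs') auto
      also have "\<dots> = - (LINT x:{0<..}|lebesgue. \<phi> n x *\<^sub>R g x)"
        using weak test[OF that] by (simp add: weak_deriv_def)
      also have "(LINT x:{0<..}|lebesgue. \<phi> n x *\<^sub>R g x) = integral {0..R} (\<lambda>x. \<phi> n x *\<^sub>R g x)"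
        using ab supp[OF _ that] by (intro set_integral_eq_integral_support \<phi>g_abs) auto
      finally have *: "integral {0..R} (\<lambda>x. deriv (\<phi> n) x *\<^sub>R u x) = - integral {0..R} (\<lambda>x. \<phi> n x *\<^sub>R g x)" .
      have "integral {0..R} (\<lambda>x. deriv (\<phi> n) x *\<^sub>R u x) =
        integral {0..R} (\<lambda>x. (real n * deriv S (real n * (x - a))) *\<^sub>R u x)
        - integral {0..R} (\<lambda>x. (real n * deriv S (real n * (x - b))) *\<^sub>R u x)"
        unfolding dphi scaleR_diff_left
        by (intro Henstock_Kurzweil_Integration.integral_diff integrable_continuous_real continuous_on_scaleR uR continuous_on_rescaled_deriv[OF S(1)])
      then show ?thesis using * by simp
    qed
    have lim1: "(\<lambda>n. integral {0..R} (\<lambda>x. (real n * deriv S (real n * (x - a))) *\<^sub>R u x)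
        - integral {0..R} (\<lambda>x. (real n * deriv S (real n * (x - b))) *\<^sub>R u x)) \<longlonglongrightarrow> u a - u b"
      using ab by (intro tendsto_diff step_approx_identity[OF S u]) (auto simp: R_def)
    \<comment> \<open>Since \<open>S 0 = 0\<close>, the limit is the indicator of a half-open
      interval: at \<open>x = a\<close> the rising step vanishes, and at \<open>x = b\<close> the
      subtracted one does.\<close>
    have lim2: "(\<lambda>n. integral {0..R} (\<lambda>x. \<phi> n x *\<^sub>R g x)) \<longlonglongrightarrow>
        integral {0..R} (\<lambda>x. if x \<in> {a<..b} then g x else 0)"
    proof (rule dominated_convergence(2))
      show "(\<lambda>x. \<phi> n x *\<^sub>R g x) integrable_on {0..R}" for n
        by (rule set_lebesgue_integral_eq_integral(1)[OF \<phi>g_abs])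
      show "(\<lambda>x. norm (g x)) integrable_on {0..R}"
        using gR by (simp add: absolutely_integrable_on_def)
      show "norm (\<phi> n x *\<^sub>R g x) \<le> norm (g x)" for n x
        using mult_right_mono[OF \<phi>_bound, of "norm (g x)"] by simp
      fix x assume "x \<in> {0..R}"
      have large: "\<forall>\<^sub>F n in sequentially. S (real n * y) = 1" if "y > 0" for y
      proof -
        have "\<forall>\<^sub>F n in sequentially. real n \<ge> 1 / y"
          using filterlim_real_sequentially by (simp add: filterlim_at_top)
        then show ?thesis
          by (rule eventually_mono) (use that S(3) in \<open>simp add: field_simps\<close>)
      qed
      have small: "S (real n * y) = 0" if "y \<le> 0" for y n
        using that by (intro S(2)) (simp add: mult_nonneg_nonpos)
      have "\<forall>\<^sub>F n in sequentially. \<phi> n x = (if x \<in> {a<..b} then 1 else 0)"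
      proof -
        consider "x \<le> a" | "a < x" "x \<le> b" | "x > b" by linarith
        then show ?thesis
        proof cases
          case 1
          then show ?thesis using ab by (simp add: \<phi>_def small)
        next
          case 2
          then show ?thesis using large[of "x - a"] by (simp add: \<phi>_def small)
        next
          case 3
          then have "\<forall>\<^sub>F n in sequentially. S (real n * (x - a)) = 1" "\<forall>\<^sub>F n in sequentially. S (real n * (x - b)) = 1"
            using ab by (auto intro!: large)
          then show ?thesis
            by eventually_elim (use 3 ab in \<open>simp add: \<phi>_def\<close>)
        qed
      qed
      then have "\<forall>\<^sub>F n in sequentially. \<phi> n x *\<^sub>R g x = (if x \<in> {a<..b} then g x else 0)"
        by eventually_elim simp
      then show "(\<lambda>n. \<phi> n x *\<^sub>R g x) \<longlonglongrightarrow> (if x \<in> {a<..b} then g x else 0)"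
        by (rule tendsto_eventually)
    qed
    have "integral {0..R} (\<lambda>x. if x \<in> {a<..b} then g x else 0) = integral {0..R} (\<lambda>x. if x \<in> {a..b} then g x else 0)"
      by (rule integral_spike[of "{a}"]) auto
    also have "\<dots> = integral {a..b} g"
    proof -
      have "{a..b} \<inter> {0..R} = {a..b}" using ab R by auto
      then show ?thesis
        by (simp only: Henstock_Kurzweil_Integration.integral_restrict_Int)
    qed
    finally have lim3: "(\<lambda>n. - integral {0..R} (\<lambda>x. \<phi> n x *\<^sub>R g x)) \<longlonglongrightarrow> - integral {a..b} g"
      using tendsto_minus[OF lim2] by simp
    have "(\<lambda>n. - integral {0..R} (\<lambda>x. \<phi> n x *\<^sub>R g x)) \<longlonglongrightarrow> u a - u b"
      using lim1 by (rule Lim_transform_eventually) (use eq in \<open>auto simp: eventually_sequentially intro!: exI[of _ 1]\<close>)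
    then have "u a - u b = - integral {a..b} g"
      using lim3 LIMSEQ_unique by blast
    then show ?thesis by (simp add: algebra_simps)
  qed
  define G where "G x = 0 + integral {0..x} g" for x
  have G: "is_primitive G g" unfolding G_def by (rule is_primitive_exists) (rule g)
  define w where "w x = u x - G x" for x
  have w_cont: "continuous_on {0..} w"
    unfolding w_def by (intro continuous_on_diff u is_primitive_continuous[OF G])
  have w_eq: "w x = w 1" if x: "x > 0" for x
  proof -
    have *: "w a = w b" if "0 < a" "a < b" for a b
    proof -
      have "G b - G a = integral {a..b} g"
        using is_primitiveD(2)[OF G, of a b] that by (simp add: integral_unique)
      then show ?thesis using increment[OF that] by (simp add: w_def algebra_simps)
    qed
    consider "x < 1" | "x = 1" | "1 < x" by linarith
    then show ?thesis
    proof cases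
      case 1
      show ?thesis by (rule *[OF x 1])
    next
      case 3
      show ?thesis by (rule *[OF zero_less_one 3, symmetric])
    qed simp
  qed
  have w: "w x = w 1" if "x \<ge> 0" for x
  proof (rule continuous_constant_on_closure[of "{0<..}" w])
    have cl: "closure {0::real<..} = {0..}" by (rule closure_greaterThan)
    show "continuous_on (closure {0<..}) w" "x \<in> closure {0<..}" unfolding cl using w_cont that by auto
    show "w x = w 1" if "x \<in> {0<..}" for x using w_eq[of x] that by simp
  qed
  have "is_primitive (\<lambda>x. w 1 + G x) (\<lambda>x. 0 + g x)"
    by (rule is_primitive_add[OF is_primitive_const G])
  then show ?thesis
  proof (rule is_primitive_cong_AE)
    show "u x = w 1 + G x" if "x \<ge> 0" for x using w[OF that] by (simp add: w_def diff_eq_eq)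
  qed simp
qed

text \<open>A test function vanishes near 0 and beyond some \<open>R\<close>, so the product rule
  for \<open>u \<phi>\<close> on \<open>[0, R]\<close> has no boundary terms.\<close>

lemma is_primitive_imp_weak_deriv:
  fixes u g :: "real \<Rightarrow> complex"
  assumes u: "is_primitive u g"
  shows "weak_deriv {0<..} u g"
  unfolding weak_deriv_def
proof (intro allI impI)
  fix \<phi> assume test: "test_fun {0<..} \<phi>"
  note sm = test_fun_smooth[OF test]
  define K where "K = closure {x. \<phi> x \<noteq> 0}"
  have cpt: "compact K" and sub: "K \<subseteq> {0<..}"
    using test by (auto simp: test_fun_def K_def)
  obtain B where B: "\<And>x. x \<in> K \<Longrightarrow> norm x \<le> B"
    using compact_imp_bounded[OF cpt] by (auto simp: bounded_iff)
  define R where "R = max B 0 + 1"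
  have zero: "\<phi> x = 0" if "x \<notin> K" for x
    using that closure_subset[of "{x. \<phi> x \<noteq> 0}"] unfolding K_def by blast
  have zero': "deriv \<phi> x = 0" if "x \<notin> K" for x
    by (rule deriv_eq_0_open[of "- K" _ _ 0]) (use that zero compact_imp_closed[OF cpt] in auto)
  have out: "x \<notin> K" if "x \<le> 0 \<or> x \<ge> R" for x
    using that sub B[of x] by (auto simp: R_def)
  have "R \<ge> 0" by (simp add: R_def)
  have vd: "((\<lambda>x. complex_of_real (\<phi> x)) has_vector_derivative complex_of_real (deriv \<phi> x)) (at x)" for x
    using smooth_fun_DERIV[OF sm, of x]
    by (intro has_vector_derivative_of_real) (simp add: has_real_derivative_iff_has_vector_derivative)
  have P: "is_primitive (\<lambda>x. complex_of_real (\<phi> x)) (\<lambda>x. complex_of_real (deriv \<phi> x))"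
    by (rule is_primitive_C1[OF vd]) (intro continuous_on_of_real smooth_fun_continuous smooth_fun_deriv sm)
  have uR: "continuous_on {0..R} u"
    using is_primitive_continuous[OF u] by (rule continuous_on_subset) auto
  have a1: "(\<lambda>x. deriv \<phi> x *\<^sub>R u x) absolutely_integrable_on {0..R}"
    by (intro absolutely_integrable_continuous_real continuous_on_scaleR uR
            smooth_fun_continuous smooth_fun_deriv sm)
  have a2: "(\<lambda>x. \<phi> x *\<^sub>R g x) absolutely_integrable_on {0..R}"
    using absolutely_integrable_mult_continuous(1)[OF is_primitiveD(1)[OF u order_refl \<open>R \<ge> 0\<close>], of "\<lambda>x. complex_of_real (\<phi> x)"]
    by (simp add: scaleR_conv_of_real continuous_on_of_real smooth_fun_continuous[OF sm])
  have "((\<lambda>x. g x * complex_of_real (\<phi> x) + u x * complex_of_real (deriv \<phi> x)) has_integral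
      (u R * complex_of_real (\<phi> R) - u 0 * complex_of_real (\<phi> 0))) {0..R}"
    using is_primitiveD(2)[OF is_primitive_mult[OF u P] order_refl \<open>R \<ge> 0\<close>] .
  moreover have "\<phi> 0 = 0" using zero[OF out] by simp
  moreover have "\<phi> R = 0" using zero[OF out] by simp
  ultimately have "((\<lambda>x. \<phi> x *\<^sub>R g x + deriv \<phi> x *\<^sub>R u x) has_integral 0) {0..R}"
    by (simp add: scaleR_conv_of_real mult.commute)
  then have "integral {0..R} (\<lambda>x. \<phi> x *\<^sub>R g x) + integral {0..R} (\<lambda>x. deriv \<phi> x *\<^sub>R u x) = 0"
    using Henstock_Kurzweil_Integration.integral_add[OF set_lebesgue_integral_eq_integral(1)[OF a2] set_lebesgue_integral_eq_integral(1)[OF a1]]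
    by (simp add: integral_unique)
  moreover have "(LINT x:{0<..}|lebesgue. deriv \<phi> x *\<^sub>R u x) = integral {0..R} (\<lambda>x. deriv \<phi> x *\<^sub>R u x)"
    by (intro set_integral_eq_integral_support a1) (simp_all add: zero'[OF out])
  moreover have "(LINT x:{0<..}|lebesgue. \<phi> x *\<^sub>R g x) = integral {0..R} (\<lambda>x. \<phi> x *\<^sub>R g x)"
    by (intro set_integral_eq_integral_support a2) (simp_all add: zero[OF out])
  ultimately show "(LINT x:{0<..}|lebesgue. deriv \<phi> x *\<^sub>R u x) = - (LINT x:{0<..}|lebesgue. \<phi> x *\<^sub>R g x)"
    by (simp add: eq_neg_iff_add_eq_0 add.commute)
qed

section \<open>Energy estimates on the half-line\<close>

text \<open>The squared norm on the half-line, as a gauge integral to match primitives. It is 0 by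
  convention when the square is not integrable, so an upper bound on it carries information only
  together with \<open>L2\<close>.\<close>

definition energy :: "(real \<Rightarrow> complex) \<Rightarrow> real" where
  "energy f = integral {0..} (\<lambda>x. (cmod (f x))^2)"

lemma L2_half_iff:
  fixes f :: "real \<Rightarrow> complex"
  shows "L2 {0<..} f \<longleftrightarrow>
    f \<in> borel_measurable (lebesgue_on {0..}) \<and> (\<lambda>x. (cmod (f x))^2) integrable_on {0..}"
proof -
  have AE: "AE x in lebesgue. (indicator {0<..} x *\<^sub>R f x :: complex) = indicator {0..} x *\<^sub>R f x"
  proof -
    have "{0::real} \<in> null_sets lebesgue" by (simp add: negligible_iff_null_sets[symmetric])
    then show ?thesis by (rule AE_I') (auto simp: indicator_def)
  qed
  have "set_borel_measurable lebesgue {0<..} f \<longleftrightarrow> set_borel_measurable lebesgue {0..} f"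
    unfolding set_borel_measurable_def
    using borel_measurable_AE[OF _ AE] borel_measurable_AE[OF _ AE[THEN AE_symmetric]] by blast
  moreover have "set_borel_measurable lebesgue {0..} f \<longleftrightarrow> f \<in> borel_measurable (lebesgue_on {0..})"
    unfolding set_borel_measurable_def by (subst borel_measurable_restrict_space_iff) auto
  moreover have "set_integrable lebesgue {0<..} (\<lambda>x. (cmod (f x))^2) \<longleftrightarrow> (\<lambda>x. (cmod (f x))^2) integrable_on {0..}"
  proof -
    have eq: "{0<..} - {0..} \<union> ({0..} - {0<..}) = {0::real}" by auto
    have "(\<lambda>x. (cmod (f x))^2) integrable_on {0<..} \<longleftrightarrow> (\<lambda>x. (cmod (f x))^2) integrable_on {0..}"
      by (rule integrable_spike_set_eq) (simp add: eq)
    then show ?thesis by (subst absolutely_integrable_on_iff_nonneg) auto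
  qed
  ultimately show ?thesis by (simp add: L2_def)
qed

lemma energy_nonneg: "energy f \<ge> 0"
  unfolding energy_def by (cases "(\<lambda>x. (cmod (f x))^2) integrable_on {0..}")
    (auto intro: Henstock_Kurzweil_Integration.integral_nonneg simp: not_integrable_integral)

lemma L2_half_integrable_Icc:
  assumes "L2 {0<..} f" "0 \<le> a"
  shows "(\<lambda>x. (cmod (f x))^2) integrable_on {a..b}"
  using assms by (intro integrable_on_subinterval[of _ "{0..}"]) (auto simp: L2_half_iff)

lemma integral_Icc_le_energy:
  assumes "L2 {0<..} f"
  shows "integral {0..x} (\<lambda>x. (cmod (f x))^2) \<le> energy f"
  unfolding energy_def using assms L2_half_integrable_Icc[OF assms, of 0 x]
  by (intro integral_subset_le) (auto simp: L2_half_iff)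

text \<open>\<open>2 t \<le> 1 + t^2\<close> bounds \<open>cmod (f t)\<close> by a function
  integrable on each bounded interval, so primitives of square-integrable sources exist.\<close>

lemma L2_half_absolutely_integrable:
  fixes f :: "real \<Rightarrow> complex"
  assumes "L2 {0<..} f"
  shows "f absolutely_integrable_on {0..x}"
proof (rule measurable_bounded_by_integrable_imp_absolutely_integrable)
  show "f \<in> borel_measurable (lebesgue_on {0..x})"
    using assms by (intro measurable_restrict_mono[where B = "{0..x}" and A = "{0..}"]) (auto simp: L2_half_iff)
  show "(\<lambda>x. 1 + (cmod (f x))^2) integrable_on {0..x}"
    by (intro integrable_add integrable_const_ivl L2_half_integrable_Icc assms order_refl)
  show "cmod (f t) \<le> 1 + (cmod (f t))^2" for t
  proof -
    have "0 \<le> (cmod (f t) - 1)^2" by simp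
    then have "2 * cmod (f t) \<le> 1 + (cmod (f t))^2" by (simp add: power2_diff)
    then show ?thesis using norm_ge_zero[of "f t"] by linarith
  qed
qed simp

text \<open>A triangle inequality for squares. The factor 2 is harmless and keeps all estimates
  quadratic, hence additive over the two sides and the two components.\<close>

lemma cmod_comb_squared:
  "(cmod (a * x + b * y))^2 \<le> 2 * (cmod a)^2 * (cmod x)^2 + 2 * (cmod b)^2 * (cmod y)^2"
proof -
  have "(cmod (a * x + b * y))^2 \<le> (cmod (a * x) + cmod (b * y))^2"
    by (intro power_mono norm_triangle_ineq) simp
  also have "\<dots> \<le> 2 * (cmod (a * x))^2 + 2 * (cmod (b * y))^2"
    using zero_le_power2[of "cmod (a * x) - cmod (b * y)"] by (simp add: power2_sum power2_diff)
  finally show ?thesis by (simp add: norm_mult power_mult_distrib)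
qed

lemma L2_half_comb:
  assumes "L2 {0<..} f" "L2 {0<..} g"
  shows "L2 {0<..} (\<lambda>x. a * f x + b * g x)" (is ?L)
    and "energy (\<lambda>x. a * f x + b * g x) \<le> 2 * (cmod a)^2 * energy f + 2 * (cmod b)^2 * energy g" (is ?E)
proof -
  have f: "f \<in> borel_measurable (lebesgue_on {0..})" "(\<lambda>x. (cmod (f x))^2) integrable_on {0..}"
    and g: "g \<in> borel_measurable (lebesgue_on {0..})" "(\<lambda>x. (cmod (g x))^2) integrable_on {0..}"
    using assms by (auto simp: L2_half_iff)
  have m[measurable]: "(\<lambda>x. a * f x + b * g x) \<in> borel_measurable (lebesgue_on {0..})"
    using f(1) g(1) by measurable
  define B where "B x = 2 * (cmod a)^2 * (cmod (f x))^2 + 2 * (cmod b)^2 * (cmod (g x))^2" for x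
  have B: "(B has_integral (2 * (cmod a)^2 * energy f + 2 * (cmod b)^2 * energy g)) {0..}"
    unfolding B_def energy_def
    by (intro has_integral_add has_integral_mult_right integrable_integral f g)
  have I: "(\<lambda>x. (cmod (a * f x + b * g x))^2) integrable_on {0..}"
  proof (rule measurable_bounded_by_integrable_imp_integrable)
    show "(\<lambda>x. (cmod (a * f x + b * g x))^2) \<in> borel_measurable (lebesgue_on {0..})" by measurable
    show "B integrable_on {0..}" using B by blast
    show "norm ((cmod (a * f x + b * g x))^2) \<le> B x" for x
      unfolding B_def using cmod_comb_squared by simp
  qed simp
  then show ?L using m by (simp add: L2_half_iff)
  show ?E
    unfolding energy_def[of "\<lambda>x. a * f x + b * g x"]
    by (rule has_integral_le[OF integrable_integral[OF I] B]) (simp add: B_def cmod_comb_squared)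
qed

text \<open>Monotone convergence for the truncations to \<open>[0, k]\<close>. It turns energy
  bounds that are uniform in the endpoint into square-integrability and a norm bound at
  once.\<close>

lemma L2_half_of_bounded_integrals:
  assumes f: "continuous_on {0..} f"
    and K: "\<And>x. x \<ge> 0 \<Longrightarrow> integral {0..x} (\<lambda>x. (cmod (f x))^2) \<le> K"
  shows "L2 {0<..} f" "energy f \<le> K"
proof -
  define h where "h k x = (if x \<in> {0..real k} then (cmod (f x))^2 else 0)" for k :: nat and x
  have f': "(\<lambda>x. (cmod (f x))^2) integrable_on {0..real k}" for k
    by (intro integrable_continuous_real continuous_intros continuous_on_subset[OF f]) auto
  have hI: "(h k has_integral integral {0..real k} (\<lambda>x. (cmod (f x))^2)) {0..}" for k
    unfolding h_def by (subst has_integral_restrict) (auto intro: integrable_integral[OF f'])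
  have b: "integral {0..} (h k) \<le> K" "0 \<le> integral {0..} (h k)" for k
    using K[of "real k"] integral_unique[OF hI] has_integral_nonneg[OF hI, of k] by (auto simp: h_def)
  have "(\<lambda>x. (cmod (f x))^2) integrable_on {0..} \<and> (\<lambda>k. integral {0..} (h k)) \<longlonglongrightarrow> energy f"
    unfolding energy_def
  proof (rule monotone_convergence_increasing)
    show "h k integrable_on {0..}" for k using hI by blast
    show "h k x \<le> h (Suc k) x" for k x by (simp add: h_def)
    show "bounded (range (\<lambda>k. integral {0..} (h k)))"
      using b by (intro boundedI[of _ K]) auto
    fix x :: real assume x: "x \<in> {0..}"
    obtain N :: nat where N: "x \<le> real N" using real_arch_simple by blast
    have "h k x = (cmod (f x))^2" if "k \<ge> N" for k
    proof -
      have "x \<le> real k" using N that by linarith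
      then show ?thesis using x by (simp add: h_def)
    qed
    then have "\<forall>\<^sub>F k in sequentially. h k x = (cmod (f x))^2"
      by (auto simp: eventually_sequentially)
    then show "(\<lambda>k. h k x) \<longlonglongrightarrow> (cmod (f x))^2" by (rule tendsto_eventually)
  qed
  then show "L2 {0<..} f" "energy f \<le> K"
    using b(1) continuous_imp_measurable_on_sets_lebesgue[OF f] LIMSEQ_le_const2[of _ "energy f" K]
    by (auto simp: L2_half_iff)
qed

text \<open>This is the integrated form of \<open>(|w|^2)' = 2 Re (w' cnj w)\<close>, from the
  product rule for \<open>w\<close> and its conjugate.\<close>

lemma is_primitive_energy_identity:
  assumes w: "is_primitive w (\<lambda>x. \<kappa> * w x + F x)" and x: "x \<ge> 0"
  shows "((\<lambda>t. 2 * Re \<kappa> * (cmod (w t))^2 + 2 * Re (F t * cnj (w t))) has_integral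
    ((cmod (w x))^2 - (cmod (w 0))^2)) {0..x}"
proof -
  have int: "((\<lambda>t. (\<kappa> * w t + F t) * cnj (w t) + w t * cnj (\<kappa> * w t + F t)) has_integral
      (w x * cnj (w x) - w 0 * cnj (w 0))) {0..x}"
    using is_primitiveD(2)[OF is_primitive_mult[OF w is_primitive_cnj[OF w]] order_refl x] .
  have Re_cnj: "Re (y * cnj y) = (cmod y)^2" for y
    unfolding cmod_power2 by (simp add: power2_eq_square)
  from has_integral_linear[OF int bounded_linear_Re]
  have "((\<lambda>t. Re ((\<kappa> * w t + F t) * cnj (w t) + w t * cnj (\<kappa> * w t + F t))) has_integral
      ((cmod (w x))^2 - (cmod (w 0))^2)) {0..x}"
    unfolding o_def minus_complex.simps Re_cnj .
  moreover have "Re ((\<kappa> * w t + F t) * cnj (w t) + w t * cnj (\<kappa> * w t + F t))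
      = 2 * Re \<kappa> * (cmod (w t))^2 + 2 * Re (F t * cnj (w t))" for t
    unfolding cmod_power2 by (simp add: algebra_simps power2_eq_square)
  ultimately show ?thesis by simp
qed

text \<open>Young's inequality with weight \<open>\<rho>\<close>: of the coefficient
  \<open>2 \<rho>\<close> in the energy identity, one \<open>\<rho>\<close> absorbs the source term
  and the other remains.\<close>

lemma two_Re_mult_cnj_bound:
  assumes "\<rho> > 0"
  shows "\<bar>2 * Re (a * cnj b)\<bar> \<le> \<rho> * (cmod b)^2 + (cmod a)^2 / \<rho>"
proof -
  have "\<bar>2 * Re (a * cnj b)\<bar> \<le> 2 * (cmod a * cmod b)"
    using abs_Re_le_cmod[of "a * cnj b"] by (simp add: norm_mult)
  moreover have "0 \<le> (\<rho> * cmod b - cmod a)^2 / \<rho>" using assms by simp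
  moreover have "(\<rho> * cmod b - cmod a)^2 / \<rho> = \<rho> * (cmod b)^2 + (cmod a)^2 / \<rho> - 2 * (cmod a * cmod b)"
    using assms by (simp add: power2_eq_square field_simps)
  ultimately show ?thesis by linarith
qed

lemma decaying_energy_estimate:
  assumes \<rho>: "\<rho> > 0" "Re \<kappa> = - \<rho>" and F: "L2 {0<..} F"
    and w: "is_primitive w (\<lambda>x. \<kappa> * w x + F x)" and x: "x \<ge> 0"
  shows "(cmod (w x))^2 + \<rho> * integral {0..x} (\<lambda>t. (cmod (w t))^2) \<le> (cmod (w 0))^2 + energy F / \<rho>"
proof -
  have wI: "(\<lambda>t. (cmod (w t))^2) integrable_on {0..x}"
    by (intro integrable_continuous_real continuous_intros continuous_on_subset[OF is_primitive_continuous[OF w]]) auto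
  have "(cmod (w x))^2 - (cmod (w 0))^2 \<le>
      (- \<rho>) * integral {0..x} (\<lambda>t. (cmod (w t))^2) + integral {0..x} (\<lambda>t. (cmod (F t))^2) / \<rho>"
  proof (rule has_integral_le[OF is_primitive_energy_identity[OF w x]])
    show "((\<lambda>t. (- \<rho>) * (cmod (w t))^2 + (cmod (F t))^2 / \<rho>) has_integral
      ((- \<rho>) * integral {0..x} (\<lambda>t. (cmod (w t))^2) + integral {0..x} (\<lambda>t. (cmod (F t))^2) / \<rho>)) {0..x}"
      by (intro has_integral_add has_integral_mult_right has_integral_divide integrable_integral wI
          L2_half_integrable_Icc[OF F] order_refl)
    show "2 * Re \<kappa> * (cmod (w t))^2 + 2 * Re (F t * cnj (w t)) \<le> (- \<rho>) * (cmod (w t))^2 + (cmod (F t))^2 / \<rho>" for t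
      using two_Re_mult_cnj_bound[OF \<rho>(1), of "F t" "w t"] \<rho>(2) by simp
  qed
  moreover have "integral {0..x} (\<lambda>t. (cmod (F t))^2) / \<rho> \<le> energy F / \<rho>"
    using integral_Icc_le_energy[OF F] \<rho>(1) by (simp add: divide_right_mono)
  ultimately show ?thesis by simp
qed

text \<open>With the sign mirrored, the past is bounded by the present value \<open>w x\<close>.
  That value has to be controlled by other means, either square-integrability or an explicit
  formula.\<close>

lemma growing_energy_estimate:
  assumes \<rho>: "\<rho> > 0" "Re \<kappa> = \<rho>" and F: "L2 {0<..} F"
    and w: "is_primitive w (\<lambda>x. \<kappa> * w x + F x)" and x: "x \<ge> 0"
  shows "(cmod (w 0))^2 + \<rho> * integral {0..x} (\<lambda>t. (cmod (w t))^2) \<le> (cmod (w x))^2 + energy F / \<rho>"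
proof -
  have wI: "(\<lambda>t. (cmod (w t))^2) integrable_on {0..x}"
    by (intro integrable_continuous_real continuous_intros continuous_on_subset[OF is_primitive_continuous[OF w]]) auto
  have "\<rho> * integral {0..x} (\<lambda>t. (cmod (w t))^2) - integral {0..x} (\<lambda>t. (cmod (F t))^2) / \<rho> \<le>
      (cmod (w x))^2 - (cmod (w 0))^2"
  proof (rule has_integral_le[OF _ is_primitive_energy_identity[OF w x]])
    show "((\<lambda>t. \<rho> * (cmod (w t))^2 - (cmod (F t))^2 / \<rho>) has_integral
      (\<rho> * integral {0..x} (\<lambda>t. (cmod (w t))^2) - integral {0..x} (\<lambda>t. (cmod (F t))^2) / \<rho>)) {0..x}"
      by (intro has_integral_diff has_integral_mult_right has_integral_divide integrable_integral wI
          L2_half_integrable_Icc[OF F] order_refl)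
    show "\<rho> * (cmod (w t))^2 - (cmod (F t))^2 / \<rho> \<le> 2 * Re \<kappa> * (cmod (w t))^2 + 2 * Re (F t * cnj (w t))" for t
      using two_Re_mult_cnj_bound[OF \<rho>(1), of "F t" "w t"] \<rho>(2) by simp
  qed
  moreover have "integral {0..x} (\<lambda>t. (cmod (F t))^2) / \<rho> \<le> energy F / \<rho>"
    using integral_Icc_le_energy[OF F] \<rho>(1) by (simp add: divide_right_mono)
  ultimately show ?thesis by simp
qed

text \<open>Every solution of the decaying equation is square-integrable, whatever its value at 0;
  this is the origin of the one free constant on each half-line.\<close>

lemma decaying_solution_bound:
  assumes "Re \<kappa> < 0" and F: "L2 {0<..} F" and w: "is_primitive w (\<lambda>x. \<kappa> * w x + F x)"
  shows "L2 {0<..} w" "energy w \<le> ((cmod (w 0))^2 + energy F / (- Re \<kappa>)) / (- Re \<kappa>)"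
proof -
  have "integral {0..x} (\<lambda>t. (cmod (w t))^2) \<le> ((cmod (w 0))^2 + energy F / (- Re \<kappa>)) / (- Re \<kappa>)"
    if "x \<ge> 0" for x
  proof -
    have "(- Re \<kappa>) * integral {0..x} (\<lambda>t. (cmod (w t))^2) \<le> (cmod (w 0))^2 + energy F / (- Re \<kappa>)"
      using decaying_energy_estimate[OF _ _ F w that, of "- Re \<kappa>"] assms(1) zero_le_power2[of "cmod (w x)"]
      by linarith
    then show ?thesis using assms(1) by (simp add: le_divide_eq mult.commute del: divide_minus_right)
  qed
  from L2_half_of_bounded_integrals[OF is_primitive_continuous[OF w] this]
  show "L2 {0<..} w" "energy w \<le> ((cmod (w 0))^2 + energy F / (- Re \<kappa>)) / (- Re \<kappa>)"
    by blast+
qed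

text \<open>The estimate at \<open>x\<close> contains \<open>cmod (w x)\<close>, which
  square-integrability removes: were the bound violated by \<open>K > 0\<close> at some
  \<open>y\<close>, then \<open>(cmod (w x))^2 \<ge> K\<close> for all \<open>x \<ge> y\<close>,
  against finite energy. In particular \<open>w 0\<close> is controlled by the source alone.\<close>

lemma growing_solution_bound:
  assumes \<rho>: "Re \<kappa> > 0" and F: "L2 {0<..} F" and w: "is_primitive w (\<lambda>x. \<kappa> * w x + F x)"
    and L2: "L2 {0<..} w"
  shows "(cmod (w 0))^2 + Re \<kappa> * energy w \<le> energy F / Re \<kappa>"
proof -
  have div: "a \<le> (c - b) / Re \<kappa> \<longleftrightarrow> b + Re \<kappa> * a \<le> c" for a b c
    by (simp add: pos_le_divide_eq[OF \<rho>] algebra_simps)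
  have *: "(cmod (w 0))^2 + Re \<kappa> * integral {0..y} (\<lambda>t. (cmod (w t))^2) \<le> energy F / Re \<kappa>"
    if y: "y \<ge> 0" for y
  proof (rule ccontr)
    define K where "K = (cmod (w 0))^2 + Re \<kappa> * integral {0..y} (\<lambda>t. (cmod (w t))^2) - energy F / Re \<kappa>"
    assume "\<not> ?thesis"
    then have "K > 0" by (simp add: K_def)
    have ge: "K \<le> (cmod (w x))^2" if "x \<ge> y" for x
    proof -
      have "integral {0..y} (\<lambda>t. (cmod (w t))^2) \<le> integral {0..x} (\<lambda>t. (cmod (w t))^2)"
        using that by (intro integral_subset_le L2_half_integrable_Icc[OF L2]) auto
      then have "Re \<kappa> * integral {0..y} (\<lambda>t. (cmod (w t))^2) \<le> Re \<kappa> * integral {0..x} (\<lambda>t. (cmod (w t))^2)"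
        using \<rho> by simp
      then show ?thesis
        using growing_energy_estimate[OF \<rho> refl F w, of x] that y by (simp add: K_def)
    qed
    \<comment> \<open>Far enough out that \<open>K (x - y) = energy w + 1\<close> exceeds the whole
      energy.\<close>
    define x where "x = y + (energy w + 1) / K"
    have "x \<ge> y" using \<open>K > 0\<close> energy_nonneg[of w] by (simp add: x_def)
    have "((\<lambda>t. K) has_integral K * (x - y)) {y..x}"
      using has_integral_const_real[of K y x] \<open>x \<ge> y\<close> by (simp add: mult.commute)
    then have "K * (x - y) \<le> integral {y..x} (\<lambda>t. (cmod (w t))^2)"
      by (rule has_integral_le[OF _ integrable_integral[OF L2_half_integrable_Icc[OF L2 y]]]) (use ge in auto)
    also have "\<dots> \<le> integral {0..x} (\<lambda>t. (cmod (w t))^2)"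
      using y by (intro integral_subset_le L2_half_integrable_Icc[OF L2]) auto
    also have "\<dots> \<le> energy w" by (rule integral_Icc_le_energy[OF L2])
    finally show False using \<open>K > 0\<close> by (simp add: x_def)
  qed
  have "integral {0..y} (\<lambda>t. (cmod (w t))^2) \<le> (energy F / Re \<kappa> - (cmod (w 0))^2) / Re \<kappa>" if "y \<ge> 0" for y
    unfolding div by (rule *[OF that])
  then have "energy w \<le> (energy F / Re \<kappa> - (cmod (w 0))^2) / Re \<kappa>"
    by (rule L2_half_of_bounded_integrals(2)[OF is_primitive_continuous[OF w]])
  then show ?thesis unfolding div .
qed

section \<open>Solutions by variation of constants\<close>

lemma linear_ode_solution:
  assumes F: "\<And>x. x \<ge> 0 \<Longrightarrow> F absolutely_integrable_on {0..x}"
  shows "is_primitive (\<lambda>x. exp (\<kappa> * of_real x) * (a + integral {0..x} (\<lambda>t. exp (- \<kappa> * of_real t) * F t)))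
    (\<lambda>x. \<kappa> * (exp (\<kappa> * of_real x) * (a + integral {0..x} (\<lambda>t. exp (- \<kappa> * of_real t) * F t))) + F x)"
proof -
  have E: "is_primitive (\<lambda>x. exp (\<kappa> * of_real x)) (\<lambda>x. \<kappa> * exp (\<kappa> * of_real x))"
  proof (rule is_primitive_C1)
    show "((\<lambda>x. exp (\<kappa> * of_real x)) has_vector_derivative \<kappa> * exp (\<kappa> * of_real x)) (at x)" for x
    proof -
      have "((\<lambda>z. exp (\<kappa> * z)) has_field_derivative \<kappa> * exp (\<kappa> * of_real x)) (at (of_real x))"
        by (auto intro!: derivative_eq_intros)
      from has_vector_derivative_real_field[OF this] show ?thesis .
    qed
  qed (intro continuous_intros)
  have I: "is_primitive (\<lambda>x. a + integral {0..x} (\<lambda>t. exp (- \<kappa> * of_real t) * F t)) (\<lambda>t. exp (- \<kappa> * of_real t) * F t)"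
    by (intro is_primitive_exists absolutely_integrable_mult_continuous F)
      (assumption | intro continuous_intros)+
  have "exp (\<kappa> * of_real x) * (exp (- \<kappa> * of_real x) * y) = y" for x :: real and y
    by (simp add: exp_minus)
  with is_primitive_mult[OF E I] show ?thesis by (simp only: mult.assoc)
qed

lemma decaying_solution_exists:
  assumes "L2 {0<..} F"
  shows "\<exists>w. is_primitive w (\<lambda>x. \<kappa> * w x + F x) \<and> w 0 = a"
proof -
  show ?thesis
    by (rule exI, rule conjI, rule linear_ode_solution[OF L2_half_absolutely_integrable[OF assms], of \<kappa> a]) simp
qed

text \<open>The initial value cancels the growing exponential: it makes \<open>w x\<close> equal to
  minus the integral over \<open>{x..}\<close> of \<open>exp (\<kappa> (x - t)) F t\<close>. This is
  bounded in \<open>x\<close>, and the growing energy estimate upgrades boundedness to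
  square-integrability.\<close>

lemma growing_solution_exists:
  assumes \<rho>: "Re \<kappa> > 0" and F: "L2 {0<..} F"
  shows "\<exists>w. is_primitive w (\<lambda>x. \<kappa> * w x + F x) \<and> L2 {0<..} w"
proof -
  define r where "r = Re \<kappa>"
  define E where "E t = exp (- \<kappa> * of_real t) * F t" for t :: real
  have Fm: "F \<in> borel_measurable (lebesgue_on {0..})" and Fi: "(\<lambda>x. (cmod (F x))^2) integrable_on {0..}"
    using F by (auto simp: L2_half_iff)
  have r: "r > 0" using \<rho> by (simp add: r_def)
  have exp_sq: "(exp (r * s))^2 = exp (2 * r * s)" for s by (simp add: power2_eq_square flip: exp_add)
  \<comment> \<open>The inequality of arithmetic and geometric means separates the kernel
    \<open>exp (r (x - t))\<close> from \<open>F\<close>, so that both parts are integrable over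
    \<open>{x..}\<close>.\<close>
  have cE: "cmod (exp (\<kappa> * of_real x) * E t) \<le> (exp (- (2 * r) * t) * exp (2 * r * x) + (cmod (F t))^2) / 2" for x t
  proof -
    define s where "s = exp (r * (x - t))"
    have "cmod (exp (\<kappa> * of_real x) * E t) = s * cmod (F t)"
      unfolding E_def norm_mult norm_exp_eq_Re s_def r_def
      by (simp add: right_diff_distrib exp_diff exp_minus divide_inverse)
    also have "\<dots> \<le> (s^2 + (cmod (F t))^2) / 2"
      using zero_le_power2[of "s - cmod (F t)"] by (simp add: power2_diff)
    also have "s^2 = exp (- (2 * r) * t) * exp (2 * r * x)"
      unfolding s_def exp_sq by (simp add: right_diff_distrib flip: exp_add)
    finally show ?thesis .
  qed
  have sub: "(\<lambda>x. (cmod (F x))^2) integrable_on {x..}" if "x \<ge> 0" for x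
  proof -
    have "set_integrable lebesgue {0..} (\<lambda>x. (cmod (F x))^2)"
      using Fi by (subst absolutely_integrable_on_iff_nonneg) auto
    then have "set_integrable lebesgue {x..} (\<lambda>x. (cmod (F x))^2)"
      by (rule set_integrable_subset) (use that in auto)
    then show ?thesis by (rule set_lebesgue_integral_eq_integral(1))
  qed
  have bI: "((\<lambda>t. (exp (- (2 * r) * t) * exp (2 * r * x) + (cmod (F t))^2) / 2) has_integral
      (exp (- (2 * r) * x) / (2 * r) * exp (2 * r * x) + integral {x..} (\<lambda>t. (cmod (F t))^2)) / 2) {x..}"
    if "x \<ge> 0" for x
    using r by (intro has_integral_divide has_integral_add has_integral_mult_left integrable_integral
        has_integral_exp_minus_to_infinity sub[OF that]) simp
  have EI: "E integrable_on {x..}" if x: "x \<ge> 0" for x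
  proof (rule measurable_bounded_by_integrable_imp_integrable)
    have "F \<in> borel_measurable (lebesgue_on {x..})"
      using Fm by (rule measurable_restrict_mono) (use x in auto)
    moreover have "(\<lambda>t. exp (- \<kappa> * of_real t)) \<in> borel_measurable (lebesgue_on {x..})"
      by (intro continuous_imp_measurable_on_sets_lebesgue continuous_intros) auto
    ultimately show "E \<in> borel_measurable (lebesgue_on {x..})"
      unfolding E_def by (rule borel_measurable_times[rotated])
    show "(\<lambda>t. (exp (- (2 * r) * t) + (cmod (F t))^2) / 2) integrable_on {x..}"
      using r by (intro integrable_on_divide integrable_add sub[OF x] has_integral_integrable[OF has_integral_exp_minus_to_infinity]) simp
    show "cmod (E t) \<le> (exp (- (2 * r) * t) + (cmod (F t))^2) / 2" for t
      using cE[of 0 t] by simp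
  qed simp
  define a where "a = - integral {0..} E"
  define w where "w x = exp (\<kappa> * of_real x) * (a + integral {0..x} E)" for x :: real
  have w: "is_primitive w (\<lambda>x. \<kappa> * w x + F x)"
    unfolding w_def E_def by (rule linear_ode_solution[OF L2_half_absolutely_integrable[OF F]])
  \<comment> \<open>The function \<open>exp (2 r (x - t))\<close> has integral
    \<open>1 / (2 r)\<close> over \<open>{x..}\<close>, independently of \<open>x\<close>.\<close>
  define B where "B = (1 / (2 * r) + energy F) / 2"
  have w_bound: "cmod (w x) \<le> B" if x: "x \<ge> 0" for x
  proof -
    have "integral {0..} E = integral {0..x} E + integral {x..} E"
    proof -
      have "{0..} = {0..x} \<union> {x..}" using x by auto
      moreover have "E integrable_on {0..x}"
        using EI[of 0] by (rule integrable_on_subinterval) auto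
      moreover have "{0..x} \<inter> {x..} = {x}" using x by auto
      ultimately show ?thesis
        using EI[OF x] by (metis integral_Un negligible_sing)
    qed
    then have "w x = - integral {x..} (\<lambda>t. exp (\<kappa> * of_real x) * E t)"
      by (simp add: w_def a_def)
    then have "cmod (w x) = cmod (integral {x..} (\<lambda>t. exp (\<kappa> * of_real x) * E t))" by simp
    also have "\<dots> \<le> integral {x..} (\<lambda>t. (exp (- (2 * r) * t) * exp (2 * r * x) + (cmod (F t))^2) / 2)"
      using EI[OF x] bI[OF x] cE by (intro Henstock_Kurzweil_Integration.integral_norm_bound_integral integrable_on_mult_right) blast+
    also have "\<dots> = (exp (- (2 * r) * x) / (2 * r) * exp (2 * r * x) + integral {x..} (\<lambda>t. (cmod (F t))^2)) / 2"
      by (rule integral_unique[OF bI[OF x]])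
    also have "\<dots> = (1 / (2 * r) + integral {x..} (\<lambda>t. (cmod (F t))^2)) / 2"
      by (simp add: exp_minus)
    also have "\<dots> \<le> B"
    proof -
      have "integral {x..} (\<lambda>t. (cmod (F t))^2) \<le> energy F"
        unfolding energy_def using x by (intro integral_subset_le sub Fi) auto
      then show ?thesis by (simp add: B_def)
    qed
    finally show ?thesis .
  qed
  have "integral {0..x} (\<lambda>t. (cmod (w t))^2) \<le> (B^2 + energy F / r) / r" if x: "x \<ge> 0" for x
  proof -
    have "(cmod (w x))^2 \<le> B^2" using w_bound[OF x] by (intro power_mono) auto
    then have "r * integral {0..x} (\<lambda>t. (cmod (w t))^2) \<le> B^2 + energy F / r"
      using growing_energy_estimate[OF r r_def[symmetric] F w x] zero_le_power2[of "cmod (w 0)"] by linarith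
    then show ?thesis using r by (simp add: pos_le_divide_eq mult.commute)
  qed
  then have "L2 {0<..} w"
    using L2_half_of_bounded_integrals(1)[OF is_primitive_continuous[OF w]] by blast
  then show ?thesis using w by blast
qed

section \<open>Square-integrable functions on the line\<close>

text \<open>Reflection is differentiable, and differentiable images of negligible sets are
  negligible.\<close>

lemma AE_lebesgue_reflect:
  assumes "AE x in lebesgue. P (x::real)"
  shows "AE x in lebesgue. P (- x)"
proof -
  obtain N where N: "N \<in> null_sets lebesgue" "{x. \<not> P x} \<subseteq> N"
    using assms by (auto simp: eventually_ae_filter)
  have "negligible (uminus ` N)"
    by (rule negligible_differentiable_image_negligible)
      (use N(1) in \<open>auto simp: negligible_iff_null_sets differentiable_on_def intro!: derivative_intros\<close>)
  then have "uminus ` N \<in> null_sets lebesgue" by (simp add: negligible_iff_null_sets)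
  moreover have "{x. \<not> P (- x)} \<subseteq> uminus ` N"
  proof
    fix x assume "x \<in> {x. \<not> P (- x)}"
    then have "- x \<in> N" using N(2) by blast
    then show "x \<in> uminus ` N" by (rule rev_image_eqI) simp
  qed
  ultimately show ?thesis by (intro AE_I'[of "uminus ` N"]) simp_all
qed

lemma L2_UNIV_iff: "L2 UNIV f \<longleftrightarrow> f \<in> borel_measurable lebesgue \<and> integrable lebesgue (\<lambda>x. (norm (f x))^2)"
  by (simp add: L2_def set_borel_measurable_def set_integrable_def)

lemma L2_UNIV_subset:
  assumes "L2 UNIV f" "S \<in> sets lebesgue"
  shows "L2 S f"
proof -
  have [measurable]: "f \<in> borel_measurable lebesgue" and "integrable lebesgue (\<lambda>x. (norm (f x))^2)"
    using assms by (auto simp: L2_UNIV_iff)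
  then have "integrable lebesgue (\<lambda>x. indicator S x *\<^sub>R (norm (f x))^2)"
    by (intro integrable_mult_indicator assms(2))
  moreover have "(\<lambda>x. indicator S x *\<^sub>R f x) \<in> borel_measurable lebesgue"
    using assms(2) by (intro borel_measurable_scaleR) auto
  ultimately show ?thesis
    by (simp add: L2_def set_borel_measurable_def set_integrable_def)
qed

lemma L2_UNIV_cong_AE:
  fixes f g :: "real \<Rightarrow> 'a::euclidean_space"
  assumes f: "L2 UNIV f" and AE: "AE x in lebesgue. f x = g x"
  shows "L2 UNIV g" "L2norm g = L2norm f"
proof -
  have f: "f \<in> borel_measurable lebesgue" "integrable lebesgue (\<lambda>x. (norm (f x))^2)"
    using f by (auto simp: L2_UNIV_iff)
  have g: "g \<in> borel_measurable lebesgue" by (rule borel_measurable_AE[OF f(1) AE])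
  have AE2: "AE x in lebesgue. (norm (f x))^2 = (norm (g x))^2"
    using AE by eventually_elim simp
  have m: "(\<lambda>x. (norm (f x))^2) \<in> borel_measurable lebesgue" "(\<lambda>x. (norm (g x))^2) \<in> borel_measurable lebesgue"
    using f(1) g by measurable
  show "L2 UNIV g" "L2norm g = L2norm f"
    using f(2) g integrable_cong_AE[OF m AE2] integral_cong_AE[OF m AE2]
    by (simp_all add: L2_UNIV_iff L2norm_def)
qed

lemma L2_half_cong_AE:
  fixes f g :: "real \<Rightarrow> complex"
  assumes AE: "AE x in lebesgue. x > 0 \<longrightarrow> f x = g x" and f: "L2 {0<..} f"
  shows "L2 {0<..} g" "energy g = energy f"
proof -
  obtain N where N: "N \<in> null_sets lebesgue" "{x. \<not> (x > 0 \<longrightarrow> f x = g x)} \<subseteq> N"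
    using AE by (auto simp: eventually_ae_filter)
  have neg: "negligible (insert 0 N)"
    using N(1) by (simp add: negligible_iff_null_sets[symmetric])
  have eq: "g x = f x" if "x \<in> {0..} - insert 0 N" for x
  proof -
    have "x > 0" "x \<notin> N" using that by auto
    then show ?thesis using N(2) by fastforce
  qed
  have AE': "AE x in lebesgue. indicator {0<..} x *\<^sub>R f x = (indicator {0<..} x *\<^sub>R g x :: complex)"
    using AE by eventually_elim (auto simp: indicator_def)
  have gm: "set_borel_measurable lebesgue {0<..} g"
    using f borel_measurable_AE[OF _ AE'] by (simp add: L2_def set_borel_measurable_def)
  have fi: "(\<lambda>x. (cmod (f x))^2) integrable_on {0..}" using f by (simp add: L2_half_iff)
  have gi: "(\<lambda>x. (cmod (g x))^2) integrable_on {0..}"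
    by (rule integrable_spike[OF fi neg]) (simp add: eq)
  have "set_integrable lebesgue {0..} (\<lambda>x. (cmod (g x))^2)"
    using gi by (subst absolutely_integrable_on_iff_nonneg) auto
  then have "set_integrable lebesgue {0<..} (\<lambda>x. (cmod (g x))^2)"
    by (rule set_integrable_subset) auto
  then show "L2 {0<..} g" using gm by (simp add: L2_def)
  show "energy g = energy f"
    unfolding energy_def by (rule integral_spike[OF neg]) (simp add: eq)
qed

text \<open>\<open>True\<close> is the right side and \<open>False\<close> the left one;
  multiplication by \<open>sg s\<close> carries the positive half-line onto side \<open>s\<close>.
  Arguments for the two half-lines are thereby made once, for arbitrary \<open>s\<close>.\<close>

definition sg :: "bool \<Rightarrow> real" where
  "sg s = (if s then 1 else - 1)"

lemma sg_simps [simp]: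
  "sg True = 1" "sg False = - 1" "sg s * sg s = 1"
  "sg s * (sg s * x) = x"
  by (auto simp: sg_def)

text \<open>The point 0 is a null set, so the line is covered almost everywhere by two copies of the
  positive half-line.\<close>

lemma AE_lebesgue_sides:
  "(AE x in lebesgue. P x) \<longleftrightarrow> (\<forall>s. AE x in lebesgue. x > 0 \<longrightarrow> P (sg s * x))"
proof
  assume P: "AE x in lebesgue. P x"
  show "\<forall>s. AE x in lebesgue. x > 0 \<longrightarrow> P (sg s * x)"
  proof
    fix s
    show "AE x in lebesgue. x > 0 \<longrightarrow> P (sg s * x)"
      using P AE_lebesgue_reflect[OF P] by (cases s) auto
  qed
next
  assume *: "\<forall>s. AE x in lebesgue. x > 0 \<longrightarrow> P (sg s * x)"
  have 1: "AE x in lebesgue. x > 0 \<longrightarrow> P x" using *[rule_format, of True] by simp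
  have 2: "AE x in lebesgue. - x > 0 \<longrightarrow> P (- (- x))"
    using AE_lebesgue_reflect[OF *[rule_format, of False]] by simp
  have 3: "AE x in lebesgue. x \<noteq> (0::real)"
  proof -
    have "{0::real} \<in> null_sets lebesgue" by (simp add: negligible_iff_null_sets[symmetric])
    then show ?thesis by (rule AE_I') auto
  qed
  from 1 2 3 show "AE x in lebesgue. P x"
  proof eventually_elim
    case (elim x)
    then show ?case by (cases x "0::real" rule: linorder_cases) auto
  qed
qed

lemma L2_UNIV_reflect:
  fixes f :: "real \<Rightarrow> complex"
  assumes "L2 UNIV f" shows "L2 UNIV (\<lambda>x. f (- x))"
proof -
  have f: "f \<in> borel_measurable lebesgue" "integrable lebesgue (\<lambda>x. (cmod (f x))^2)"
    using assms by (auto simp: L2_UNIV_iff)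
  have "uminus \<in> lebesgue \<rightarrow>\<^sub>M (lebesgue :: real measure)"
  proof -
    have "(*\<^sub>R) (- 1) = (uminus :: real \<Rightarrow> real)" by (rule ext) simp
    then show ?thesis using lebesgue_measurable_scaling[of "- 1", where 'a = real] by simp
  qed
  then have "(\<lambda>x. f (- x)) \<in> borel_measurable lebesgue" using f(1) by (rule measurable_compose)
  moreover have "integrable lebesgue (\<lambda>x. (cmod (f (- x)))^2)"
    using f(2) lebesgue_integrable_real_affine_iff[of "- 1" "\<lambda>x. (cmod (f x))^2" 0] by simp
  ultimately show ?thesis by (simp add: L2_UNIV_iff)
qed

lemma L2_UNIV_side:
  fixes f :: "real \<Rightarrow> complex"
  assumes "L2 UNIV f" shows "L2 {0<..} (\<lambda>x. f (sg s * x))"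
  using L2_UNIV_subset[OF assms, of "{0<..}"] L2_UNIV_subset[OF L2_UNIV_reflect[OF assms], of "{0<..}"]
  by (cases s) auto

lemma L2_UNIV_comb:
  fixes f g :: "real \<Rightarrow> complex"
  assumes "L2 UNIV f" "L2 UNIV g"
  shows "L2 UNIV (\<lambda>x. a * f x + b * g x)"
proof -
  have f[measurable]: "f \<in> borel_measurable lebesgue" and fi: "integrable lebesgue (\<lambda>x. (cmod (f x))^2)"
    and g[measurable]: "g \<in> borel_measurable lebesgue" and gi: "integrable lebesgue (\<lambda>x. (cmod (g x))^2)"
    using assms by (auto simp: L2_UNIV_iff)
  have "integrable lebesgue (\<lambda>x. (cmod (a * f x + b * g x))^2)"
  proof (rule Bochner_Integration.integrable_bound)
    show "integrable lebesgue (\<lambda>x. 2 * (cmod a)^2 * (cmod (f x))^2 + 2 * (cmod b)^2 * (cmod (g x))^2)"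
      by (intro Bochner_Integration.integrable_add integrable_mult_right fi gi)
    show "AE x in lebesgue. norm ((cmod (a * f x + b * g x))^2)
        \<le> norm (2 * (cmod a)^2 * (cmod (f x))^2 + 2 * (cmod b)^2 * (cmod (g x))^2)"
      using cmod_comb_squared[of a _ b] by (intro always_eventually allI) (simp add: abs_of_nonneg)
  qed measurable
  then show ?thesis by (simp add: L2_UNIV_iff)
qed

text \<open>At \<open>x < 0\<close> the glued function is \<open>U False (- x)\<close>: the
  reflected left-hand function is put back in place.\<close>

lemma L2_UNIV_glue:
  fixes U :: "bool \<Rightarrow> real \<Rightarrow> complex"
  assumes "\<And>s. L2 {0<..} (U s)"
  shows "L2 UNIV (\<lambda>x. U (x > 0) \<bar>x\<bar>)"
proof -
  have ext: "L2 UNIV (\<lambda>x. indicator {0<..} x *\<^sub>R U s x)" for s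
  proof -
    have "(\<lambda>x. indicator {0<..} x *\<^sub>R U s x) \<in> borel_measurable lebesgue"
      "integrable lebesgue (\<lambda>x. indicator {0<..} x *\<^sub>R (cmod (U s x))^2)"
      using assms[of s] by (auto simp: L2_def set_borel_measurable_def set_integrable_def)
    moreover have "(cmod (indicator {0<..} x *\<^sub>R U s x))^2 = indicator {0<..} x *\<^sub>R (cmod (U s x))^2" for x
      by (simp add: indicator_def)
    ultimately show ?thesis by (simp add: L2_UNIV_iff)
  qed
  have "L2 UNIV (\<lambda>x. 1 * (indicator {0<..} x *\<^sub>R U True x) + 1 * (indicator {0<..} (- x) *\<^sub>R U False (- x)))"
    by (intro L2_UNIV_comb ext L2_UNIV_reflect[OF ext])
  then show ?thesis
  proof (rule L2_UNIV_cong_AE(1))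
    show "AE x in lebesgue. 1 * (indicator {0<..} x *\<^sub>R U True x) + 1 * (indicator {0<..} (- x) *\<^sub>R U False (- x))
        = U (x > 0) \<bar>x\<bar>"
      by (subst AE_lebesgue_sides, intro allI always_eventually) (simp add: sg_def indicator_def)
  qed
qed

lemma L2norm_nonneg: "L2norm f \<ge> 0"
  by (simp add: L2norm_def)

lemma L2norm_squared: "(L2norm f)^2 = (\<integral>x. (norm (f x))^2 \<partial>lebesgue)"
  by (simp add: L2norm_def)

lemma energy_eq_set_integral:
  assumes "L2 {0<..} f"
  shows "energy f = (LINT x:{0<..}|lebesgue. (cmod (f x))^2)"
proof -
  have eq: "{0<..} - {0..} = ({}::real set)" "{0..} - {0<..} = {0::real}" by auto
  have "(LINT x:{0<..}|lebesgue. (cmod (f x))^2) = integral {0<..} (\<lambda>x. (cmod (f x))^2)"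
    using assms by (intro set_lebesgue_integral_eq_integral(2)) (simp add: L2_def)
  also have "\<dots> = energy f"
    unfolding energy_def
  proof (rule integral_spike_set)
    show "negligible {x \<in> {0<..} - {0..}. (cmod (f x))^2 \<noteq> 0}" by (simp add: eq)
    show "negligible {x \<in> {0..} - {0<..}. (cmod (f x))^2 \<noteq> 0}"
      unfolding eq by (rule negligible_subset[of "{0}"]) auto
  qed
  finally show ?thesis ..
qed

lemma L2norm_squared_sides:
  fixes f :: "real \<Rightarrow> complex"
  assumes "L2 UNIV f"
  shows "(L2norm f)^2 = energy (\<lambda>x. f (sg True * x)) + energy (\<lambda>x. f (sg False * x))"
proof -
  have f: "integrable lebesgue (\<lambda>x. (cmod (f x))^2)" using assms by (simp add: L2_UNIV_iff)
  have AE: "AE x in lebesgue. (cmod (f x))^2 =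
      indicator {0<..} x *\<^sub>R (cmod (f x))^2 + indicator {0<..} (- x) *\<^sub>R (cmod (f x))^2"
    by (subst AE_lebesgue_sides, intro allI always_eventually) (simp add: sg_def indicator_def)
  have i1: "integrable lebesgue (\<lambda>x. indicator {0<..} x *\<^sub>R (cmod (f x))^2)"
    by (rule integrable_mult_indicator[OF _ f]) simp
  have "integrable lebesgue (\<lambda>x. indicator {0<..} x *\<^sub>R (cmod (f (- x)))^2)"
    using L2_UNIV_reflect[OF assms] by (intro integrable_mult_indicator) (auto simp: L2_UNIV_iff)
  then have i2: "integrable lebesgue (\<lambda>x. indicator {0<..} (- x) *\<^sub>R (cmod (f x))^2)"
    using lebesgue_integrable_real_affine_iff[of "- 1" "\<lambda>x. indicator {0<..} (- x) *\<^sub>R (cmod (f x))^2" 0] by simp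
  have "(L2norm f)^2 = (\<integral>x. indicator {0<..} x *\<^sub>R (cmod (f x))^2 + indicator {0<..} (- x) *\<^sub>R (cmod (f x))^2 \<partial>lebesgue)"
    unfolding L2norm_squared
    by (rule integral_cong_AE[OF _ _ AE]) (use f i1 i2 in \<open>auto intro!: borel_measurable_add dest: borel_measurable_integrable\<close>)
  also have "\<dots> = (\<integral>x. indicator {0<..} x *\<^sub>R (cmod (f x))^2 \<partial>lebesgue) + (\<integral>x. indicator {0<..} (- x) *\<^sub>R (cmod (f x))^2 \<partial>lebesgue)"
    by (rule Bochner_Integration.integral_add[OF i1 i2])
  also have "(\<integral>x. indicator {0<..} (- x) *\<^sub>R (cmod (f x))^2 \<partial>lebesgue) = (\<integral>x. indicator {0<..} x *\<^sub>R (cmod (f (- x)))^2 \<partial>lebesgue)"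
    using lebesgue_integral_real_affine[of "- 1" "\<lambda>x. indicator {0<..} (- x) *\<^sub>R (cmod (f x))^2" 0] by simp
  finally show ?thesis
    using energy_eq_set_integral[OF L2_UNIV_side[OF assms, of True]] energy_eq_set_integral[OF L2_UNIV_side[OF assms, of False]]
    by (simp add: set_lebesgue_integral_def)
qed

section \<open>The first-order system with a transmission condition\<close>

definition half_sol :: "complex \<Rightarrow> complex \<Rightarrow> (real \<Rightarrow> complex) \<Rightarrow> (real \<Rightarrow> complex) \<Rightarrow>
    (real \<Rightarrow> complex) \<Rightarrow> (real \<Rightarrow> complex) \<Rightarrow> bool" where
  "half_sol \<kappa> b u v g h \<longleftrightarrow> L2 {0<..} u \<and> L2 {0<..} v \<and>
     is_primitive u (\<lambda>x. \<kappa> * v x + g x) \<and> is_primitive v (\<lambda>x. b * u x + h x)"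

lemma is_primitive_cong:
  assumes "is_primitive u g" "\<And>x. u' x = u x" "\<And>x. g' x = g x"
  shows "is_primitive u' g'"
  using assms by (metis ext)

lemma is_primitive_comb:
  assumes "is_primitive u g" "is_primitive v h"
  shows "is_primitive (\<lambda>x. a * u x + b * v x) (\<lambda>x. a * g x + b * h x)"
  by (intro is_primitive_add is_primitive_cmult assms)

text \<open>Diagonalisation: \<open>p = (u + v / \<nu>) / 2\<close> and \<open>q = (u - v / \<nu>) / 2\<close> decouple the system into
  \<open>p' = \<kappa> \<nu> p + \<dots>\<close> and \<open>q' = - \<kappa> \<nu> q + \<dots>\<close>. As \<open>Re (\<kappa> \<nu>) < 0\<close>, the value
  \<open>p 0\<close> is free while \<open>q 0\<close> is determined by the data.\<close>

lemma half_sol_estimate: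
  assumes neg: "Re (\<kappa> * \<nu>) < 0" and nu: "\<nu> \<noteq> 0"
  shows "\<exists>C1 C2 C3. 0 \<le> C1 \<and> 0 \<le> C2 \<and> 0 \<le> C3 \<and> (\<forall>u v g h.
    half_sol \<kappa> (\<kappa> * \<nu>^2) u v g h \<and> L2 {0<..} g \<and> L2 {0<..} h \<longrightarrow>
      (cmod ((u 0 - v 0 / \<nu>) / 2))^2 \<le> C1 * (energy g + energy h) \<and>
      energy u + energy v \<le> C2 * (cmod ((u 0 + v 0 / \<nu>) / 2))^2 + C3 * (energy g + energy h))"
proof -
  define \<rho> where "\<rho> = - Re (\<kappa> * \<nu>)"
  have \<rho>: "\<rho> > 0" using neg by (simp add: \<rho>_def)
  define c where "c = 1 / (2 * \<nu>)"
  \<comment> \<open>\<open>M\<close> and \<open>L\<close> come from the factor 2 in the inequality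
    for squares: \<open>M\<close> from the sources \<open>g / 2 + c h\<close> and
    \<open>g / 2 - c h\<close>, \<open>L\<close> from recovering \<open>u = p + q\<close> and
    \<open>v = \<nu> (p - q)\<close>.\<close>
  define M where "M = 1 / 2 + 2 * (cmod c)^2"
  have "M \<ge> 0" by (simp add: M_def)
  define L where "L = 2 + 2 * (cmod \<nu>)^2"
  have "L \<ge> 0" by (simp add: L_def)
  have est: "(cmod ((u 0 - v 0 / \<nu>) / 2))^2 \<le> (M / \<rho>) * (energy g + energy h) \<and>
      energy u + energy v \<le> (L / \<rho>) * (cmod ((u 0 + v 0 / \<nu>) / 2))^2 + (2 * L * M / \<rho>^2) * (energy g + energy h)"
    if sol: "half_sol \<kappa> (\<kappa> * \<nu>^2) u v g h" and g: "L2 {0<..} g" and h: "L2 {0<..} h" for u v g h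
  proof -
    define N where "N = energy g + energy h"
    have u: "L2 {0<..} u" "is_primitive u (\<lambda>x. \<kappa> * v x + g x)"
      and v: "L2 {0<..} v" "is_primitive v (\<lambda>x. (\<kappa> * \<nu>^2) * u x + h x)"
      using sol by (auto simp: half_sol_def)
    have comb_M: "energy (\<lambda>x. (1 / 2) * g x + c' * h x) \<le> M * N" if "cmod c' = cmod c" for c'
    proof -
      have "energy (\<lambda>x. (1 / 2) * g x + c' * h x) \<le> 2 * (cmod (1 / 2))^2 * energy g + 2 * (cmod c')^2 * energy h"
        by (rule L2_half_comb(2)[OF g h])
      also have "\<dots> \<le> M * energy g + M * energy h"
        by (intro add_mono mult_right_mono energy_nonneg) (auto simp: M_def that norm_divide power2_eq_square)
      finally show ?thesis by (simp add: N_def distrib_left)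
    qed
    define p where "p x = (1 / 2) * u x + c * v x" for x
    define q where "q x = (1 / 2) * u x + (- c) * v x" for x
    define G where "G x = (1 / 2) * g x + c * h x" for x
    define H where "H x = (1 / 2) * g x + (- c) * h x" for x
    have p: "is_primitive p (\<lambda>x. (\<kappa> * \<nu>) * p x + G x)"
      by (rule is_primitive_cong[OF is_primitive_comb[OF u(2) v(2), of "1 / 2" c]])
        (use nu in \<open>simp_all add: p_def G_def c_def field_simps power2_eq_square\<close>)
    have q: "is_primitive q (\<lambda>x. (- (\<kappa> * \<nu>)) * q x + H x)"
      by (rule is_primitive_cong[OF is_primitive_comb[OF u(2) v(2), of "1 / 2" "- c"]])
        (use nu in \<open>simp_all add: q_def H_def c_def field_simps power2_eq_square\<close>)
    have GL: "L2 {0<..} G" "energy G \<le> M * N" and HL: "L2 {0<..} H" "energy H \<le> M * N"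
      unfolding G_def H_def by (rule L2_half_comb(1)[OF g h] comb_M; simp)+
    have pL: "L2 {0<..} p" and qL: "L2 {0<..} q"
      unfolding p_def q_def by (intro L2_half_comb(1) u v)+
    have qest: "(cmod (q 0))^2 + \<rho> * energy q \<le> M * N / \<rho>"
    proof -
      have "(cmod (q 0))^2 + \<rho> * energy q \<le> energy H / \<rho>"
        using growing_solution_bound[OF _ HL(1) q qL] \<rho> by (simp add: \<rho>_def)
      also have "\<dots> \<le> M * N / \<rho>" using HL(2) \<rho> by (simp add: divide_right_mono)
      finally show ?thesis .
    qed
    have q0: "(cmod (q 0))^2 \<le> M / \<rho> * N"
    proof -
      have "0 \<le> \<rho> * energy q" using \<rho> energy_nonneg by simp
      then show ?thesis using qest by simp
    qed
    have qE: "energy q \<le> M * N / \<rho>^2"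
    proof -
      have "\<rho> * energy q \<le> M * N / \<rho>" using qest zero_le_power2[of "cmod (q 0)"] by linarith
      then show ?thesis using \<rho> by (simp add: field_simps power2_eq_square)
    qed
    have pE: "energy p \<le> (cmod (p 0))^2 / \<rho> + M * N / \<rho>^2"
    proof -
      have "energy p \<le> ((cmod (p 0))^2 + energy G / \<rho>) / \<rho>"
        using decaying_solution_bound(2)[OF neg GL(1) p] by (simp add: \<rho>_def)
      also have "\<dots> \<le> ((cmod (p 0))^2 + M * N / \<rho>) / \<rho>"
        using GL(2) \<rho> by (simp add: divide_right_mono)
      also have "\<dots> = (cmod (p 0))^2 / \<rho> + M * N / \<rho>^2"
        by (simp add: add_divide_distrib power2_eq_square)
      finally show ?thesis .
    qed
    have u_eq: "u = (\<lambda>x. 1 * p x + 1 * q x)" and v_eq: "v = (\<lambda>x. \<nu> * p x + (- \<nu>) * q x)"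
      using nu by (auto simp: p_def q_def c_def field_simps)
    have "energy u + energy v \<le> (2 * energy p + 2 * energy q) + (2 * (cmod \<nu>)^2 * energy p + 2 * (cmod \<nu>)^2 * energy q)"
      using L2_half_comb(2)[OF pL qL, of 1 1, folded u_eq] L2_half_comb(2)[OF pL qL, of \<nu> "- \<nu>", folded v_eq]
      by simp
    also have "\<dots> = L * (energy p + energy q)" by (simp add: L_def algebra_simps)
    also have "\<dots> \<le> L * (((cmod (p 0))^2 / \<rho> + M * N / \<rho>^2) + M * N / \<rho>^2)"
      by (intro mult_left_mono add_mono pE qE \<open>L \<ge> 0\<close>)
    also have "\<dots> = (L / \<rho>) * (cmod (p 0))^2 + (2 * L * M / \<rho>^2) * N"
      by (simp add: algebra_simps)
    finally have E: "energy u + energy v \<le> (L / \<rho>) * (cmod (p 0))^2 + (2 * L * M / \<rho>^2) * N" .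
    have "p 0 = (u 0 + v 0 / \<nu>) / 2" "q 0 = (u 0 - v 0 / \<nu>) / 2"
      using nu by (auto simp: p_def q_def c_def field_simps)
    then show ?thesis using E q0 by (simp only: N_def)
  qed
  show ?thesis
    by (rule exI[of _ "M / \<rho>"], rule exI[of _ "L / \<rho>"], rule exI[of _ "2 * L * M / \<rho>^2"])
      (use est \<rho> \<open>M \<ge> 0\<close> \<open>L \<ge> 0\<close> in simp)
qed

text \<open>The order of the quantifiers matters: \<open>q0\<close> is fixed by the data before the
  amplitude \<open>p0\<close> of the decaying part is chosen, which leaves \<open>p0\<close>
  available for the transmission condition.\<close>

lemma half_sol_exists:
  assumes neg: "Re (\<kappa> * \<nu>) < 0" and nu: "\<nu> \<noteq> 0" and g: "L2 {0<..} g" and h: "L2 {0<..} h"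
  shows "\<exists>q0. \<forall>p0. \<exists>u v. half_sol \<kappa> (\<kappa> * \<nu>^2) u v g h \<and> u 0 = p0 + q0 \<and> v 0 = \<nu> * (p0 - q0)"
proof -
  define c where "c = 1 / (2 * \<nu>)"
  define G where "G x = (1 / 2) * g x + c * h x" for x
  define H where "H x = (1 / 2) * g x + (- c) * h x" for x
  have GL: "L2 {0<..} G" and HL: "L2 {0<..} H"
    unfolding G_def H_def by (intro L2_half_comb(1) g h)+
  obtain q where q: "is_primitive q (\<lambda>x. (- (\<kappa> * \<nu>)) * q x + H x)" "L2 {0<..} q"
    using growing_solution_exists[OF _ HL, of "- (\<kappa> * \<nu>)"] neg by auto
  have "\<exists>u v. half_sol \<kappa> (\<kappa> * \<nu>^2) u v g h \<and> u 0 = p0 + q 0 \<and> v 0 = \<nu> * (p0 - q 0)" for p0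
  proof -
    obtain p where p: "is_primitive p (\<lambda>x. (\<kappa> * \<nu>) * p x + G x)" and p0: "p 0 = p0"
      using decaying_solution_exists[OF GL] by blast
    have pL: "L2 {0<..} p" by (rule decaying_solution_bound(1)[OF neg GL p])
    define u where "u x = 1 * p x + 1 * q x" for x
    define v where "v x = \<nu> * p x + (- \<nu>) * q x" for x
    have "is_primitive u (\<lambda>x. \<kappa> * v x + g x)"
      by (rule is_primitive_cong[OF is_primitive_comb[OF p q(1), of 1 1]])
        (use nu in \<open>simp_all add: u_def v_def G_def H_def c_def field_simps\<close>)
    moreover have "is_primitive v (\<lambda>x. (\<kappa> * \<nu>^2) * u x + h x)"
      by (rule is_primitive_cong[OF is_primitive_comb[OF p q(1), of \<nu> "- \<nu>"]])
        (use nu in \<open>simp_all add: u_def v_def G_def H_def c_def field_simps power2_eq_square\<close>)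
    moreover have "L2 {0<..} u" "L2 {0<..} v"
      unfolding u_def v_def by (intro L2_half_comb(1) pL q(2))+
    ultimately have "half_sol \<kappa> (\<kappa> * \<nu>^2) u v g h" by (simp add: half_sol_def)
    moreover have "u 0 = p0 + q 0" "v 0 = \<nu> * (p0 - q 0)"
      by (auto simp: u_def v_def p0 algebra_simps)
    ultimately show ?thesis by blast
  qed
  then show ?thesis by blast
qed

section \<open>The transmission condition as a linear system for the amplitudes at 0\<close>

definition transmission :: "complex \<Rightarrow> complex \<Rightarrow> complex \<Rightarrow> complex \<Rightarrow>
    complex \<Rightarrow> complex \<Rightarrow> complex \<Rightarrow> complex \<Rightarrow> bool" where
  "transmission \<alpha> \<beta> \<gamma> \<delta> up vp um vm \<longleftrightarrow>
     vp - vm = \<alpha> * (up + um) / 2 - \<i> * \<beta> * (vp + vm) / 2 \<and>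
     up - um = - \<i> * \<gamma> * (up + um) / 2 - \<delta> * (vp + vm) / 2"

lemma cramer_2x2:
  fixes a b c d x y X Y :: complex
  assumes "a * d - b * c \<noteq> 0"
  shows "a * x + b * y = X \<and> c * x + d * y = Y \<longleftrightarrow>
    x = (d * X - b * Y) / (a * d - b * c) \<and> y = (a * Y - c * X) / (a * d - b * c)" (is "?l \<longleftrightarrow> ?r")
proof -
  define D where "D = a * d - b * c"
  have D: "D \<noteq> 0" using assms by (simp add: D_def)
  show ?thesis unfolding D_def[symmetric]
  proof
    assume *: "a * x + b * y = X \<and> c * x + d * y = Y"
    have "D * x = d * X - b * Y" "D * y = a * Y - c * X"
      unfolding *[THEN conjunct1, symmetric] *[THEN conjunct2, symmetric]
      by (simp_all add: D_def algebra_simps)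
    then show "x = (d * X - b * Y) / D \<and> y = (a * Y - c * X) / D"
      using D by (metis nonzero_mult_div_cancel_left)
  next
    assume *: "x = (d * X - b * Y) / D \<and> y = (a * Y - c * X) / D"
    have D': "D * x = d * X - b * Y" "D * y = a * Y - c * X" using * D by auto
    have "D * (a * x + b * y) = a * (D * x) + b * (D * y)" "D * (c * x + d * y) = c * (D * x) + d * (D * y)"
      by (simp_all add: distrib_left mult.left_commute)
    then have "D * (a * x + b * y) = D * X" "D * (c * x + d * y) = D * Y"
      unfolding D' by (simp_all add: D_def algebra_simps)
    then show "a * x + b * y = X \<and> c * x + d * y = Y" using D by simp
  qed
qed

text \<open>\<open>a\<close> and \<open>r\<close> are the decaying and growing amplitudes on the
  right, \<open>b\<close> and \<open>t\<close> those on the left, where reflection changes the sign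
  of \<open>v\<close>. The growing ones are dictated by the data, so what is needed is unique
  solvability for \<open>a\<close> and \<open>b\<close>; the hypothesis says that the determinant of
  this system does not vanish.\<close>

lemma transmission_solve:
  assumes "(\<nu> - \<alpha> / 2) * (1 + \<delta> * \<nu> / 2) + \<beta> * \<gamma> * \<nu> / 4 \<noteq> 0"
  shows "\<exists>c11 c12 c21 c22. \<forall>a b r t.
    transmission \<alpha> \<beta> \<gamma> \<delta> (a + r) (\<nu> * (a - r)) (b + t) (- (\<nu> * (b - t))) \<longleftrightarrow>
    a = c11 * r + c12 * t \<and> b = c21 * r + c22 * t"
proof -
  \<comment> \<open>The coefficients belong to the unknowns \<open>a + b\<close> and
    \<open>a - b\<close>: of the unknowns, the sum of the \<open>u\<close> values and the difference
    of the \<open>v\<close> values involve only \<open>a + b\<close>, the other two combinations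
    only \<open>a - b\<close>.\<close>
  define m11 where "m11 = \<nu> - \<alpha> / 2"
  define m12 where "m12 = \<i> * \<beta> * \<nu> / 2"
  define m21 where "m21 = \<i> * \<gamma> / 2"
  define m22 where "m22 = 1 + \<delta> * \<nu> / 2"
  define D where "D = m11 * m22 - m12 * m21"
  have D: "D \<noteq> 0"
  proof -
    have "m12 * m21 = (\<i> * \<i>) * (\<beta> * \<gamma> * \<nu> / 4)"
      unfolding m12_def m21_def by (simp only: times_divide_times_eq mult_ac times_divide_eq_right) simp
    then show ?thesis using assms by (simp add: D_def m11_def m22_def)
  qed
  define xR where "xR = \<nu> + \<alpha> / 2"
  define xE where "xE = \<i> * \<beta> * \<nu> / 2"
  define yR where "yR = - (\<i> * \<gamma> / 2)"
  define yE where "yE = \<delta> * \<nu> / 2 - 1"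
  \<comment> \<open>Cramer's rule, separately for the contributions of \<open>r + t\<close> and
    \<open>r - t\<close>: \<open>sR\<close> and \<open>sE\<close> give \<open>a + b\<close>, while
    \<open>dR\<close> and \<open>dE\<close> give \<open>a - b\<close>.\<close>
  define sR where "sR = (m22 * xR - m12 * yR) / D"
  define sE where "sE = (m22 * xE - m12 * yE) / D"
  define dR where "dR = (m11 * yR - m21 * xR) / D"
  define dE where "dE = (m11 * yE - m21 * xE) / D"
  have "transmission \<alpha> \<beta> \<gamma> \<delta> (a + r) (\<nu> * (a - r)) (b + t) (- (\<nu> * (b - t))) \<longleftrightarrow>
      a = ((sR + sE + dR + dE) / 2) * r + ((sR - sE + dR - dE) / 2) * t \<and>
      b = ((sR + sE - dR - dE) / 2) * r + ((sR - sE - dR + dE) / 2) * t" (is "?T \<longleftrightarrow> ?R") for a b r t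
  proof -
    have "?T \<longleftrightarrow> m11 * (a + b) + m12 * (a - b) = xR * (r + t) + xE * (r - t) \<and>
        m21 * (a + b) + m22 * (a - b) = yR * (r + t) + yE * (r - t)"
    proof -
      have 1: "\<nu> * (a - r) - (- (\<nu> * (b - t))) - (\<alpha> * (a + r + (b + t)) / 2 - \<i> * \<beta> * (\<nu> * (a - r) + (- (\<nu> * (b - t)))) / 2)
          = m11 * (a + b) + m12 * (a - b) - (xR * (r + t) + xE * (r - t))"
        by (simp add: m11_def m12_def xR_def xE_def field_simps)
      have 2: "a + r - (b + t) - (- \<i> * \<gamma> * (a + r + (b + t)) / 2 - \<delta> * (\<nu> * (a - r) + (- (\<nu> * (b - t)))) / 2)
          = m21 * (a + b) + m22 * (a - b) - (yR * (r + t) + yE * (r - t))"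
        by (simp add: m21_def m22_def yR_def yE_def field_simps)
      have iff: "x - y = x' - y' \<Longrightarrow> (x = y) = (x' = y')" for x y x' y' :: complex
        by (metis eq_iff_diff_eq_0)
      show ?thesis unfolding transmission_def iff[OF 1] iff[OF 2] ..
    qed
    also have "\<dots> \<longleftrightarrow>
      a + b = (m22 * (xR * (r + t) + xE * (r - t)) - m12 * (yR * (r + t) + yE * (r - t))) / D \<and>
      a - b = (m11 * (yR * (r + t) + yE * (r - t)) - m21 * (xR * (r + t) + xE * (r - t))) / D"
      using cramer_2x2[of m11 m22 m12 m21] D unfolding D_def by blast
    also have "(m22 * (xR * (r + t) + xE * (r - t)) - m12 * (yR * (r + t) + yE * (r - t))) / D
        = sR * (r + t) + sE * (r - t)"
      using D by (simp add: sR_def sE_def field_simps)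
    also have "(m11 * (yR * (r + t) + yE * (r - t)) - m21 * (xR * (r + t) + xE * (r - t))) / D
        = dR * (r + t) + dE * (r - t)"
      using D by (simp add: dR_def dE_def field_simps)
    also have "a + b = sR * (r + t) + sE * (r - t) \<and> a - b = dR * (r + t) + dE * (r - t) \<longleftrightarrow> ?R"
    proof -
      have sd: "a + b = s \<and> a - b = d \<longleftrightarrow> a = (s + d) / 2 \<and> b = (s - d) / 2" for s d
      proof
        assume *: "a + b = s \<and> a - b = d"
        have "s + d = 2 * a" "s - d = 2 * b"
          unfolding *[THEN conjunct1, symmetric] *[THEN conjunct2, symmetric] by simp_all
        then show "a = (s + d) / 2 \<and> b = (s - d) / 2" by simp
      next
        have "(s + d) / 2 + (s - d) / 2 = s" "(s + d) / 2 - (s - d) / 2 = d"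
          by (simp_all add: field_simps)
        then show "a = (s + d) / 2 \<and> b = (s - d) / 2 \<Longrightarrow> a + b = s \<and> a - b = d" by metis
      qed
      have "(sR * (r + t) + sE * (r - t) + (dR * (r + t) + dE * (r - t))) / 2 =
          (sR + sE + dR + dE) / 2 * r + (sR - sE + dR - dE) / 2 * t"
        "(sR * (r + t) + sE * (r - t) - (dR * (r + t) + dE * (r - t))) / 2 =
          (sR + sE - dR - dE) / 2 * r + (sR - sE - dR + dE) / 2 * t"
        by (simp_all add: field_simps)
      then show ?thesis unfolding sd by (simp only:)
    qed
    finally show ?thesis .
  qed
  then show ?thesis by blast
qed

text \<open>\<open>U False\<close> and \<open>V False\<close> live on the reflected left half-line; reflection reverses the signs of
  \<open>v\<close> and \<open>g\<close>, so that the same system holds on both sides.\<close>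

definition line_sol :: "complex \<Rightarrow> complex \<Rightarrow> complex \<Rightarrow> complex \<Rightarrow> complex \<Rightarrow> complex \<Rightarrow>
    (real \<Rightarrow> complex) \<Rightarrow> (real \<Rightarrow> complex) \<Rightarrow> (real \<Rightarrow> complex) \<Rightarrow> (real \<Rightarrow> complex) \<Rightarrow> bool" where
  "line_sol \<alpha> \<beta> \<gamma> \<delta> \<kappa> b u v g h \<longleftrightarrow> L2 UNIV u \<and> L2 UNIV v \<and>
    (\<exists>U V. (\<forall>s. half_sol \<kappa> b (U s) (V s)
              (\<lambda>x. of_real (sg s) * g (sg s * x)) (\<lambda>x. h (sg s * x))) \<and>
       transmission \<alpha> \<beta> \<gamma> \<delta> (U True 0) (V True 0) (U False 0) (- V False 0) \<and>
       (\<forall>s. AE x in lebesgue. x > 0 \<longrightarrow>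
          u (sg s * x) = U s x \<and> v (sg s * x) = of_real (sg s) * V s x))"

lemma energy_sg: "energy (\<lambda>x. of_real (sg s) * f x) = energy f"
  by (simp add: energy_def norm_mult sg_def)

lemma L2_half_sg:
  fixes f :: "real \<Rightarrow> complex"
  assumes "L2 UNIV f" shows "L2 {0<..} (\<lambda>x. of_real (sg s) * f (sg s * x))"
  using L2_half_comb(1)[OF L2_UNIV_side[OF assms, of s] L2_UNIV_side[OF assms, of s], of "of_real (sg s)" 0]
  by simp

text \<open>On each side the data bound the growing amplitude \<open>q\<close>; the transmission
  condition expresses both decaying amplitudes \<open>p\<close> linearly through the two
  \<open>q\<close>; and \<open>p\<close> together with the data bounds the energies.\<close>

lemma line_sol_estimate:
  assumes neg: "Re (\<kappa> * \<nu>) < 0" and nu: "\<nu> \<noteq> 0"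
    and det: "(\<nu> - \<alpha> / 2) * (1 + \<delta> * \<nu> / 2) + \<beta> * \<gamma> * \<nu> / 4 \<noteq> 0"
  shows "\<exists>C\<ge>0. \<forall>u v g h. line_sol \<alpha> \<beta> \<gamma> \<delta> \<kappa> (\<kappa> * \<nu>^2) u v g h \<and> L2 UNIV g \<and> L2 UNIV h \<longrightarrow>
    (L2norm u)^2 + (L2norm v)^2 \<le> C * ((L2norm g)^2 + (L2norm h)^2)"
proof -
  obtain C1 C2 C3 where C: "0 \<le> C1" "0 \<le> C2" "0 \<le> C3" and est: "\<And>u v g h.
    \<lbrakk>half_sol \<kappa> (\<kappa> * \<nu>^2) u v g h; L2 {0<..} g; L2 {0<..} h\<rbrakk> \<Longrightarrow>
      (cmod ((u 0 - v 0 / \<nu>) / 2))^2 \<le> C1 * (energy g + energy h) \<and>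
      energy u + energy v \<le> C2 * (cmod ((u 0 + v 0 / \<nu>) / 2))^2 + C3 * (energy g + energy h)"
    using half_sol_estimate[OF neg nu] by blast
  obtain c11 c12 c21 c22 where c: "\<And>a b r t.
    transmission \<alpha> \<beta> \<gamma> \<delta> (a + r) (\<nu> * (a - r)) (b + t) (- (\<nu> * (b - t))) \<longleftrightarrow>
    a = c11 * r + c12 * t \<and> b = c21 * r + c22 * t"
    using transmission_solve[OF det] by blast
  \<comment> \<open>The factor 2 of the inequality for squares times all four coefficients, crude
    enough to bound the contribution of either \<open>q\<close>.\<close>
  define K where "K = 2 * ((cmod c11)^2 + (cmod c12)^2 + (cmod c21)^2 + (cmod c22)^2)"
  have "K \<ge> 0" by (simp add: K_def)
  have "(L2norm u)^2 + (L2norm v)^2 \<le> (C2 * (K * C1) + C3) * ((L2norm g)^2 + (L2norm h)^2)"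
    if sol: "line_sol \<alpha> \<beta> \<gamma> \<delta> \<kappa> (\<kappa> * \<nu>^2) u v g h" and g: "L2 UNIV g" and h: "L2 UNIV h" for u v g h
  proof -
    define g' where "g' s x = of_real (sg s) * g (sg s * x)" for s x
    define h' where "h' s x = h (sg s * x)" for s x
    obtain U V where uv: "L2 UNIV u" "L2 UNIV v"
      and half: "\<And>s. half_sol \<kappa> (\<kappa> * \<nu>^2) (U s) (V s) (g' s) (h' s)"
      and tr: "transmission \<alpha> \<beta> \<gamma> \<delta> (U True 0) (V True 0) (U False 0) (- V False 0)"
      and AE: "\<And>s. AE x in lebesgue. x > 0 \<longrightarrow>
          u (sg s * x) = U s x \<and> v (sg s * x) = of_real (sg s) * V s x"
      using sol unfolding line_sol_def g'_def h'_def by blast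
    have gh': "L2 {0<..} (g' s)" "L2 {0<..} (h' s)" for s
      unfolding g'_def h'_def by (intro L2_half_sg L2_UNIV_side g h)+
    define p where "p s = (U s 0 + V s 0 / \<nu>) / 2" for s
    define q where "q s = (U s 0 - V s 0 / \<nu>) / 2" for s
    define N where "N s = energy (g' s) + energy (h' s)" for s
    have q: "(cmod (q s))^2 \<le> C1 * N s" and UV: "energy (U s) + energy (V s) \<le> C2 * (cmod (p s))^2 + C3 * N s" for s
      using est[OF half gh'] unfolding p_def q_def N_def by blast+
    have pq: "U s 0 = p s + q s" "V s 0 = \<nu> * (p s - q s)" for s
      using nu by (auto simp: p_def q_def field_simps)
    have p: "p True = c11 * q True + c12 * q False" "p False = c21 * q True + c22 * q False"
      using tr unfolding pq c by auto
    have "(cmod (p True))^2 + (cmod (p False))^2 \<le>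
        2 * ((cmod c11)^2 + (cmod c21)^2) * (cmod (q True))^2 + 2 * ((cmod c12)^2 + (cmod c22)^2) * (cmod (q False))^2"
      unfolding p using cmod_comb_squared[of c11 "q True" c12 "q False"] cmod_comb_squared[of c21 "q True" c22 "q False"]
      by (simp add: algebra_simps)
    also have "\<dots> \<le> K * (cmod (q True))^2 + K * (cmod (q False))^2"
      by (intro add_mono mult_right_mono) (simp_all add: K_def)
    also have "\<dots> \<le> K * (C1 * N True) + K * (C1 * N False)"
      by (intro add_mono mult_left_mono q \<open>K \<ge> 0\<close>)
    finally have pn: "(cmod (p True))^2 + (cmod (p False))^2 \<le> K * C1 * (N True + N False)"
      by (simp add: algebra_simps)
    have u_eq: "energy (\<lambda>x. u (sg s * x)) = energy (U s)" for s
      by (rule L2_half_cong_AE(2)[rotated]) (use half[of s] AE[of s] in \<open>auto simp: half_sol_def elim: eventually_mono\<close>)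
    have v_eq: "energy (\<lambda>x. v (sg s * x)) = energy (V s)" for s
    proof -
      have VL: "L2 {0<..} (\<lambda>x. of_real (sg s) * V s x)"
        using half[of s] L2_half_comb(1)[of "V s" "V s" "of_real (sg s)" 0] by (simp add: half_sol_def)
      have "energy (\<lambda>x. v (sg s * x)) = energy (\<lambda>x. of_real (sg s) * V s x)"
        by (rule L2_half_cong_AE(2)[OF _ VL]) (use AE[of s] in \<open>auto elim: eventually_mono\<close>)
      then show ?thesis by (simp add: energy_sg)
    qed
    have "(L2norm u)^2 + (L2norm v)^2 = (energy (U True) + energy (V True)) + (energy (U False) + energy (V False))"
      using u_eq v_eq by (simp only: L2norm_squared_sides[OF uv(1)] L2norm_squared_sides[OF uv(2)])
    also have "\<dots> \<le> (C2 * (cmod (p True))^2 + C3 * N True) + (C2 * (cmod (p False))^2 + C3 * N False)"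
      by (intro add_mono UV)
    also have "\<dots> = C2 * ((cmod (p True))^2 + (cmod (p False))^2) + C3 * (N True + N False)"
      by (simp add: algebra_simps)
    also have "\<dots> \<le> C2 * (K * C1 * (N True + N False)) + C3 * (N True + N False)"
      by (intro add_right_mono mult_left_mono pn C)
    also have "\<dots> = (C2 * (K * C1) + C3) * (N True + N False)" by (simp add: algebra_simps)
    also have "N True + N False = (L2norm g)^2 + (L2norm h)^2"
      unfolding N_def g'_def h'_def energy_sg L2norm_squared_sides[OF g] L2norm_squared_sides[OF h] by simp
    finally show ?thesis .
  qed
  moreover have "0 \<le> C2 * (K * C1) + C3" using C \<open>K \<ge> 0\<close> by simp
  ultimately show ?thesis by blast
qed

text \<open>The growing amplitudes of the two half-line problems come out of the data, and the
  transmission condition tells which decaying amplitudes to prescribe.\<close>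

lemma line_sol_exists:
  assumes neg: "Re (\<kappa> * \<nu>) < 0" and nu: "\<nu> \<noteq> 0"
    and det: "(\<nu> - \<alpha> / 2) * (1 + \<delta> * \<nu> / 2) + \<beta> * \<gamma> * \<nu> / 4 \<noteq> 0"
    and g: "L2 UNIV g" and h: "L2 UNIV h"
  shows "\<exists>u v. line_sol \<alpha> \<beta> \<gamma> \<delta> \<kappa> (\<kappa> * \<nu>^2) u v g h"
proof -
  define g' where "g' s x = of_real (sg s) * g (sg s * x)" for s x
  define h' where "h' s x = h (sg s * x)" for s x
  have gh': "L2 {0<..} (g' s)" "L2 {0<..} (h' s)" for s
    unfolding g'_def h'_def by (intro L2_half_sg L2_UNIV_side g h)+
  obtain c11 c12 c21 c22 where c: "\<And>a b r t.
    transmission \<alpha> \<beta> \<gamma> \<delta> (a + r) (\<nu> * (a - r)) (b + t) (- (\<nu> * (b - t))) \<longleftrightarrow>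
    a = c11 * r + c12 * t \<and> b = c21 * r + c22 * t"
    using transmission_solve[OF det] by blast
  have "\<forall>s. \<exists>q0. \<forall>p0. \<exists>u v. half_sol \<kappa> (\<kappa> * \<nu>^2) u v (g' s) (h' s) \<and> u 0 = p0 + q0 \<and> v 0 = \<nu> * (p0 - q0)"
    using half_sol_exists[OF neg nu gh'] by blast
  then obtain q where q: "\<And>s p0. \<exists>u v. half_sol \<kappa> (\<kappa> * \<nu>^2) u v (g' s) (h' s) \<and>
      u 0 = p0 + q s \<and> v 0 = \<nu> * (p0 - q s)"
    by metis
  define p where "p s = (if s then c11 * q True + c12 * q False else c21 * q True + c22 * q False)" for s
  have "\<forall>s. \<exists>u v. half_sol \<kappa> (\<kappa> * \<nu>^2) u v (g' s) (h' s) \<and> u 0 = p s + q s \<and> v 0 = \<nu> * (p s - q s)"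
    using q by blast
  then obtain U V where half: "\<And>s. half_sol \<kappa> (\<kappa> * \<nu>^2) (U s) (V s) (g' s) (h' s)"
    and UV0: "\<And>s. U s 0 = p s + q s" "\<And>s. V s 0 = \<nu> * (p s - q s)"
    by metis
  have tr: "transmission \<alpha> \<beta> \<gamma> \<delta> (U True 0) (V True 0) (U False 0) (- V False 0)"
    unfolding UV0 c by (simp add: p_def)
  define V' where "V' s x = of_real (sg s) * V s x" for s x
  have UL: "L2 {0<..} (U s)" "L2 {0<..} (V' s)" for s
    using half[of s] L2_half_comb(1)[of "V s" "V s" "of_real (sg s)" 0]
    by (simp_all add: half_sol_def V'_def[abs_def])
  have "line_sol \<alpha> \<beta> \<gamma> \<delta> \<kappa> (\<kappa> * \<nu>^2) (\<lambda>x. U (x > 0) \<bar>x\<bar>) (\<lambda>x. V' (x > 0) \<bar>x\<bar>) g h"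
    unfolding line_sol_def
  proof (intro conjI exI)
    show "L2 UNIV (\<lambda>x. U (x > 0) \<bar>x\<bar>)" "L2 UNIV (\<lambda>x. V' (x > 0) \<bar>x\<bar>)"
      by (intro L2_UNIV_glue UL)+
    show "\<forall>s. half_sol \<kappa> (\<kappa> * \<nu>^2) (U s) (V s) (\<lambda>x. of_real (sg s) * g (sg s * x)) (\<lambda>x. h (sg s * x))"
      using half unfolding g'_def h'_def by blast
    show "transmission \<alpha> \<beta> \<gamma> \<delta> (U True 0) (V True 0) (U False 0) (- V False 0)" by (rule tr)
    show "\<forall>s. AE x in lebesgue. 0 < x \<longrightarrow>
        U (0 < sg s * x) \<bar>sg s * x\<bar> = U s x \<and>
        V' (0 < sg s * x) \<bar>sg s * x\<bar> = of_real (sg s) * V s x"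
      by (intro allI always_eventually) (simp add: sg_def V'_def)
  qed
  then show ?thesis by blast
qed

text \<open>The coefficient \<open>b\<close> stays the same, so only the equation for
  \<open>u\<close> is altered. The extra term is a source of the same kind, because under reflection
  \<open>v\<close> carries the factor \<open>sg s\<close> just as \<open>g\<close> does.\<close>

lemma line_sol_change_kappa:
  assumes "line_sol \<alpha> \<beta> \<gamma> \<delta> \<kappa> b u v g h"
  shows "line_sol \<alpha> \<beta> \<gamma> \<delta> \<kappa>' b u v (\<lambda>x. g x + (\<kappa> - \<kappa>') * v x) h"
proof -
  obtain U V where uv: "L2 UNIV u" "L2 UNIV v"
    and half: "\<And>s. half_sol \<kappa> b (U s) (V s) (\<lambda>x. of_real (sg s) * g (sg s * x)) (\<lambda>x. h (sg s * x))"
    and tr: "transmission \<alpha> \<beta> \<gamma> \<delta> (U True 0) (V True 0) (U False 0) (- V False 0)"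
    and AE: "\<And>s. AE x in lebesgue. x > 0 \<longrightarrow>
          u (sg s * x) = U s x \<and> v (sg s * x) = of_real (sg s) * V s x"
    using assms unfolding line_sol_def by blast
  have "half_sol \<kappa>' b (U s) (V s)
      (\<lambda>x. of_real (sg s) * (g (sg s * x) + (\<kappa> - \<kappa>') * v (sg s * x))) (\<lambda>x. h (sg s * x))" for s
    unfolding half_sol_def
  proof (intro conjI)
    have "is_primitive (U s) (\<lambda>x. \<kappa> * V s x + of_real (sg s) * g (sg s * x))"
      using half[of s] by (simp add: half_sol_def)
    then show "is_primitive (U s) (\<lambda>x. \<kappa>' * V s x +
        of_real (sg s) * (g (sg s * x) + (\<kappa> - \<kappa>') * v (sg s * x)))"
    proof (rule is_primitive_cong_AE)
      show "AE x in lebesgue. 0 < x \<longrightarrow> \<kappa>' * V s x +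
          of_real (sg s) * (g (sg s * x) + (\<kappa> - \<kappa>') * v (sg s * x))
          = \<kappa> * V s x + of_real (sg s) * g (sg s * x)"
        using AE[of s] by eventually_elim (cases s; simp add: algebra_simps)
    qed simp
  qed (use half[of s] in \<open>auto simp: half_sol_def\<close>)
  then show ?thesis unfolding line_sol_def using uv tr AE by blast
qed

lemma line_sol_diff:
  assumes "line_sol \<alpha> \<beta> \<gamma> \<delta> \<kappa> b u1 v1 g1 h1" "line_sol \<alpha> \<beta> \<gamma> \<delta> \<kappa> b u2 v2 g2 h2"
  shows "line_sol \<alpha> \<beta> \<gamma> \<delta> \<kappa> b (\<lambda>x. u1 x - u2 x) (\<lambda>x. v1 x - v2 x) (\<lambda>x. g1 x - g2 x) (\<lambda>x. h1 x - h2 x)"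
proof -
  obtain U V where 1: "L2 UNIV u1" "L2 UNIV v1"
    "\<And>s. half_sol \<kappa> b (U s) (V s) (\<lambda>x. of_real (sg s) * g1 (sg s * x)) (\<lambda>x. h1 (sg s * x))"
    "transmission \<alpha> \<beta> \<gamma> \<delta> (U True 0) (V True 0) (U False 0) (- V False 0)"
    "\<And>s. AE x in lebesgue. x > 0 \<longrightarrow>
          u1 (sg s * x) = U s x \<and> v1 (sg s * x) = of_real (sg s) * V s x"
    using assms(1) unfolding line_sol_def by blast
  obtain X Y where 2: "L2 UNIV u2" "L2 UNIV v2"
    "\<And>s. half_sol \<kappa> b (X s) (Y s) (\<lambda>x. of_real (sg s) * g2 (sg s * x)) (\<lambda>x. h2 (sg s * x))"
    "transmission \<alpha> \<beta> \<gamma> \<delta> (X True 0) (Y True 0) (X False 0) (- Y False 0)"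
    "\<And>s. AE x in lebesgue. x > 0 \<longrightarrow>
          u2 (sg s * x) = X s x \<and> v2 (sg s * x) = of_real (sg s) * Y s x"
    using assms(2) unfolding line_sol_def by blast
  show ?thesis unfolding line_sol_def
  proof (intro conjI exI allI)
    show "L2 UNIV (\<lambda>x. u1 x - u2 x)" "L2 UNIV (\<lambda>x. v1 x - v2 x)"
      using L2_UNIV_comb[OF 1(1) 2(1), of 1 "- 1"] L2_UNIV_comb[OF 1(2) 2(2), of 1 "- 1"] by simp_all
    fix s
    have a: "L2 {0<..} (U s)" "L2 {0<..} (V s)" "L2 {0<..} (X s)" "L2 {0<..} (Y s)"
      and b: "is_primitive (U s) (\<lambda>x. \<kappa> * V s x + of_real (sg s) * g1 (sg s * x))"
        "is_primitive (V s) (\<lambda>x. b * U s x + h1 (sg s * x))"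
        "is_primitive (X s) (\<lambda>x. \<kappa> * Y s x + of_real (sg s) * g2 (sg s * x))"
        "is_primitive (Y s) (\<lambda>x. b * X s x + h2 (sg s * x))"
      using 1(3)[of s] 2(3)[of s] by (auto simp: half_sol_def)
    show "half_sol \<kappa> b (\<lambda>x. U s x - X s x) (\<lambda>x. V s x - Y s x)
        (\<lambda>x. of_real (sg s) * (g1 (sg s * x) - g2 (sg s * x)))
        (\<lambda>x. h1 (sg s * x) - h2 (sg s * x))"
      unfolding half_sol_def
    proof (intro conjI)
      show "L2 {0<..} (\<lambda>x. U s x - X s x)" "L2 {0<..} (\<lambda>x. V s x - Y s x)"
        using L2_half_comb(1)[OF a(1,3), of 1 "- 1"] L2_half_comb(1)[OF a(2,4), of 1 "- 1"] by simp_all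
      show "is_primitive (\<lambda>x. U s x - X s x) (\<lambda>x. \<kappa> * (V s x - Y s x) +
          of_real (sg s) * (g1 (sg s * x) - g2 (sg s * x)))"
        by (rule is_primitive_cong[OF is_primitive_comb[OF b(1,3), of 1 "- 1"]]) (simp_all add: algebra_simps)
      show "is_primitive (\<lambda>x. V s x - Y s x) (\<lambda>x. b * (U s x - X s x) + (h1 (sg s * x) - h2 (sg s * x)))"
        by (rule is_primitive_cong[OF is_primitive_comb[OF b(2,4), of 1 "- 1"]]) (simp_all add: algebra_simps)
    qed
    show "AE x in lebesgue. x > 0 \<longrightarrow> u1 (sg s * x) - u2 (sg s * x) = U s x - X s x \<and>
        v1 (sg s * x) - v2 (sg s * x) = of_real (sg s) * (V s x - Y s x)"
      using 1(5)[of s] 2(5)[of s] by eventually_elim (simp add: right_diff_distrib)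
  next
    show "transmission \<alpha> \<beta> \<gamma> \<delta> (U True 0 - X True 0) (V True 0 - Y True 0) (U False 0 - X False 0) (- (V False 0 - Y False 0))"
      using 1(4) 2(4) unfolding transmission_def by (auto simp: field_simps)
  qed
qed

text \<open>Graphs provide the data only up to \<open>ae_eq\<close>, while the two resolvents have
  to be compared for the same \<open>f\<close>.\<close>

lemma line_sol_cong_AE:
  assumes "line_sol \<alpha> \<beta> \<gamma> \<delta> \<kappa> b u v g h"
    and g: "AE x in lebesgue. g' x = g x" and h: "AE x in lebesgue. h' x = h x"
  shows "line_sol \<alpha> \<beta> \<gamma> \<delta> \<kappa> b u v g' h'"
proof -
  have half: "half_sol \<kappa> b U V (\<lambda>x. of_real (sg s) * g' (sg s * x)) (\<lambda>x. h' (sg s * x))"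
    if "half_sol \<kappa> b U V (\<lambda>x. of_real (sg s) * g (sg s * x)) (\<lambda>x. h (sg s * x))" for U V s
  proof -
    have g': "AE x in lebesgue. x > 0 \<longrightarrow> g' (sg s * x) = g (sg s * x)"
      using g by (subst (asm) AE_lebesgue_sides) blast
    have h': "AE x in lebesgue. x > 0 \<longrightarrow> h' (sg s * x) = h (sg s * x)"
      using h by (subst (asm) AE_lebesgue_sides) blast
    have U: "is_primitive U (\<lambda>x. \<kappa> * V x + of_real (sg s) * g (sg s * x))"
      and V: "is_primitive V (\<lambda>x. b * U x + h (sg s * x))"
      using that by (auto simp: half_sol_def)
    have "is_primitive U (\<lambda>x. \<kappa> * V x + of_real (sg s) * g' (sg s * x))"
      by (rule is_primitive_cong_AE[OF U refl]) (use g' in \<open>auto elim: eventually_mono\<close>)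
    moreover have "is_primitive V (\<lambda>x. b * U x + h' (sg s * x))"
      by (rule is_primitive_cong_AE[OF V refl]) (use h' in \<open>auto elim: eventually_mono\<close>)
    ultimately show ?thesis
      using that by (simp add: half_sol_def)
  qed
  show ?thesis using assms(1) half unfolding line_sol_def by blast
qed

section \<open>Weak derivatives on the two half-lines\<close>

definition side_set :: "bool \<Rightarrow> real set" where "side_set s = (if s then {0<..} else {..<0})"
definition side_closure :: "bool \<Rightarrow> real set" where "side_closure s = (if s then {0..} else {..0})"

lemma test_fun_reflect:
  assumes "test_fun S \<phi>"
  shows "test_fun (uminus ` S) (\<lambda>x. \<phi> (- x))"
proof -
  have "smooth_fun (\<lambda>x. 1 * \<phi> ((- 1) * x + 0) + 0 * \<phi> (0 * x + 0))"
    by (intro smooth_fun_affine_comb test_fun_smooth[OF assms])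
  then have sm: "smooth_fun (\<lambda>x. \<phi> (- x))" by simp
  have cpt: "compact (closure {x. \<phi> x \<noteq> 0})" and sub: "closure {x. \<phi> x \<noteq> 0} \<subseteq> S"
    using assms by (auto simp: test_fun_def)
  have cpt': "compact (uminus ` closure {x. \<phi> x \<noteq> 0})"
    by (intro compact_continuous_image cpt continuous_intros)
  have "{x. \<phi> (- x) \<noteq> 0} \<subseteq> uminus ` closure {x. \<phi> x \<noteq> 0}"
  proof
    fix x assume "x \<in> {x. \<phi> (- x) \<noteq> 0}"
    then have "- x \<in> closure {x. \<phi> x \<noteq> 0}" using closure_subset by fast
    then show "x \<in> uminus ` closure {x. \<phi> x \<noteq> 0}" by (rule rev_image_eqI) simp
  qed
  then have cl: "closure {x. \<phi> (- x) \<noteq> 0} \<subseteq> uminus ` closure {x. \<phi> x \<noteq> 0}"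
    by (intro closure_minimal compact_imp_closed cpt')
  moreover have "bounded {x. \<phi> (- x) \<noteq> 0}"
    using compact_imp_bounded[OF cpt'] cl closure_subset by (meson bounded_subset)
  ultimately show ?thesis
    using sm sub unfolding test_fun_def smooth_fun_def by (auto simp: image_iff subset_iff)
qed

lemma set_integral_reflect_lebesgue:
  fixes f :: "real \<Rightarrow> complex"
  shows "(LINT x:uminus ` S|lebesgue. f x) = (LINT x:S|lebesgue. f (- x))"
proof -
  have "indicator (uminus ` S) (- x) = (indicator S x :: real)" for x
    by (auto simp: indicator_def image_iff)
  then show ?thesis
    unfolding set_lebesgue_integral_def
    using lebesgue_integral_real_affine[of "- 1" "\<lambda>x. indicator (uminus ` S) x *\<^sub>R f x" 0] by simp
qed

lemma weak_deriv_reflect: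
  fixes u g :: "real \<Rightarrow> complex"
  assumes "weak_deriv S u g"
  shows "weak_deriv (uminus ` S) (\<lambda>x. u (- x)) (\<lambda>x. - g (- x))"
  unfolding weak_deriv_def
proof (intro allI impI)
  fix \<phi> assume test: "test_fun (uminus ` S) \<phi>"
  have test': "test_fun S (\<lambda>x. \<phi> (- x))"
    using test_fun_reflect[OF test] by (simp add: image_comp)
  have d: "deriv (\<lambda>x. \<phi> (- x)) x = - deriv \<phi> (- x)" for x
  proof -
    have "((\<lambda>x. \<phi> (- x)) has_real_derivative deriv \<phi> (- x) * (- 1)) (at x)"
      by (rule DERIV_chain2[OF smooth_fun_DERIV[OF test_fun_smooth[OF test]]]) (auto intro!: derivative_eq_intros)
    then show ?thesis by (simp add: DERIV_imp_deriv)
  qed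
  have "(LINT x:uminus ` S|lebesgue. deriv \<phi> x *\<^sub>R u (- x)) = (LINT x:S|lebesgue. deriv \<phi> (- x) *\<^sub>R u x)"
    unfolding set_integral_reflect_lebesgue by simp
  also have "\<dots> = - (LINT x:S|lebesgue. deriv (\<lambda>x. \<phi> (- x)) x *\<^sub>R u x)"
    unfolding d by (simp add: set_lebesgue_integral_def)
  also have "\<dots> = (LINT x:S|lebesgue. \<phi> (- x) *\<^sub>R g x)"
    using assms test' by (simp add: weak_deriv_def)
  also have "\<dots> = - (LINT x:uminus ` S|lebesgue. \<phi> x *\<^sub>R - g (- x))"
    unfolding set_integral_reflect_lebesgue by (simp add: set_lebesgue_integral_def)
  finally show "(LINT x:uminus ` S|lebesgue. deriv \<phi> x *\<^sub>R u (- x)) = - (LINT x:uminus ` S|lebesgue. \<phi> x *\<^sub>R - g (- x))" .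
qed

lemma uminus_half_lines: "uminus ` {..<0} = {0::real<..}" "uminus ` {0<..} = {..<0::real}"
  by (auto simp: image_iff intro: exI[of _ "- x" for x])

lemma weak_deriv_side_iff:
  fixes u g :: "real \<Rightarrow> complex"
  shows "weak_deriv (side_set s) u g \<longleftrightarrow>
    weak_deriv {0<..} (\<lambda>x. u (sg s * x)) (\<lambda>x. of_real (sg s) * g (sg s * x))"
proof (cases s)
  case False
  then show ?thesis
    using weak_deriv_reflect[of "{..<0}" u g] weak_deriv_reflect[of "{0<..}" "\<lambda>x. u (- x)" "\<lambda>x. - g (- x)"]
    by (auto simp: side_set_def uminus_half_lines)
qed (simp add: side_set_def)

lemma L2_side_iff:
  fixes f :: "real \<Rightarrow> complex"
  shows "L2 (side_set s) f \<longleftrightarrow> L2 {0<..} (\<lambda>x. f (sg s * x))"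
proof -
  have ext: "L2 S f \<longleftrightarrow> L2 UNIV (\<lambda>x. indicator S x *\<^sub>R f x)" for S and f :: "real \<Rightarrow> complex"
  proof -
    have "indicator S x *\<^sub>R (cmod (f x))^2 = (cmod (indicator S x *\<^sub>R f x))^2" for x
      by (simp add: indicator_def)
    then show ?thesis by (simp add: L2_def L2_UNIV_iff set_borel_measurable_def set_integrable_def)
  qed
  show ?thesis
  proof (cases s)
    case False
    have e: "indicator {..<0} (- x) = (indicator {0<..} x :: real)" "indicator {0<..} (- x) = (indicator {..<0} x :: real)" for x :: real
      by (auto simp: indicator_def)
    show ?thesis
      using L2_UNIV_reflect[of "\<lambda>x. indicator {..<0} x *\<^sub>R f x"] L2_UNIV_reflect[of "\<lambda>x. indicator {0<..} x *\<^sub>R f (- x)"]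
      unfolding ext[of _ f] ext[of _ "\<lambda>x. f (sg s * x)"] using False by (auto simp: e side_set_def)
  qed (simp add: side_set_def)
qed

text \<open>The passage from the operator graphs to the half-line calculus: a weak derivative on
  either side becomes a primitive on the positive half-line, the factor \<open>sg s\<close> being
  the chain rule for the reflection.\<close>

lemma is_primitive_side_iff_weak_deriv:
  fixes u g :: "real \<Rightarrow> complex"
  assumes "continuous_on (side_closure s) u" "L2 (side_set s) g"
  shows "weak_deriv (side_set s) u g \<longleftrightarrow>
    is_primitive (\<lambda>x. u (sg s * x)) (\<lambda>x. of_real (sg s) * g (sg s * x))"
proof -
  have gL: "L2 {0<..} (\<lambda>x. of_real (sg s) * g (sg s * x))"
    using L2_half_comb(1)[of "\<lambda>x. g (sg s * x)" "\<lambda>x. g (sg s * x)" "of_real (sg s)" 0] assms(2)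
    by (simp add: L2_side_iff)
  have uc: "continuous_on {0..} (\<lambda>x. u (sg s * x))"
    by (rule continuous_on_compose2[OF assms(1)]) (auto simp: sg_def side_closure_def intro!: continuous_intros)
  show ?thesis
    unfolding weak_deriv_side_iff
    using weak_deriv_imp_is_primitive[OF uc L2_half_absolutely_integrable[OF gL]] is_primitive_imp_weak_deriv by blast
qed

lemma continuous_on_side:
  assumes "continuous_on {0..} U"
  shows "continuous_on (side_closure s) (\<lambda>x. U (sg s * x))"
  by (rule continuous_on_compose2[OF assms]) (auto simp: sg_def side_closure_def intro!: continuous_intros)

lemma AE_side_iff:
  "(AE x in lebesgue. x \<in> side_set s \<longrightarrow> P x) \<longleftrightarrow> (AE x in lebesgue. x > 0 \<longrightarrow> P (sg s * x))"
proof (cases s)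
  case False
  have "(AE x in lebesgue. x < 0 \<longrightarrow> P x) \<longleftrightarrow> (AE x in lebesgue. x > 0 \<longrightarrow> P (- x))"
  proof
    assume "AE x in lebesgue. x < 0 \<longrightarrow> P x"
    from AE_lebesgue_reflect[OF this] show "AE x in lebesgue. x > 0 \<longrightarrow> P (- x)" by simp
  next
    assume "AE x in lebesgue. x > 0 \<longrightarrow> P (- x)"
    from AE_lebesgue_reflect[OF this] show "AE x in lebesgue. x < 0 \<longrightarrow> P x" by simp
  qed
  with False show ?thesis by (simp add: side_set_def)
qed (simp add: side_set_def)

section \<open>Functions with values in C^2\<close>

lemma norm_vec2_squared: "(norm v)^2 = (cmod (v $ 1))^2 + (cmod (v $ 2))^2" for v :: "complex^2"
  by (simp add: norm_vec_def L2_set_def sum_2)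

lemma borel_measurable_vec2_iff:
  fixes f :: "real \<Rightarrow> complex^2"
  shows "f \<in> borel_measurable M \<longleftrightarrow> (\<lambda>x. f x $ 1) \<in> borel_measurable M \<and> (\<lambda>x. f x $ 2) \<in> borel_measurable M"
proof
  assume f: "f \<in> borel_measurable M"
  have "(\<lambda>x. f x $ i) \<in> borel_measurable M" for i
    by (rule measurable_compose[OF f]) (intro borel_measurable_continuous_onI continuous_intros)
  then show "(\<lambda>x. f x $ 1) \<in> borel_measurable M \<and> (\<lambda>x. f x $ 2) \<in> borel_measurable M" by blast
next
  assume *: "(\<lambda>x. f x $ 1) \<in> borel_measurable M \<and> (\<lambda>x. f x $ 2) \<in> borel_measurable M"
  have "(\<lambda>x. f x $ i) \<in> borel_measurable M" for i using * exhaust_2[of i] by auto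
  then show "f \<in> borel_measurable M"
    by (subst borel_measurable_euclidean_space)
      (auto simp: Basis_vec_def inner_axis intro!: borel_measurable_inner)
qed

lemma L2_vec2_iff:
  fixes f :: "real \<Rightarrow> complex^2"
  shows "L2 S f \<longleftrightarrow> L2 S (\<lambda>x. f x $ 1) \<and> L2 S (\<lambda>x. f x $ 2)"
proof -
  have m: "set_borel_measurable lebesgue S f \<longleftrightarrow>
      set_borel_measurable lebesgue S (\<lambda>x. f x $ 1) \<and> set_borel_measurable lebesgue S (\<lambda>x. f x $ 2)"
    unfolding set_borel_measurable_def by (subst borel_measurable_vec2_iff) simp
  have sq: "(\<lambda>x. indicator S x *\<^sub>R (cmod (f x $ i))^2) \<in> borel_measurable lebesgue"
    if "set_borel_measurable lebesgue S (\<lambda>x. f x $ i)" for i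
  proof -
    have "(\<lambda>x. (cmod (indicator S x *\<^sub>R f x $ i))^2) \<in> borel_measurable lebesgue"
      using that unfolding set_borel_measurable_def by measurable
    moreover have "(cmod (indicator S x *\<^sub>R f x $ i))^2 = indicator S x *\<^sub>R (cmod (f x $ i))^2" for x
      by (simp add: indicator_def)
    ultimately show ?thesis by simp
  qed
  show ?thesis
  proof
    assume f: "L2 S f"
    have "L2 S (\<lambda>x. f x $ i)" for i
    proof -
      have mi: "set_borel_measurable lebesgue S (\<lambda>x. f x $ i)"
        using f m exhaust_2[of i] by (auto simp: L2_def)
      have "(cmod (f x $ i))^2 \<le> (norm (f x))^2" for x
        unfolding norm_vec2_squared using exhaust_2[of i] by auto
      then have bound: "AE x in lebesgue. x \<in> S \<longrightarrow> norm ((cmod (f x $ i))^2) \<le> norm ((norm (f x))^2)"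
        by simp
      have "set_integrable lebesgue S (\<lambda>x. (cmod (f x $ i))^2)"
      proof (intro set_integrable_bound[of lebesgue S "\<lambda>x. (norm (f x))^2" "\<lambda>x. (cmod (f x $ i))^2"])
        show "set_integrable lebesgue S (\<lambda>x. (norm (f x))^2)" using f by (simp add: L2_def)
        show "set_borel_measurable lebesgue S (\<lambda>x. (cmod (f x $ i))^2)"
          using sq[OF mi] by (simp add: set_borel_measurable_def)
      qed (rule bound)
      then show ?thesis using mi by (simp add: L2_def)
    qed
    then show "L2 S (\<lambda>x. f x $ 1) \<and> L2 S (\<lambda>x. f x $ 2)" by blast
  next
    assume *: "L2 S (\<lambda>x. f x $ 1) \<and> L2 S (\<lambda>x. f x $ 2)"
    then have "set_integrable lebesgue S (\<lambda>x. (cmod (f x $ 1))^2 + (cmod (f x $ 2))^2)"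
      by (intro set_integral_add(1)) (simp_all add: L2_def)
    then show "L2 S f"
      using * unfolding L2_def m norm_vec2_squared by blast
  qed
qed

lemma L2norm_vec2_squared:
  fixes f :: "real \<Rightarrow> complex^2"
  assumes "L2 UNIV f"
  shows "(L2norm f)^2 = (L2norm (\<lambda>x. f x $ 1))^2 + (L2norm (\<lambda>x. f x $ 2))^2"
  using assms unfolding L2norm_squared norm_vec2_squared
  by (intro Bochner_Integration.integral_add) (auto simp: L2_vec2_iff[of _ f] L2_UNIV_iff)

text \<open>\<open>|\<eta> w| \<le> \<eta>^2 + |w|^2\<close> suffices. Integrability has to be known
  because the Bochner integral of a nonintegrable function is 0 by convention, and taking components
  need not commute with that.\<close>

lemma test_mult_L2_integrable:
  fixes w :: "real \<Rightarrow> 'a::{banach, second_countable_topology}"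
  assumes \<eta>: "continuous_on UNIV \<eta>" "\<And>x. x \<notin> {- R..R} \<Longrightarrow> \<eta> x = 0" and w: "L2 S w"
  shows "set_integrable lebesgue S (\<lambda>x. \<eta> x *\<^sub>R w x)"
proof -
  have wm: "(\<lambda>x. indicator S x *\<^sub>R w x) \<in> borel_measurable lebesgue"
    and wi: "integrable lebesgue (\<lambda>x. indicator S x *\<^sub>R (norm (w x))^2)"
    using w by (auto simp: L2_def set_borel_measurable_def set_integrable_def)
  have \<eta>m: "\<eta> \<in> borel_measurable lebesgue"
    using borel_measurable_continuous_onI[OF \<eta>(1)] by (intro measurable_completion) simp
  have "(\<lambda>x. (\<eta> x)^2) absolutely_integrable_on {- R..R}"
    by (intro absolutely_integrable_continuous_real continuous_intros continuous_on_subset[OF \<eta>(1)]) auto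
  then have "integrable lebesgue (\<lambda>x. indicator {- R..R} x *\<^sub>R (\<eta> x)^2)"
    by (simp add: set_integrable_def)
  moreover have "indicator {- R..R} x *\<^sub>R (\<eta> x)^2 = (\<eta> x)^2" for x
    using \<eta>(2)[of x] by (cases "x \<in> {- R..R}") auto
  ultimately have \<eta>i: "integrable lebesgue (\<lambda>x. (\<eta> x)^2)" by (simp only:)
  show ?thesis unfolding set_integrable_def
  proof (rule Bochner_Integration.integrable_bound)
    show "integrable lebesgue (\<lambda>x. (\<eta> x)^2 + indicator S x *\<^sub>R (norm (w x))^2)"
      by (rule Bochner_Integration.integrable_add[OF \<eta>i wi])
    have "(\<lambda>x. \<eta> x *\<^sub>R (indicator S x *\<^sub>R w x)) \<in> borel_measurable lebesgue"
      by (rule borel_measurable_scaleR[OF \<eta>m wm])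
    then show "(\<lambda>x. indicator S x *\<^sub>R \<eta> x *\<^sub>R w x) \<in> borel_measurable lebesgue"
      by (simp only: scaleR_left_commute)
    show "AE x in lebesgue. norm (indicator S x *\<^sub>R \<eta> x *\<^sub>R w x) \<le> norm ((\<eta> x)^2 + indicator S x *\<^sub>R (norm (w x))^2)"
    proof (intro always_eventually allI)
      fix x
      have "0 \<le> (\<bar>\<eta> x\<bar> - norm (w x))^2" by simp
      then have "2 * (\<bar>\<eta> x\<bar> * norm (w x)) \<le> (\<eta> x)^2 + (norm (w x))^2" by (simp add: power2_diff)
      moreover have "0 \<le> \<bar>\<eta> x\<bar> * norm (w x)" by simp
      ultimately have "\<bar>\<eta> x\<bar> * norm (w x) \<le> (\<eta> x)^2 + (norm (w x))^2" by linarith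
      then show "norm (indicator S x *\<^sub>R \<eta> x *\<^sub>R w x) \<le> norm ((\<eta> x)^2 + indicator S x *\<^sub>R (norm (w x))^2)"
        by (simp add: indicator_def)
    qed
  qed
qed

lemma weak_deriv_vec2_iff:
  fixes u g :: "real \<Rightarrow> complex^2"
  assumes u: "L2 S u" and g: "L2 S g"
  shows "weak_deriv S u g \<longleftrightarrow> (\<forall>i. weak_deriv S (\<lambda>x. u x $ i) (\<lambda>x. g x $ i))"
proof -
  have nth: "(LINT x:S|lebesgue. \<eta> x *\<^sub>R w x) $ i = (LINT x:S|lebesgue. \<eta> x *\<^sub>R (w x $ i))"
    if "set_integrable lebesgue S (\<lambda>x. \<eta> x *\<^sub>R w x)" for \<eta> i and w :: "real \<Rightarrow> complex^2"
    using integral_bounded_linear[OF bounded_linear_vec_nth[of i] that[unfolded set_integrable_def]]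
    by (simp add: set_lebesgue_integral_def)
  have int: "set_integrable lebesgue S (\<lambda>x. deriv \<phi> x *\<^sub>R u x)" "set_integrable lebesgue S (\<lambda>x. \<phi> x *\<^sub>R g x)"
    if test: "test_fun S \<phi>" for \<phi>
  proof -
    note sm = test_fun_smooth[OF test]
    have "bounded {x. \<phi> x \<noteq> 0}" using test by (simp add: test_fun_def)
    then obtain R where R: "\<And>x. \<phi> x \<noteq> 0 \<Longrightarrow> \<bar>x\<bar> \<le> R" by (auto simp: bounded_iff)
    have zero: "\<phi> x = 0" if "x \<notin> {- R..R}" for x using R[of x] that by (cases "\<phi> x = 0") auto
    have zero': "deriv \<phi> x = 0" if "x \<notin> {- R..R}" for x
      by (rule deriv_eq_0_open[of "- {- R..R}" _ _ 0]) (use that zero in auto)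
    show "set_integrable lebesgue S (\<lambda>x. deriv \<phi> x *\<^sub>R u x)"
      by (rule test_mult_L2_integrable[OF smooth_fun_continuous[OF smooth_fun_deriv[OF sm]] zero' u])
    show "set_integrable lebesgue S (\<lambda>x. \<phi> x *\<^sub>R g x)"
      by (rule test_mult_L2_integrable[OF smooth_fun_continuous[OF sm] zero g])
  qed
  show ?thesis
    unfolding weak_deriv_def vec_eq_iff using nth int by auto
qed

section \<open>The operator graphs as first-order systems\<close>

lemma L2_half_of_AE_side:
  fixes u w :: "real \<Rightarrow> complex"
  assumes "L2 UNIV u" "AE x in lebesgue. x > 0 \<longrightarrow> u (sg s * x) = w x"
  shows "L2 {0<..} w"
  by (rule L2_half_cong_AE(1)[OF assms(2) L2_UNIV_side[OF assms(1)]])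

lemma L2_half_cmult:
  fixes f :: "real \<Rightarrow> complex"
  assumes "L2 {0<..} f" shows "L2 {0<..} (\<lambda>x. c * f x)"
  using L2_half_comb(1)[OF assms assms, of c 0] by simp

lemma L2_UNIV_cmult:
  fixes f :: "real \<Rightarrow> complex"
  assumes "L2 UNIV f" shows "L2 UNIV (\<lambda>x. c * f x)"
  using L2_UNIV_comb[OF assms assms, of c 0] by simp

text \<open>With \<open>v = u'\<close> the equation \<open>- u'' / (2 m) - z u = \<eta>\<close>
  reads \<open>v' = - 2 m z u - 2 m \<eta>\<close>, which is the case \<open>\<kappa> = 1\<close>
  without source in the equation for \<open>u\<close>. Under reflection \<open>v\<close> gets one
  factor \<open>sg s\<close> and its derivative \<open>w\<close> gets two.\<close>

lemma schr_side_half_sol: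
  fixes u v w \<psi> \<phi> :: "real \<Rightarrow> complex" and m :: real
  assumes m: "m \<noteq> 0" and cont: "continuous_on (side_closure s) u" "continuous_on (side_closure s) v"
    and psi: "L2 UNIV \<psi>" "AE x in lebesgue. x \<in> side_set s \<longrightarrow> \<psi> x = u x"
    and L2: "L2 (side_set s) v" "L2 (side_set s) w"
    and weak: "weak_deriv (side_set s) u v" "weak_deriv (side_set s) v w"
    and phi: "AE x in lebesgue. x \<in> side_set s \<longrightarrow> \<phi> x = - w x / complex_of_real (2 * m)"
  shows "half_sol 1 (- (2 * of_real m * z)) (\<lambda>x. u (sg s * x)) (\<lambda>x. of_real (sg s) * v (sg s * x))
    (\<lambda>x. of_real (sg s) * 0) (\<lambda>x. - (2 * of_real m) * (\<phi> (sg s * x) - z * \<psi> (sg s * x)))"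
  unfolding half_sol_def
proof (intro conjI)
  note psi' = psi(2)[unfolded AE_side_iff] and phi' = phi[unfolded AE_side_iff]
  show "L2 {0<..} (\<lambda>x. u (sg s * x))"
    by (rule L2_half_of_AE_side[OF psi(1) psi'])
  show "L2 {0<..} (\<lambda>x. of_real (sg s) * v (sg s * x))"
    using L2(1) by (intro L2_half_cmult) (simp add: L2_side_iff)
  show "is_primitive (\<lambda>x. u (sg s * x))
      (\<lambda>x. 1 * (of_real (sg s) * v (sg s * x)) + of_real (sg s) * 0)"
    using is_primitive_side_iff_weak_deriv[OF cont(1) L2(1)] weak(1) by simp
  have "is_primitive (\<lambda>x. v (sg s * x)) (\<lambda>x. of_real (sg s) * w (sg s * x))"
    using is_primitive_side_iff_weak_deriv[OF cont(2) L2(2)] weak(2) by simp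
  from is_primitive_cmult[OF this, of "of_real (sg s)"]
  show "is_primitive (\<lambda>x. of_real (sg s) * v (sg s * x)) (\<lambda>x. - (2 * of_real m * z) * u (sg s * x) +
      - (2 * of_real m) * (\<phi> (sg s * x) - z * \<psi> (sg s * x)))"
  proof (rule is_primitive_cong_AE)
    show "AE x in lebesgue. 0 < x \<longrightarrow> - (2 * of_real m * z) * u (sg s * x) +
        - (2 * of_real m) * (\<phi> (sg s * x) - z * \<psi> (sg s * x)) =
        of_real (sg s) * (of_real (sg s) * w (sg s * x))"
      using psi' phi'
    proof eventually_elim
      case (elim x)
      show ?case
      proof
        assume "0 < x"
        then have "\<psi> (sg s * x) = u (sg s * x)" "\<phi> (sg s * x) = - w (sg s * x) / complex_of_real (2 * m)"
          using elim by auto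
        then show "- (2 * of_real m * z) * u (sg s * x) +
            - (2 * of_real m) * (\<phi> (sg s * x) - z * \<psi> (sg s * x)) =
            of_real (sg s) * (of_real (sg s) * w (sg s * x))"
          using m by (cases s) (simp_all add: field_simps)
      qed
    qed
  qed simp
qed

lemma schr_graph_imp_line_sol:
  assumes m: "m \<noteq> 0" and G: "(\<psi>, \<eta>) \<in> schr_shift_graph m \<alpha> \<beta> \<gamma> \<delta> z"
  shows "\<exists>v. line_sol \<alpha> \<beta> \<gamma> \<delta> 1 (- (2 * of_real m * z)) \<psi> v (\<lambda>x. 0) (\<lambda>x. - (2 * of_real m) * \<eta> x)"
    and "L2 UNIV \<psi>" "L2 UNIV \<eta>"
proof -
  obtain \<phi> where phi: "\<eta> = (\<lambda>x. \<phi> x - z * \<psi> x)" and G': "(\<psi>, \<phi>) \<in> schr_graph m \<alpha> \<beta> \<gamma> \<delta>"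
    using G unfolding schr_shift_graph_def by auto
  obtain up um vp vm wp wm where L: "L2 UNIV \<psi>" "L2 UNIV \<phi>"
    and *: "continuous_on {0..} up" "continuous_on {..0} um" "continuous_on {0..} vp" "continuous_on {..0} vm"
      "AE x in lebesgue. x > 0 \<longrightarrow> \<psi> x = up x" "AE x in lebesgue. x < 0 \<longrightarrow> \<psi> x = um x"
      "L2 {0<..} vp" "L2 {..<0} vm" "L2 {0<..} wp" "L2 {..<0} wm"
      "weak_deriv {0<..} up vp" "weak_deriv {..<0} um vm" "weak_deriv {0<..} vp wp" "weak_deriv {..<0} vm wm"
      "AE x in lebesgue. x > 0 \<longrightarrow> \<phi> x = - wp x / complex_of_real (2 * m)"
      "AE x in lebesgue. x < 0 \<longrightarrow> \<phi> x = - wm x / complex_of_real (2 * m)"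
    and bc: "vp 0 - vm 0 = \<alpha> * (up 0 + um 0) / 2 - \<i> * \<beta> * (vp 0 + vm 0) / 2"
      "up 0 - um 0 = - \<i> * \<gamma> * (up 0 + um 0) / 2 - \<delta> * (vp 0 + vm 0) / 2"
    using G' unfolding schr_graph_def by blast
  define u where "u s = (if s then up else um)" for s
  define v where "v s = (if s then vp else vm)" for s
  define w where "w s = (if s then wp else wm)" for s
  have cont: "continuous_on (side_closure s) (u s)" "continuous_on (side_closure s) (v s)"
    and AE: "AE x in lebesgue. x \<in> side_set s \<longrightarrow> \<psi> x = u s x"
      "AE x in lebesgue. x \<in> side_set s \<longrightarrow> \<phi> x = - w s x / complex_of_real (2 * m)"
    and L2: "L2 (side_set s) (v s)" "L2 (side_set s) (w s)"
    and weak: "weak_deriv (side_set s) (u s) (v s)" "weak_deriv (side_set s) (v s) (w s)" for s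
    using * by (cases s; simp add: side_closure_def side_set_def u_def v_def w_def)+
  define U where "U s x = u s (sg s * x)" for s x
  define V where "V s x = of_real (sg s) * v s (sg s * x)" for s x
  have half: "half_sol 1 (- (2 * of_real m * z)) (U s) (V s)
      (\<lambda>x. of_real (sg s) * 0) (\<lambda>x. - (2 * of_real m) * \<eta> (sg s * x))" for s
    unfolding U_def V_def phi by (rule schr_side_half_sol[OF m cont L(1) AE(1) L2 weak AE(2)])
  \<comment> \<open>This undoes the sign from the reflection, so that the glued function is the
    derivative of \<open>\<psi>\<close> in the original orientation.\<close>
  define V' where "V' s x = of_real (sg s) * V s x" for s x
  have V'L: "L2 {0<..} (V' s)" for s
    using half[of s] unfolding V'_def by (intro L2_half_cmult) (simp add: half_sol_def)
  have "line_sol \<alpha> \<beta> \<gamma> \<delta> 1 (- (2 * of_real m * z)) \<psi> (\<lambda>x. V' (x > 0) \<bar>x\<bar>) (\<lambda>x. 0) (\<lambda>x. - (2 * of_real m) * \<eta> x)"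
    unfolding line_sol_def
  proof (intro conjI exI)
    show "L2 UNIV \<psi>" by fact
    show "L2 UNIV (\<lambda>x. V' (x > 0) \<bar>x\<bar>)" by (rule L2_UNIV_glue[OF V'L])
    show "\<forall>s. half_sol 1 (- (2 * of_real m * z)) (U s) (V s)
      (\<lambda>x. of_real (sg s) * 0) (\<lambda>x. - (2 * of_real m) * \<eta> (sg s * x))" using half by blast
    show "transmission \<alpha> \<beta> \<gamma> \<delta> (U True 0) (V True 0) (U False 0) (- V False 0)"
      using bc by (simp add: transmission_def U_def V_def u_def v_def)
    show "\<forall>s. AE x in lebesgue. 0 < x \<longrightarrow> \<psi> (sg s * x) = U s x \<and>
        V' (0 < sg s * x) \<bar>sg s * x\<bar> = of_real (sg s) * V s x"
    proof
      fix s
      show "AE x in lebesgue. 0 < x \<longrightarrow> \<psi> (sg s * x) = U s x \<and>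
        V' (0 < sg s * x) \<bar>sg s * x\<bar> = of_real (sg s) * V s x"
        using AE(1)[of s] unfolding AE_side_iff by eventually_elim (simp add: U_def V'_def sg_def)
    qed
  qed
  then show "\<exists>v. line_sol \<alpha> \<beta> \<gamma> \<delta> 1 (- (2 * of_real m * z)) \<psi> v (\<lambda>x. 0) (\<lambda>x. - (2 * of_real m) * \<eta> x)" by blast
  show "L2 UNIV \<psi>" by fact
  show "L2 UNIV \<eta>" unfolding phi using L2_UNIV_comb[OF L(2,1), of 1 "- z"] by simp
qed

text \<open>The unsimplified second component is the literal form of the members of the shifted
  graph.\<close>

lemma line_sol_imp_schr_graph:
  assumes m: "m \<noteq> 0" and f: "L2 UNIV f"
    and sol: "line_sol \<alpha> \<beta> \<gamma> \<delta> 1 (- (2 * of_real m * z)) \<psi> v (\<lambda>x. 0) (\<lambda>x. - (2 * of_real m) * f x)"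
  shows "(\<psi>, \<lambda>x. (f x + z * \<psi> x) - z * \<psi> x) \<in> schr_shift_graph m \<alpha> \<beta> \<gamma> \<delta> z"
proof -
  obtain U V where L: "L2 UNIV \<psi>"
    and half: "\<And>s. half_sol 1 (- (2 * of_real m * z)) (U s) (V s)
      (\<lambda>x. of_real (sg s) * 0) (\<lambda>x. - (2 * of_real m) * f (sg s * x))"
    and tr: "transmission \<alpha> \<beta> \<gamma> \<delta> (U True 0) (V True 0) (U False 0) (- V False 0)"
    and AE: "\<And>s. AE x in lebesgue. x > 0 \<longrightarrow>
          \<psi> (sg s * x) = U s x \<and> v (sg s * x) = of_real (sg s) * V s x"
    using sol unfolding line_sol_def by blast
  define u where "u s y = U s (sg s * y)" for s y
  define v' where "v' s y = of_real (sg s) * V s (sg s * y)" for s y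
  \<comment> \<open>The second derivative is read off from the equation for
    \<open>v\<close>.\<close>
  define w where "w s y = - (2 * of_real m * z) * u s y + - (2 * of_real m) * f y" for s y
  have UV: "L2 {0<..} (U s)" "L2 {0<..} (V s)" "is_primitive (U s) (V s)"
    "is_primitive (V s) (\<lambda>x. - (2 * of_real m * z) * U s x + - (2 * of_real m) * f (sg s * x))" for s
    using half[of s] by (auto simp: half_sol_def)
  have cont: "continuous_on (side_closure s) (u s)" "continuous_on (side_closure s) (v' s)" for s
    unfolding u_def v'_def
    by (intro continuous_on_side continuous_on_mult[OF continuous_on_const] is_primitive_continuous[OF UV(3)] is_primitive_continuous[OF UV(4)])+
  have AE1: "AE x in lebesgue. x \<in> side_set s \<longrightarrow> \<psi> x = u s x" for s
    unfolding AE_side_iff using AE[of s] by eventually_elim (simp add: u_def)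
  have AE2: "AE x in lebesgue. x \<in> side_set s \<longrightarrow> f x + z * \<psi> x = - w s x / complex_of_real (2 * m)" for s
    using AE1[of s] by eventually_elim (use m in \<open>simp add: w_def field_simps\<close>)
  have L2: "L2 (side_set s) (v' s)" "L2 (side_set s) (w s)" for s
    unfolding L2_side_iff v'_def w_def u_def sg_simps
    by (intro L2_half_cmult L2_half_comb(1) UV L2_UNIV_side f)+
  have w1: "weak_deriv (side_set s) (u s) (v' s)" for s
    unfolding is_primitive_side_iff_weak_deriv[OF cont(1) L2(1)]
    using UV(3)[of s] by (simp add: u_def v'_def mult.assoc[symmetric] flip: of_real_mult)
  have w2: "weak_deriv (side_set s) (v' s) (w s)" for s
    unfolding is_primitive_side_iff_weak_deriv[OF cont(2) L2(2)]
    using is_primitive_cmult[OF UV(4)[of s], of "of_real (sg s)"] by (simp add: u_def v'_def w_def)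
  have "L2 UNIV (\<lambda>x. f x + z * \<psi> x)" using L2_UNIV_comb[OF f L, of 1 z] by simp
  note sides = side_set_def side_closure_def if_True if_False greaterThan_iff lessThan_iff
  note on_sides = cont[of True, unfolded sides] cont[of False, unfolded sides]
    AE1[of True, unfolded sides] AE1[of False, unfolded sides] AE2[of True, unfolded sides] AE2[of False, unfolded sides]
    L2[of True, unfolded sides] L2[of False, unfolded sides] w1[of True, unfolded sides] w1[of False, unfolded sides]
    w2[of True, unfolded sides] w2[of False, unfolded sides]
  have bc: "v' True 0 - v' False 0 = \<alpha> * (u True 0 + u False 0) / 2 - \<i> * \<beta> * (v' True 0 + v' False 0) / 2"
    "u True 0 - u False 0 = - \<i> * \<gamma> * (u True 0 + u False 0) / 2 - \<delta> * (v' True 0 + v' False 0) / 2"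
    using tr by (simp_all add: transmission_def u_def v'_def)
  have "(\<psi>, \<lambda>x. f x + z * \<psi> x) \<in> schr_graph m \<alpha> \<beta> \<gamma> \<delta>"
    unfolding schr_graph_def mem_Collect_eq prod.case
    by (rule conjI, rule L, rule conjI, rule \<open>L2 UNIV (\<lambda>x. f x + z * \<psi> x)\<close>,
        rule exI[of _ "u True"], rule exI[of _ "u False"], rule exI[of _ "v' True"], rule exI[of _ "v' False"],
        rule exI[of _ "w True"], rule exI[of _ "w False"]) (intro conjI on_sides bc)
  then show ?thesis
    unfolding schr_shift_graph_def
    by (intro CollectI exI[of _ \<psi>] exI[of _ "\<lambda>x. f x + z * \<psi> x"] conjI refl)
qed

section \<open>The graph of the Dirac operator\<close>

lemma mat2_mult_vec [simp]:
  "(mat2 a b c d *v x) $ 1 = a * x $ 1 + b * x $ 2" "(mat2 a b c d *v x) $ 2 = c * x $ 1 + d * x $ 2"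
  by (simp_all add: mat2_def matrix_vector_mult_def sum_2)

lemma cmat_scale_mat2: "cmat_scale s (mat2 a b c d) = mat2 (s * a) (s * b) (s * c) (s * d)"
  by (simp add: cmat_scale_def mat2_def vec_eq_iff forall_2)

lemma mat2_add: "mat2 a b c d + mat2 a' b' c' d' = mat2 (a + a') (b + b') (c + c') (d + d')"
  and mat2_diff: "mat2 a b c d - mat2 a' b' c' d' = mat2 (a - a') (b - b') (c - c') (d - d')"
  by (simp_all add: mat2_def vec_eq_iff forall_2)

abbreviation scaled_matrix :: "real \<Rightarrow> real \<Rightarrow> complex \<Rightarrow> complex \<Rightarrow> complex \<Rightarrow> complex \<Rightarrow> complex^2^2" where
  "scaled_matrix m c \<alpha> \<beta> \<gamma> \<delta> \<equiv> mat2 (\<alpha> / complex_of_real (2 * m * c)) \<beta> \<gamma> (complex_of_real (2 * m * c) * \<delta>)"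

text \<open>Because \<open>sigma1\<close> swaps components, the first row concerns the jump of the
  second component and yields the condition on the jump of \<open>v = a \<i> \<psi>2\<close>; the
  second row yields the one for \<open>u\<close>. In the application \<open>a = 2 m c\<close>, and
  with the entries \<open>\<alpha> / a\<close> and \<open>a \<delta>\<close> every power of
  \<open>a\<close> is absorbed into \<open>v\<close>.\<close>

lemma dirac_boundary_iff:
  assumes a: "a \<noteq> 0"
  shows "(cmat_scale (2 * \<i>) sigma1 - mat2 (\<alpha> / a) \<beta> \<gamma> (a * \<delta>)) *v x =
      (cmat_scale (2 * \<i>) sigma1 + mat2 (\<alpha> / a) \<beta> \<gamma> (a * \<delta>)) *v y \<longleftrightarrow>
    transmission \<alpha> \<beta> \<gamma> \<delta> (x $ 1) (a * \<i> * x $ 2) (y $ 1) (a * \<i> * y $ 2)"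
proof -
  define x1 where "x1 = x $ 1"
  define x2 where "x2 = x $ 2"
  define y1 where "y1 = y $ 1"
  define y2 where "y2 = y $ 2"
  define r1 where "r1 = (2 * \<i>) * (x2 - y2) - (\<alpha> / a) * (x1 + y1) - \<beta> * (x2 + y2)"
  define r2 where "r2 = (2 * \<i>) * (x1 - y1) - \<gamma> * (x1 + y1) - a * \<delta> * (x2 + y2)"
  have "(cmat_scale (2 * \<i>) sigma1 - mat2 (\<alpha> / a) \<beta> \<gamma> (a * \<delta>)) *v x =
      (cmat_scale (2 * \<i>) sigma1 + mat2 (\<alpha> / a) \<beta> \<gamma> (a * \<delta>)) *v y \<longleftrightarrow> r1 = 0 \<and> r2 = 0"
    unfolding sigma1_def cmat_scale_mat2 mat2_add mat2_diff vec_eq_iff forall_2 mat2_mult_vec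
      x1_def[symmetric] x2_def[symmetric] y1_def[symmetric] y2_def[symmetric]
    by (auto simp: r1_def r2_def algebra_simps add_divide_distrib)
  \<comment> \<open>The row factors are nonzero and turn the coefficients \<open>2 \<i>\<close> of
    the two jumps into \<open>a \<i>\<close> and 1.\<close>
  also have "\<dots> \<longleftrightarrow> (a / 2) * r1 = 0 \<and> (- \<i> / 2) * r2 = 0" using a by simp
  also have "(a / 2) * r1 = (a * \<i> * x2 - a * \<i> * y2) - (\<alpha> * (x1 + y1) / 2 - \<i> * \<beta> * (a * \<i> * x2 + a * \<i> * y2) / 2)"
    using a by (simp add: r1_def field_simps)
  also have "(- \<i> / 2) * r2 = (x1 - y1) - (- \<i> * \<gamma> * (x1 + y1) / 2 - \<delta> * (a * \<i> * x2 + a * \<i> * y2) / 2)"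
    by (simp add: r2_def field_simps)
  finally show ?thesis
    unfolding transmission_def x1_def x2_def y1_def y2_def by (simp only: right_minus_eq)
qed

lemma sigma_mult_vec [simp]:
  "(sigma1 *v x) $ 1 = x $ 2" "(sigma1 *v x) $ 2 = x $ 1"
  "(sigma3 *v x) $ 1 = x $ 1" "(sigma3 *v x) $ 2 = - x $ 2"
  by (simp_all add: sigma1_def sigma3_def)

lemma L2_UNIV_vec2_add_smult:
  fixes f g :: "real \<Rightarrow> complex^2"
  assumes "L2 UNIV f" "L2 UNIV g"
  shows "L2 UNIV (\<lambda>x. f x + k *s g x)"
proof -
  have L: "L2 UNIV (\<lambda>x. f x $ 1)" "L2 UNIV (\<lambda>x. f x $ 2)" "L2 UNIV (\<lambda>x. g x $ 1)" "L2 UNIV (\<lambda>x. g x $ 2)"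
    using assms by (simp_all add: L2_vec2_iff[of _ f] L2_vec2_iff[of _ g])
  show ?thesis
    using L2_UNIV_comb[OF L(1,3), of 1 k] L2_UNIV_comb[OF L(2,4), of 1 k]
    by (simp add: L2_vec2_iff[of _ "\<lambda>x. f x + k *s g x"])
qed

text \<open>Subtracting \<open>m c^2 + z\<close> cancels the rest energy in the upper row, leaving
  \<open>- z\<close>, and gives \<open>- (2 m c^2 + z)\<close> in the lower one. With
  \<open>v = 2 m c \<i> \<psi>2\<close> the lower row becomes the equation for \<open>u\<close>,
  where \<open>(2 m c^2 + z) / (2 m c^2)\<close> is \<open>\<kappa>\<close>, and the upper row
  becomes the equation for \<open>v\<close>.\<close>

lemma dirac_side_half_sol:
  fixes w d \<psi> \<phi> :: "real \<Rightarrow> complex^2" and m c :: real and z :: complex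
  assumes mc: "m \<noteq> 0" "c \<noteq> 0" and cont: "continuous_on (side_closure s) w"
    and psi: "L2 UNIV \<psi>" "AE x in lebesgue. x \<in> side_set s \<longrightarrow> \<psi> x = w x"
    and L2: "L2 (side_set s) d" and weak: "weak_deriv (side_set s) w d"
    and phi: "AE x in lebesgue. x \<in> side_set s \<longrightarrow> \<phi> x =
            (- \<i> * complex_of_real c) *s (sigma1 *v d x) + complex_of_real (m * c^2) *s (sigma3 *v w x)"
    and chi: "\<And>x. \<eta> x = \<phi> x - (complex_of_real (m * c^2) + z) *s \<psi> x"
  shows "half_sol (1 + z / of_real (2 * m * c^2)) (- (2 * of_real m * z))
    (\<lambda>x. w (sg s * x) $ 1)
    (\<lambda>x. of_real (sg s) * (of_real (2 * m * c) * \<i> * w (sg s * x) $ 2))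
    (\<lambda>x. of_real (sg s) * (\<i> / of_real c * \<eta> (sg s * x) $ 2))
    (\<lambda>x. - (2 * of_real m) * \<eta> (sg s * x) $ 1)"
proof -
  note psi' = psi(2)[unfolded AE_side_iff] and phi' = phi[unfolded AE_side_iff]
  have psiL: "L2 UNIV (\<lambda>x. \<psi> x $ i)" for i
    using psi(1) exhaust_2[of i] by (auto simp: L2_vec2_iff[of _ \<psi>])
  have dL: "L2 (side_set s) (\<lambda>x. d x $ i)" for i
    using L2 exhaust_2[of i] by (auto simp: L2_vec2_iff[of _ d])
  have wL: "L2 {0<..} (\<lambda>x. w (sg s * x) $ i)" for i
  proof (rule L2_half_of_AE_side[OF psiL[of i]])
    show "AE x in lebesgue. 0 < x \<longrightarrow> \<psi> (sg s * x) $ i = w (sg s * x) $ i"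
      using psi' by eventually_elim simp
  qed
  \<comment> \<open>The graph asks for square-integrability of \<open>\<psi>\<close> and of the
    derivative; for the representative \<open>w\<close> it is inferred from \<open>\<psi>\<close>.
    It is what allows the weak derivative to be taken componentwise.\<close>
  have "L2 (side_set s) (\<lambda>x. w x $ i)" for i using wL[of i] by (simp add: L2_side_iff)
  then have "L2 (side_set s) w" by (simp add: L2_vec2_iff[of _ w])
  then have wk: "weak_deriv (side_set s) (\<lambda>x. w x $ i) (\<lambda>x. d x $ i)" for i
    using weak_deriv_vec2_iff[OF _ L2] weak by blast
  have P: "is_primitive (\<lambda>x. w (sg s * x) $ i) (\<lambda>x. of_real (sg s) * d (sg s * x) $ i)" for i
    using is_primitive_side_iff_weak_deriv[OF _ dL[of i], of "\<lambda>x. w x $ i"] wk[of i]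
      continuous_on_component[OF cont, of i] by simp
  \<comment> \<open>\<open>sigma1\<close> puts the derivative of each component into the other row,
    so multiplying the rows by \<open>\<i> / c\<close> gives both derivatives explicitly.\<close>
  have eq: "AE x in lebesgue. 0 < x \<longrightarrow>
      d (sg s * x) $ 1 = \<i> / of_real c * (\<eta> (sg s * x) $ 2 + (of_real (2 * m * c^2) + z) * w (sg s * x) $ 2) \<and>
      d (sg s * x) $ 2 = \<i> / of_real c * (\<eta> (sg s * x) $ 1 + z * w (sg s * x) $ 1)"
    using psi' phi'
  proof eventually_elim
    case (elim x)
    show ?case
    proof
      assume "0 < x"
      then have 1: "\<psi> (sg s * x) = w (sg s * x)" and 2: "\<phi> (sg s * x) =
          (- \<i> * complex_of_real c) *s (sigma1 *v d (sg s * x)) + complex_of_real (m * c^2) *s (sigma3 *v w (sg s * x))"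
        using elim by auto
      show "d (sg s * x) $ 1 = \<i> / of_real c * (\<eta> (sg s * x) $ 2 + (of_real (2 * m * c^2) + z) * w (sg s * x) $ 2) \<and>
        d (sg s * x) $ 2 = \<i> / of_real c * (\<eta> (sg s * x) $ 1 + z * w (sg s * x) $ 1)"
        unfolding chi 1 2 using mc by (simp add: field_simps)
    qed
  qed
  show ?thesis unfolding half_sol_def
  proof (intro conjI)
    show "L2 {0<..} (\<lambda>x. w (sg s * x) $ 1)" by (rule wL)
    show "L2 {0<..} (\<lambda>x. of_real (sg s) * (of_real (2 * m * c) * \<i> * w (sg s * x) $ 2))"
      by (intro L2_half_cmult wL)
    show "is_primitive (\<lambda>x. w (sg s * x) $ 1)
        (\<lambda>x. (1 + z / of_real (2 * m * c^2)) * (of_real (sg s) * (of_real (2 * m * c) * \<i> * w (sg s * x) $ 2)) +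
          of_real (sg s) * (\<i> / of_real c * \<eta> (sg s * x) $ 2))"
    proof (rule is_primitive_cong_AE[OF P[of 1] refl], use eq in eventually_elim, rule impI)
      fix x assume "0 < x \<longrightarrow>
        d (sg s * x) $ 1 = \<i> / of_real c * (\<eta> (sg s * x) $ 2 + (of_real (2 * m * c^2) + z) * w (sg s * x) $ 2) \<and>
        d (sg s * x) $ 2 = \<i> / of_real c * (\<eta> (sg s * x) $ 1 + z * w (sg s * x) $ 1)" and "0 < x"
      then have d: "d (sg s * x) $ 1 = \<i> / of_real c * (\<eta> (sg s * x) $ 2 + (of_real (2 * m * c^2) + z) * w (sg s * x) $ 2)"
        by blast
      have "(1 + z / of_real (2 * m * c^2)) * (\<sigma> * (of_real (2 * m * c) * \<i> * w')) + \<sigma> * (\<i> / of_real c * \<eta>')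
          = \<sigma> * (\<i> / of_real c * (\<eta>' + (of_real (2 * m * c^2) + z) * w'))" for \<sigma> w' \<eta>'
        using mc by (simp add: field_simps power2_eq_square)
      then show "(1 + z / of_real (2 * m * c^2)) * (of_real (sg s) * (of_real (2 * m * c) * \<i> * w (sg s * x) $ 2)) +
          of_real (sg s) * (\<i> / of_real c * \<eta> (sg s * x) $ 2) = of_real (sg s) * d (sg s * x) $ 1"
        unfolding d .
    qed
    show "is_primitive (\<lambda>x. of_real (sg s) * (of_real (2 * m * c) * \<i> * w (sg s * x) $ 2))
        (\<lambda>x. - (2 * of_real m * z) * w (sg s * x) $ 1 + - (2 * of_real m) * \<eta> (sg s * x) $ 1)"
    proof (rule is_primitive_cong_AE[OF is_primitive_cmult[OF P[of 2], of "of_real (sg s) * (of_real (2 * m * c) * \<i>)"]],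
          simp only: mult.assoc, use eq in eventually_elim, rule impI)
      fix x assume "0 < x \<longrightarrow>
        d (sg s * x) $ 1 = \<i> / of_real c * (\<eta> (sg s * x) $ 2 + (of_real (2 * m * c^2) + z) * w (sg s * x) $ 2) \<and>
        d (sg s * x) $ 2 = \<i> / of_real c * (\<eta> (sg s * x) $ 1 + z * w (sg s * x) $ 1)" and "0 < x"
      then have d: "d (sg s * x) $ 2 = \<i> / of_real c * (\<eta> (sg s * x) $ 1 + z * w (sg s * x) $ 1)"
        by blast
      have "- (2 * of_real m * z) * w' + - (2 * of_real m) * \<eta>' =
          of_real (sg s) * (of_real (2 * m * c) * \<i>) * (of_real (sg s) * (\<i> / of_real c * (\<eta>' + z * w')))" for w' \<eta>'
        using mc by (cases s) (simp_all add: field_simps)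
      then show "- (2 * of_real m * z) * w (sg s * x) $ 1 + - (2 * of_real m) * \<eta> (sg s * x) $ 1 =
          of_real (sg s) * (of_real (2 * m * c) * \<i>) * (of_real (sg s) * d (sg s * x) $ 2)"
        unfolding d .
    qed
  qed
qed

lemma dirac_graph_imp_line_sol:
  assumes mc: "m \<noteq> 0" "c \<noteq> 0"
    and G: "(\<psi>, \<eta>) \<in> dirac_shift_graph m c
      (scaled_matrix m c \<alpha> \<beta> \<gamma> \<delta>) z"
  shows "line_sol \<alpha> \<beta> \<gamma> \<delta> (1 + z / of_real (2 * m * c^2)) (- (2 * of_real m * z))
      (\<lambda>x. \<psi> x $ 1) (\<lambda>x. of_real (2 * m * c) * \<i> * \<psi> x $ 2)
      (\<lambda>x. \<i> / of_real c * \<eta> x $ 2) (\<lambda>x. - (2 * of_real m) * \<eta> x $ 1)"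
    and "L2 UNIV \<psi>" "L2 UNIV \<eta>"
proof -
  obtain \<phi> where phi: "\<eta> = (\<lambda>x. \<phi> x - (complex_of_real (m * c^2) + z) *s \<psi> x)"
    and G': "(\<psi>, \<phi>) \<in> dirac_graph m c (scaled_matrix m c \<alpha> \<beta> \<gamma> \<delta>)"
    using G unfolding dirac_shift_graph_def by auto
  obtain up um gp gm where L: "L2 UNIV \<psi>" "L2 UNIV \<phi>"
    and *: "continuous_on {0..} up" "continuous_on {..0} um"
        "AE x in lebesgue. x > 0 \<longrightarrow> \<psi> x = up x"
        "AE x in lebesgue. x < 0 \<longrightarrow> \<psi> x = um x"
        "L2 {0<..} gp" "L2 {..<0} gm"
        "weak_deriv {0<..} up gp" "weak_deriv {..<0} um gm"
        "AE x in lebesgue. x > 0 \<longrightarrow> \<phi> x =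
            (- \<i> * complex_of_real c) *s (sigma1 *v gp x) + complex_of_real (m * c^2) *s (sigma3 *v up x)"
        "AE x in lebesgue. x < 0 \<longrightarrow> \<phi> x =
            (- \<i> * complex_of_real c) *s (sigma1 *v gm x) + complex_of_real (m * c^2) *s (sigma3 *v um x)"
    and bc: "(cmat_scale (2 * \<i>) sigma1 - scaled_matrix m c \<alpha> \<beta> \<gamma> \<delta>) *v up 0 =
      (cmat_scale (2 * \<i>) sigma1 + scaled_matrix m c \<alpha> \<beta> \<gamma> \<delta>) *v um 0"
    using G' unfolding dirac_graph_def by blast
  define w where "w s = (if s then up else um)" for s
  define d where "d s = (if s then gp else gm)" for s
  have cont: "continuous_on (side_closure s) (w s)"
    and AE: "AE x in lebesgue. x \<in> side_set s \<longrightarrow> \<psi> x = w s x"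
      "AE x in lebesgue. x \<in> side_set s \<longrightarrow> \<phi> x =
            (- \<i> * complex_of_real c) *s (sigma1 *v d s x) + complex_of_real (m * c^2) *s (sigma3 *v w s x)"
    and L2: "L2 (side_set s) (d s)" and weak: "weak_deriv (side_set s) (w s) (d s)" for s
    using * by (cases s; simp add: side_closure_def side_set_def w_def d_def)+
  have psiL: "L2 UNIV (\<lambda>x. \<psi> x $ 1)" "L2 UNIV (\<lambda>x. \<psi> x $ 2)" using L(1) by (simp_all add: L2_vec2_iff[of _ \<psi>])
  show "line_sol \<alpha> \<beta> \<gamma> \<delta> (1 + z / of_real (2 * m * c^2)) (- (2 * of_real m * z))
      (\<lambda>x. \<psi> x $ 1) (\<lambda>x. of_real (2 * m * c) * \<i> * \<psi> x $ 2)
      (\<lambda>x. \<i> / of_real c * \<eta> x $ 2) (\<lambda>x. - (2 * of_real m) * \<eta> x $ 1)"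
    unfolding line_sol_def
  proof (intro conjI exI allI)
    show "L2 UNIV (\<lambda>x. \<psi> x $ 1)" "L2 UNIV (\<lambda>x. of_real (2 * m * c) * \<i> * \<psi> x $ 2)"
      by (intro L2_UNIV_cmult psiL)+
    fix s
    show "half_sol (1 + z / of_real (2 * m * c^2)) (- (2 * of_real m * z))
      (\<lambda>x. w s (sg s * x) $ 1)
      (\<lambda>x. of_real (sg s) * (of_real (2 * m * c) * \<i> * w s (sg s * x) $ 2))
      (\<lambda>x. of_real (sg s) * (\<i> / of_real c * \<eta> (sg s * x) $ 2))
      (\<lambda>x. - (2 * of_real m) * \<eta> (sg s * x) $ 1)"
      by (rule dirac_side_half_sol[OF mc cont L(1) AE(1) L2 weak AE(2)]) (simp add: phi)
    show "AE x in lebesgue. 0 < x \<longrightarrow> \<psi> (sg s * x) $ 1 = w s (sg s * x) $ 1 \<and>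
        of_real (2 * m * c) * \<i> * \<psi> (sg s * x) $ 2 =
        of_real (sg s) * (of_real (sg s) * (of_real (2 * m * c) * \<i> * w s (sg s * x) $ 2))"
      using AE(1)[of s] unfolding AE_side_iff by eventually_elim (cases s; simp)
  next
    show "transmission \<alpha> \<beta> \<gamma> \<delta> (w True (sg True * 0) $ 1)
        (of_real (sg True) * (of_real (2 * m * c) * \<i> * w True (sg True * 0) $ 2))
        (w False (sg False * 0) $ 1)
        (- (of_real (sg False) * (of_real (2 * m * c) * \<i> * w False (sg False * 0) $ 2)))"
      using bc dirac_boundary_iff[of "of_real (2 * m * c)" \<alpha> \<beta> \<gamma> \<delta> "up 0" "um 0"] mc
      by (simp add: w_def)
  qed
  show "L2 UNIV \<psi>" by fact
  show "L2 UNIV \<eta>"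
    using L2_UNIV_vec2_add_smult[OF L(2,1), of "- (complex_of_real (m * c^2) + z)"]
    by (simp only: phi vector_smult_lneg ab_group_add_class.ab_diff_conv_add_uminus)
qed

lemma line_sol_imp_dirac_graph:
  fixes f :: "real \<Rightarrow> complex^2"
  assumes mc: "m \<noteq> 0" "c \<noteq> 0" and f: "L2 UNIV f"
    and sol: "line_sol \<alpha> \<beta> \<gamma> \<delta> (1 + z / of_real (2 * m * c^2)) (- (2 * of_real m * z))
      u v (\<lambda>x. \<i> / of_real c * f x $ 2) (\<lambda>x. - (2 * of_real m) * f x $ 1)"
  shows "\<exists>\<psi> \<eta>. (\<psi>, \<eta>) \<in> dirac_shift_graph m c
      (scaled_matrix m c \<alpha> \<beta> \<gamma> \<delta>) z \<and> \<eta> = f"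
proof -
  define \<kappa> where "\<kappa> = 1 + z / of_real (2 * m * c^2)"
  define a where "a = complex_of_real (2 * m * c) * \<i>"
  have a: "a \<noteq> 0" using mc by (simp add: a_def)
  obtain U V where uv: "L2 UNIV u" "L2 UNIV v"
    and half: "\<And>s. half_sol \<kappa> (- (2 * of_real m * z)) (U s) (V s)
      (\<lambda>x. of_real (sg s) * (\<i> / of_real c * f (sg s * x) $ 2)) (\<lambda>x. - (2 * of_real m) * f (sg s * x) $ 1)"
    and tr: "transmission \<alpha> \<beta> \<gamma> \<delta> (U True 0) (V True 0) (U False 0) (- V False 0)"
    and AE: "\<And>s. AE x in lebesgue. x > 0 \<longrightarrow>
          u (sg s * x) = U s x \<and> v (sg s * x) = of_real (sg s) * V s x"
    using sol unfolding line_sol_def \<kappa>_def[symmetric] by blast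
  have fL: "L2 UNIV (\<lambda>x. f x $ 1)" "L2 UNIV (\<lambda>x. f x $ 2)" using f by (simp_all add: L2_vec2_iff[of _ f])
  define w :: "bool \<Rightarrow> real \<Rightarrow> complex^2" where
    "w s y = vector [U s (sg s * y), of_real (sg s) * V s (sg s * y) / a]" for s y
  \<comment> \<open>\<open>d\<close> collects the right-hand sides of the system, transported to
    side \<open>s\<close> and rescaled; that it is the derivative of \<open>w\<close> is the
    primitive property of \<open>U\<close> and \<open>V\<close>.\<close>
  define d :: "bool \<Rightarrow> real \<Rightarrow> complex^2" where
    "d s y = vector [of_real (sg s) * (\<kappa> * V s (sg s * y) + of_real (sg s) * (\<i> / of_real c * f y $ 2)),
      (- (2 * of_real m * z) * U s (sg s * y) + - (2 * of_real m) * f y $ 1) / a]" for s y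
  define \<psi> :: "real \<Rightarrow> complex^2" where "\<psi> x = vector [u x, v x / a]" for x
  define \<phi> :: "real \<Rightarrow> complex^2" where "\<phi> x = f x + (complex_of_real (m * c^2) + z) *s \<psi> x" for x
  have w12: "(\<lambda>y. w s y $ 1) = (\<lambda>y. U s (sg s * y))"
      "(\<lambda>y. w s y $ 2) = (\<lambda>y. of_real (sg s) / a * V s (sg s * y))"
    and d12: "(\<lambda>y. d s y $ 1) = (\<lambda>y. of_real (sg s) * (\<kappa> * V s (sg s * y) + of_real (sg s) * (\<i> / of_real c * f y $ 2)))"
      "(\<lambda>y. d s y $ 2) = (\<lambda>y. (1 / a) * (- (2 * of_real m * z) * U s (sg s * y) + - (2 * of_real m) * f y $ 1))" for s
    by (auto simp: w_def d_def vector_2)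
  have UV: "L2 {0<..} (U s)" "L2 {0<..} (V s)"
    "is_primitive (U s) (\<lambda>x. \<kappa> * V s x + of_real (sg s) * (\<i> / of_real c * f (sg s * x) $ 2))"
    "is_primitive (V s) (\<lambda>x. - (2 * of_real m * z) * U s x + - (2 * of_real m) * f (sg s * x) $ 1)" for s
    using half[of s] by (auto simp: half_sol_def)
  have cont12: "continuous_on (side_closure s) (\<lambda>y. w s y $ 1)" "continuous_on (side_closure s) (\<lambda>y. w s y $ 2)" for s
    unfolding w12
    by (intro continuous_on_side continuous_on_mult[OF continuous_on_const] is_primitive_continuous[OF UV(3)] is_primitive_continuous[OF UV(4)])+
  have cont: "continuous_on (side_closure s) (w s)" for s
  proof -
    have "continuous_on (side_closure s) (\<lambda>y. w s y $ i)" for i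
      using cont12[of s] exhaust_2[of i] by auto
    then have "continuous_on (side_closure s) (\<lambda>y. \<chi> i. w s y $ i)" by (rule continuous_on_vec_lambda)
    then show ?thesis by simp
  qed
  have dL12: "L2 (side_set s) (\<lambda>y. d s y $ 1)" "L2 (side_set s) (\<lambda>y. d s y $ 2)" for s
    unfolding L2_side_iff d12 sg_simps
    by (rule L2_half_cmult, rule L2_half_comb(1), rule UV, rule L2_half_cmult, rule L2_UNIV_side, rule fL)
      (rule L2_half_cmult, rule L2_half_comb(1), rule UV, rule L2_UNIV_side, rule fL)
  then have dL: "L2 (side_set s) (d s)" for s by (simp add: L2_vec2_iff[of _ "d s"])
  have wL12: "L2 (side_set s) (\<lambda>y. w s y $ 1)" "L2 (side_set s) (\<lambda>y. w s y $ 2)" for s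
    unfolding L2_side_iff w12 sg_simps by (intro L2_half_cmult UV)+
  then have wL: "L2 (side_set s) (w s)" for s by (simp add: L2_vec2_iff[of _ "w s"])
  have weak1: "weak_deriv (side_set s) (\<lambda>y. w s y $ 1) (\<lambda>y. d s y $ 1)" for s
    unfolding is_primitive_side_iff_weak_deriv[OF cont12(1) dL12(1)]
    by (rule is_primitive_cong[OF UV(3)[of s]]) (cases s; simp add: w_def d_def vector_2)+
  have weak2: "weak_deriv (side_set s) (\<lambda>y. w s y $ 2) (\<lambda>y. d s y $ 2)" for s
    unfolding is_primitive_side_iff_weak_deriv[OF cont12(2) dL12(2)]
  proof (rule is_primitive_cong[OF is_primitive_cmult[OF UV(4)[of s], of "of_real (sg s) / a"]])
    show "w s (sg s * x) $ 2 = of_real (sg s) / a * V s x" for x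
      by (simp add: w_def vector_2)
    have "\<sigma> * (y / a) = \<sigma> / a * y" for \<sigma> y by simp
    then show "of_real (sg s) * d s (sg s * x) $ 2 = of_real (sg s) / a *
        (- (2 * of_real m * z) * U s x + - (2 * of_real m) * f (sg s * x) $ 1)" for x
      by (simp only: d_def vector_2 sg_simps)
  qed
  have weak: "weak_deriv (side_set s) (w s) (d s)" for s
    unfolding weak_deriv_vec2_iff[OF wL dL] forall_2 using weak1 weak2 by blast
  have AE1: "AE x in lebesgue. x \<in> side_set s \<longrightarrow> \<psi> x = w s x" for s
    unfolding AE_side_iff using AE[of s] by eventually_elim (simp add: \<psi>_def w_def)
  have AE2: "AE x in lebesgue. x \<in> side_set s \<longrightarrow> \<phi> x =
            (- \<i> * complex_of_real c) *s (sigma1 *v d s x) + complex_of_real (m * c^2) *s (sigma3 *v w s x)" for s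
    using AE1[of s]
  proof eventually_elim
    case (elim x)
    define V1 where "V1 = V s (sg s * x)"
    define U1 where "U1 = U s (sg s * x)"
    have e1: "f x $ 1 + (complex_of_real (m * c^2) + z) * U1 =
        (- \<i> * complex_of_real c) * ((- (2 * of_real m * z) * U1 + - (2 * of_real m) * f x $ 1) / a)
        + complex_of_real (m * c^2) * U1"
      using mc by (simp add: a_def field_simps)
    have e2: "f x $ 2 + (complex_of_real (m * c^2) + z) * (of_real (sg s) * V1 / a) =
        (- \<i> * complex_of_real c) * (of_real (sg s) * (\<kappa> * V1 + of_real (sg s) * (\<i> / of_real c * f x $ 2)))
        + complex_of_real (m * c^2) * (- (of_real (sg s) * V1 / a))"
      using mc by (cases s) (simp_all add: a_def \<kappa>_def field_simps power2_eq_square)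
    show ?case
    proof
      assume "x \<in> side_set s"
      then have "\<phi> x = f x + (complex_of_real (m * c^2) + z) *s w s x" using elim by (simp add: \<phi>_def)
      then show "\<phi> x = (- \<i> * complex_of_real c) *s (sigma1 *v d s x) + complex_of_real (m * c^2) *s (sigma3 *v w s x)"
        by (simp only: vec_eq_iff forall_2 vector_add_component vector_smult_component sigma_mult_vec
            w_def d_def vector_2 e1[unfolded U1_def] e2[unfolded V1_def])
    qed
  qed
  have bc: "(cmat_scale (2 * \<i>) sigma1 - scaled_matrix m c \<alpha> \<beta> \<gamma> \<delta>) *v w True 0 =
      (cmat_scale (2 * \<i>) sigma1 + scaled_matrix m c \<alpha> \<beta> \<gamma> \<delta>) *v w False 0"
  proof -
    have nz: "complex_of_real (2 * m * c) \<noteq> 0" using mc by simp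
    show ?thesis
      unfolding dirac_boundary_iff[OF nz] a_def[symmetric]
      using tr a by (simp add: w_def vector_2)
  qed
  have psiL: "L2 UNIV \<psi>"
    using L2_UNIV_cmult[OF uv(2), of "1 / a"] uv(1) by (simp add: L2_vec2_iff[of _ \<psi>] \<psi>_def vector_2)
  have phiL: "L2 UNIV \<phi>"
    unfolding \<phi>_def by (rule L2_UNIV_vec2_add_smult[OF f psiL])
  note sides = side_set_def side_closure_def if_True if_False greaterThan_iff lessThan_iff
  note on_sides = cont[of True, unfolded sides] cont[of False, unfolded sides]
    AE1[of True, unfolded sides] AE1[of False, unfolded sides] AE2[of True, unfolded sides] AE2[of False, unfolded sides]
    dL[of True, unfolded sides] dL[of False, unfolded sides] weak[of True, unfolded sides] weak[of False, unfolded sides]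
  have "(\<psi>, \<phi>) \<in> dirac_graph m c (scaled_matrix m c \<alpha> \<beta> \<gamma> \<delta>)"
    unfolding dirac_graph_def mem_Collect_eq prod.case
    by (rule conjI, rule psiL, rule conjI, rule phiL, rule exI[of _ "w True"], rule exI[of _ "w False"],
        rule exI[of _ "d True"], rule exI[of _ "d False"]) (intro conjI on_sides bc)
  then have "(\<psi>, \<lambda>x. \<phi> x - (complex_of_real (m * c^2) + z) *s \<psi> x) \<in> dirac_shift_graph m c
      (scaled_matrix m c \<alpha> \<beta> \<gamma> \<delta>) z"
    unfolding dirac_shift_graph_def by (intro CollectI exI[of _ \<psi>] exI[of _ \<phi>] conjI refl)
  moreover have "(\<lambda>x. \<phi> x - (complex_of_real (m * c^2) + z) *s \<psi> x) = f" by (simp add: \<phi>_def)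
  ultimately show ?thesis by blast
qed

section \<open>The nonrelativistic limit\<close>

text \<open>A real root would have its square in \<open>[0, \<infinity>)\<close>, so for the
  remaining \<open>w\<close> exactly one of the two roots lies in the upper half-plane.\<close>

lemma sqrt_up_upper:
  assumes "w \<notin> complex_of_real ` {0..}"
  shows "Im (sqrt_up w) > 0" "(sqrt_up w)^2 = w"
proof -
  have "Im (csqrt w) \<noteq> 0"
  proof
    assume "Im (csqrt w) = 0"
    then have "csqrt w = of_real (Re (csqrt w))" by (simp add: complex_eq_iff)
    then have "w = of_real ((Re (csqrt w))^2)" by (metis of_real_power power2_csqrt)
    then show False using assms by (metis atLeast_iff imageI zero_le_power2)
  qed
  moreover have "Im s \<noteq> 0 \<Longrightarrow> Im (if Im s > 0 then s else - s) > 0" for s :: complex by auto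
  ultimately show "Im (sqrt_up w) > 0" unfolding sqrt_up_def by blast
  show "(sqrt_up w)^2 = w" by (simp add: sqrt_up_def)
qed

lemma mu_upper:
  assumes "m > 0" "z \<notin> complex_of_real ` {0..}"
  shows "Im (mu m z) > 0" "(mu m z)^2 = 2 * of_real m * z"
proof -
  have "2 * complex_of_real m * z \<notin> complex_of_real ` {0..}"
  proof
    assume "2 * complex_of_real m * z \<in> complex_of_real ` {0..}"
    then obtain r where r: "r \<ge> 0" "2 * complex_of_real m * z = of_real r" by auto
    then have "z = of_real (r / (2 * m))" using assms(1) by (simp add: field_simps)
    moreover have "r / (2 * m) \<in> {0..}" using r assms(1) by simp
    ultimately show False using assms(2) by blast
  qed
  from sqrt_up_upper[OF this] show "Im (mu m z) > 0" "(mu m z)^2 = 2 * of_real m * z"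
    by (simp_all add: mu_def)
qed

section \<open>Invertibility of graphs and the operator norm\<close>

lemma L2norm_zero_imp_ae_eq:
  assumes "L2 UNIV f" "L2norm f = 0"
  shows "ae_eq f (\<lambda>x. 0)"
proof -
  have i: "integrable lebesgue (\<lambda>x. (norm (f x))^2)" using assms(1) by (simp add: L2_UNIV_iff)
  have "(\<integral>x. (norm (f x))^2 \<partial>lebesgue) = 0" using assms(2) by (simp add: L2norm_def)
  then have "AE x in lebesgue. (norm (f x))^2 = 0"
    using integral_nonneg_eq_0_iff_AE[OF i] by simp
  then show ?thesis unfolding ae_eq_def by eventually_elim simp
qed

lemma L2norm_comb:
  fixes f g :: "real \<Rightarrow> complex"
  assumes "L2 UNIV f" "L2 UNIV g"
  shows "(L2norm (\<lambda>x. a * f x + b * g x))^2 \<le> 2 * (cmod a)^2 * (L2norm f)^2 + 2 * (cmod b)^2 * (L2norm g)^2"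
proof -
  have i: "integrable lebesgue (\<lambda>x. (cmod (f x))^2)" "integrable lebesgue (\<lambda>x. (cmod (g x))^2)"
    "integrable lebesgue (\<lambda>x. (cmod (a * f x + b * g x))^2)"
    using assms L2_UNIV_comb[OF assms, of a b] by (auto simp: L2_UNIV_iff)
  have "(L2norm (\<lambda>x. a * f x + b * g x))^2 \<le>
      (\<integral>x. 2 * (cmod a)^2 * (cmod (f x))^2 + 2 * (cmod b)^2 * (cmod (g x))^2 \<partial>lebesgue)"
    unfolding L2norm_squared
    by (intro integral_mono i Bochner_Integration.integrable_add integrable_mult_right cmod_comb_squared)
  also have "\<dots> = 2 * (cmod a)^2 * (L2norm f)^2 + 2 * (cmod b)^2 * (L2norm g)^2"
    unfolding L2norm_squared using i
    by (subst Bochner_Integration.integral_add) (auto simp del: times_divide_eq_left)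
  finally show ?thesis .
qed

lemma L2norm_cmult:
  fixes f :: "real \<Rightarrow> complex"
  shows "(L2norm (\<lambda>x. a * f x))^2 = (cmod a)^2 * (L2norm f)^2"
  by (simp add: L2norm_squared norm_mult power_mult_distrib)

text \<open>Injectivity is the a priori bound at \<open>L2norm \<phi> = 0\<close>. The bound is
  assumed between squares, as the estimates produce it, and \<open>\<bar>C\<bar>\<close> makes
  taking roots legitimate whatever the sign of \<open>C\<close>.\<close>

lemma invertible_graphI:
  fixes G :: "((real \<Rightarrow> 'a::euclidean_space) \<times> (real \<Rightarrow> 'a)) set"
  assumes surj: "\<And>f. L2 UNIV f \<Longrightarrow> \<exists>\<psi> \<phi>. (\<psi>, \<phi>) \<in> G \<and> ae_eq \<phi> f"
    and L2: "\<And>\<psi> \<phi>. (\<psi>, \<phi>) \<in> G \<Longrightarrow> L2 UNIV \<psi>"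
    and bound: "\<And>\<psi> \<phi>. (\<psi>, \<phi>) \<in> G \<Longrightarrow> (L2norm \<psi>)^2 \<le> C * (L2norm \<phi>)^2"
  shows "invertible_graph G"
  unfolding invertible_graph_def
proof (intro conjI allI impI)
  have le: "L2norm \<psi> \<le> sqrt \<bar>C\<bar> * L2norm \<phi>" if "(\<psi>, \<phi>) \<in> G" for \<psi> \<phi>
  proof -
    have "C * (L2norm \<phi>)^2 \<le> \<bar>C\<bar> * (L2norm \<phi>)^2" by (intro mult_right_mono) auto
    then have "(L2norm \<psi>)^2 \<le> \<bar>C\<bar> * (L2norm \<phi>)^2" using bound[OF that] by linarith
    then have "sqrt ((L2norm \<psi>)^2) \<le> sqrt (\<bar>C\<bar> * (L2norm \<phi>)^2)" by (rule real_sqrt_le_mono)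
    then show ?thesis by (simp add: real_sqrt_mult L2norm_nonneg)
  qed
  show "\<exists>\<psi> \<phi>. (\<psi>, \<phi>) \<in> G \<and> ae_eq \<phi> f" if "L2 UNIV f" for f by (rule surj[OF that])
  show "\<exists>C. \<forall>\<psi> \<phi>. (\<psi>, \<phi>) \<in> G \<longrightarrow> L2norm \<psi> \<le> C * L2norm \<phi>" using le by blast
  show "ae_eq \<psi> (\<lambda>x. 0)" if *: "(\<psi>, \<phi>) \<in> G \<and> ae_eq \<phi> (\<lambda>x. 0)" for \<psi> \<phi>
  proof (rule L2norm_zero_imp_ae_eq)
    show "L2 UNIV \<psi>" using * L2 by blast
    have "L2 UNIV (\<lambda>x. 0 :: 'a)" by (simp add: L2_UNIV_iff)
    moreover have "AE x in lebesgue. 0 = \<phi> x"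
      using *[THEN conjunct2] unfolding ae_eq_def by eventually_elim simp
    ultimately have "L2norm \<phi> = L2norm (\<lambda>x. 0 :: 'a)" by (rule L2_UNIV_cong_AE(2))
    then have "L2norm \<phi> = 0" by (simp add: L2norm_def)
    then have "L2norm \<psi> \<le> 0" using le * by fastforce
    then show "L2norm \<psi> = 0" using L2norm_nonneg[of \<psi>] by linarith
  qed
qed

text \<open>This membership is all that is used about the representative that
  \<open>inv_graph\<close> chooses.\<close>

lemma inv_graph_mem:
  assumes "invertible_graph G" "L2 UNIV f"
  shows "\<exists>\<phi>. (inv_graph G f, \<phi>) \<in> G \<and> ae_eq \<phi> f"
  unfolding inv_graph_def using assms unfolding invertible_graph_def by (metis (mono_tags, lifting) someI_ex)

text \<open>A supremum of reals says something only for a nonempty set bounded above. The choice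
  \<open>f = 0\<close> gives a member, and all members are nonnegative, so a bound \<open>e\<close>
  on the members yields both inequalities.\<close>

lemma opnorm_diff_bounds:
  assumes "\<And>f. L2 UNIV f \<Longrightarrow> L2norm f \<le> 1 \<Longrightarrow> L2norm (\<lambda>x. R f x - S f x) \<le> e"
  shows "0 \<le> opnorm_diff R S" "opnorm_diff R S \<le> e"
proof -
  let ?A = "{L2norm (\<lambda>x. R f x - S f x) | f. L2 UNIV f \<and> L2norm f \<le> 1}"
  have zero: "L2 UNIV (\<lambda>x. 0 :: 'a)" "L2norm (\<lambda>x. 0 :: 'a) \<le> 1"
    by (simp_all add: L2_UNIV_iff L2norm_def)
  have mem: "L2norm (\<lambda>x. R (\<lambda>x. 0) x - S (\<lambda>x. 0) x) \<in> ?A" using zero by blast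
  have le: "y \<le> e" if "y \<in> ?A" for y using that assms by blast
  show "opnorm_diff R S \<le> e"
    unfolding opnorm_diff_def by (rule cSup_least) (use mem le in blast)+
  have "L2norm (\<lambda>x. R (\<lambda>x. 0) x - S (\<lambda>x. 0) x) \<le> Sup ?A"
    by (rule cSup_upper[OF mem]) (use le in \<open>auto intro!: bdd_aboveI\<close>)
  then show "0 \<le> opnorm_diff R S"
    unfolding opnorm_diff_def using L2norm_nonneg order_trans by blast
qed

text \<open>A solution for \<open>\<kappa>\<close> solves the problem for \<open>\<kappa> = 1\<close> with the extra source term \<open>(\<kappa> - 1) v\<close>,
  which can be absorbed when \<open>\<kappa>\<close> is close to 1.\<close>

lemma line_sol_perturbed_estimate:
  assumes C: "0 \<le> C" and est: "\<And>u v g h. \<lbrakk>line_sol \<alpha> \<beta> \<gamma> \<delta> 1 b u v g h; L2 UNIV g; L2 UNIV h\<rbrakk> \<Longrightarrow>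
    (L2norm u)^2 + (L2norm v)^2 \<le> C * ((L2norm g)^2 + (L2norm h)^2)"
    and small: "4 * C * (cmod (\<kappa> - 1))^2 \<le> 1"
    and sol: "line_sol \<alpha> \<beta> \<gamma> \<delta> \<kappa> b u v g h" and g: "L2 UNIV g" and h: "L2 UNIV h"
  shows "(L2norm u)^2 + (L2norm v)^2 \<le> 4 * C * ((L2norm g)^2 + (L2norm h)^2)"
proof -
  have v: "L2 UNIV v" using sol by (simp add: line_sol_def)
  define U where "U = (L2norm u)^2"
  define V where "V = (L2norm v)^2"
  define K where "K = (cmod (\<kappa> - 1))^2"
  have nn: "0 \<le> U" "0 \<le> V" "0 \<le> (L2norm g)^2" "0 \<le> (L2norm h)^2" by (simp_all add: U_def V_def)
  have G: "L2 UNIV (\<lambda>x. g x + (\<kappa> - 1) * v x)" using L2_UNIV_comb[OF g v, of 1 "\<kappa> - 1"] by simp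
  have GN: "(L2norm (\<lambda>x. g x + (\<kappa> - 1) * v x))^2 \<le> 2 * (L2norm g)^2 + 2 * K * V"
    using L2norm_comb[OF g v, of 1 "\<kappa> - 1"] by (simp add: K_def V_def)
  have "U + V \<le> C * ((L2norm (\<lambda>x. g x + (\<kappa> - 1) * v x))^2 + (L2norm h)^2)"
    unfolding U_def V_def by (rule est[OF line_sol_change_kappa[OF sol] G h])
  also have "\<dots> \<le> C * ((2 * (L2norm g)^2 + 2 * K * V) + (L2norm h)^2)"
    by (intro mult_left_mono add_right_mono GN C)
  \<comment> \<open>The part with \<open>v\<close> is isolated with the factor \<open>4 C K\<close>,
    at most 1 by assumption, so that it costs half of \<open>V\<close> and goes to the left.\<close>
  also have "\<dots> = C * (2 * (L2norm g)^2 + (L2norm h)^2) + (4 * C * K) * V / 2"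
    by (simp add: algebra_simps)
  also have "\<dots> \<le> C * (2 * (L2norm g)^2 + (L2norm h)^2) + 1 * V / 2"
    using small nn by (intro add_left_mono divide_right_mono mult_right_mono) (simp_all add: K_def)
  also have "\<dots> \<le> C * (2 * (L2norm g)^2 + 2 * (L2norm h)^2) + (U + V) / 2"
    using nn C by (intro add_mono mult_left_mono) auto
  finally have le: "U + V \<le> C * (2 * (L2norm g)^2 + 2 * (L2norm h)^2) + (U + V) / 2" .
  have "T \<le> 2 * K'" if "T \<le> K' + T / 2" for T K' :: real using that by simp
  from this[OF le] have "U + V \<le> 2 * (C * (2 * (L2norm g)^2 + 2 * (L2norm h)^2))" .
  then show ?thesis by (simp add: U_def V_def algebra_simps)
qed

theorem theorem5p1:
  fixes m :: real and \<alpha> \<beta> \<gamma> \<delta> z :: complex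
  assumes "m > 0"
    and "z \<notin> complex_of_real ` {0..}"
    and "4 - det (mat2 \<alpha> \<beta> \<gamma> \<delta>) + 2 * \<i> / mu m z * \<alpha> + 2 * \<i> * mu m z * \<delta> \<noteq> 0"
  shows "invertible_graph (schr_shift_graph m \<alpha> \<beta> \<gamma> \<delta> z) \<and>
    (\<forall>\<^sub>F c in at_top.
       invertible_graph (dirac_shift_graph m c
         (mat2 (\<alpha> / complex_of_real (2 * m * c)) \<beta> \<gamma> (complex_of_real (2 * m * c) * \<delta>)) z)) \<and>
    ((\<lambda>c. opnorm_diff
        (inv_graph (dirac_shift_graph m c
           (mat2 (\<alpha> / complex_of_real (2 * m * c)) \<beta> \<gamma> (complex_of_real (2 * m * c) * \<delta>)) z))
        (\<lambda>f x. vector [inv_graph (schr_shift_graph m \<alpha> \<beta> \<gamma> \<delta> z) (\<lambda>y. f y $ 1) x, 0]))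
      \<longlongrightarrow> 0) at_top"
proof -
  define \<mu> where "\<mu> = mu m z"
  have \<mu>: "Im \<mu> > 0" "\<mu>^2 = 2 * of_real m * z" using mu_upper[OF assms(1,2)] by (simp_all add: \<mu>_def)
  have "\<mu> \<noteq> 0" using \<mu>(1) by auto
  have m0: "m \<noteq> 0" using assms(1) by simp
  define b where "b = - (2 * complex_of_real m * z)"
  \<comment> \<open>The determinant of the transmission system as a function of
    \<open>\<nu>\<close>, the ratio of \<open>v\<close> to \<open>u\<close> in the decaying
    solution.\<close>
  define D where "D \<nu> = (\<nu> - \<alpha> / 2) * (1 + \<delta> * \<nu> / 2) + \<beta> * \<gamma> * \<nu> / 4" for \<nu>
  \<comment> \<open>\<open>4 D (\<i> \<mu>)\<close> is \<open>\<i> \<mu>\<close> times the quantity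
    assumed not to vanish.\<close>
  have D0: "D (\<i> * \<mu>) \<noteq> 0"
  proof -
    have ii: "\<i> * (\<i> * x) = - x" for x by (simp flip: mult.assoc)
    have "4 * D (\<i> * \<mu>) = (\<i> * \<mu>) * (4 - (\<alpha> * \<delta> - \<beta> * \<gamma>) + 2 * \<i> / \<mu> * \<alpha> + 2 * \<i> * \<mu> * \<delta>)"
      using \<open>\<mu> \<noteq> 0\<close> by (simp add: D_def field_simps ii)
    moreover have "det (mat2 \<alpha> \<beta> \<gamma> \<delta>) = \<alpha> * \<delta> - \<beta> * \<gamma>" by (simp add: det_2 mat2_def)
    ultimately show ?thesis using assms(3) \<open>\<mu> \<noteq> 0\<close> by (auto simp: \<mu>_def)
  qed
  \<comment> \<open>\<open>Re (\<i> \<mu>) = - Im \<mu>\<close>, so the branch with positive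
    imaginary part makes \<open>\<i> \<mu>\<close> a decay rate.\<close>
  have neg1: "Re (1 * (\<i> * \<mu>)) < 0" and nz1: "\<i> * \<mu> \<noteq> 0" and b1: "1 * (\<i> * \<mu>)^2 = b"
    using \<mu> \<open>\<mu> \<noteq> 0\<close> by (simp_all add: b_def power_mult_distrib)
  obtain C where C: "C \<ge> 0" and est: "\<And>u v g h. \<lbrakk>line_sol \<alpha> \<beta> \<gamma> \<delta> 1 b u v g h; L2 UNIV g; L2 UNIV h\<rbrakk> \<Longrightarrow>
    (L2norm u)^2 + (L2norm v)^2 \<le> C * ((L2norm g)^2 + (L2norm h)^2)"
    using line_sol_estimate[OF neg1 nz1 D0[unfolded D_def]] unfolding b1 by blast
  have L2_0: "L2 UNIV (\<lambda>x. 0 :: complex)" "L2norm (\<lambda>x. 0 :: complex) = 0"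
    by (simp_all add: L2_UNIV_iff L2norm_def)

  have schr: "invertible_graph (schr_shift_graph m \<alpha> \<beta> \<gamma> \<delta> z)"
  proof (rule invertible_graphI)
    fix f :: "real \<Rightarrow> complex" assume f: "L2 UNIV f"
    obtain u v where "line_sol \<alpha> \<beta> \<gamma> \<delta> 1 b u v (\<lambda>x. 0) (\<lambda>x. - (2 * of_real m) * f x)"
      using line_sol_exists[OF neg1 nz1 D0[unfolded D_def] L2_0(1) L2_UNIV_cmult[OF f]] unfolding b1 by blast
    then have "(u, \<lambda>x. (f x + z * u x) - z * u x) \<in> schr_shift_graph m \<alpha> \<beta> \<gamma> \<delta> z"
      unfolding b_def by (rule line_sol_imp_schr_graph[OF m0 f])
    moreover have "ae_eq (\<lambda>x. (f x + z * u x) - z * u x) f" by (simp add: ae_eq_def)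
    ultimately show "\<exists>\<psi> \<phi>. (\<psi>, \<phi>) \<in> schr_shift_graph m \<alpha> \<beta> \<gamma> \<delta> z \<and> ae_eq \<phi> f" by blast
  next
    fix \<psi> \<phi> assume G: "(\<psi>, \<phi>) \<in> schr_shift_graph m \<alpha> \<beta> \<gamma> \<delta> z"
    note S = schr_graph_imp_line_sol[OF m0 G]
    show "L2 UNIV \<psi>" by (rule S(2))
    obtain v where "line_sol \<alpha> \<beta> \<gamma> \<delta> 1 b \<psi> v (\<lambda>x. 0) (\<lambda>x. - (2 * of_real m) * \<phi> x)"
      using S(1) unfolding b_def by blast
    from est[OF this L2_0(1) L2_UNIV_cmult[OF S(3)]]
    have "(L2norm \<psi>)^2 + (L2norm v)^2 \<le> C * (cmod (- (2 * of_real m)))^2 * (L2norm \<phi>)^2"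
      unfolding L2norm_cmult L2_0(2) by (simp add: mult.assoc)
    then show "(L2norm \<psi>)^2 \<le> C * (cmod (- (2 * of_real m)))^2 * (L2norm \<phi>)^2"
      using zero_le_power2[of "L2norm v"] by linarith
  qed

  define \<kappa> where "\<kappa> c = 1 + z / of_real (2 * m * c^2)" for c :: real
  define G where "G c = dirac_shift_graph m c
         (scaled_matrix m c \<alpha> \<beta> \<gamma> \<delta>) z" for c
  have inv_c: "((\<lambda>c::real. 1 / c^2) \<longlongrightarrow> 0) at_top"
    by (intro tendsto_divide_0[OF tendsto_const] filterlim_at_top_imp_at_infinity filterlim_pow_at_top filterlim_ident) simp
  have \<kappa>_eq: "\<kappa> c = 1 + of_real (1 / c^2) * (z / of_real (2 * m))" for c
    by (simp add: \<kappa>_def)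
  have \<kappa>_lim: "(\<kappa> \<longlongrightarrow> 1) at_top"
  proof -
    have "((\<lambda>c. 1 + complex_of_real (1 / c^2) * (z / of_real (2 * m))) \<longlongrightarrow> 1 + complex_of_real 0 * (z / of_real (2 * m))) at_top"
      by (intro tendsto_intros inv_c)
    then show ?thesis by (simp add: \<kappa>_eq[abs_def])
  qed
  \<comment> \<open>Dividing by the root keeps \<open>\<kappa> \<nu>^2 = - \<mu>^2 = b\<close>
    whenever \<open>\<kappa> c \<noteq> 0\<close>. Continuity of \<open>csqrt\<close> at 1 gives the
    limit \<open>\<i> \<mu>\<close>.\<close>
  define \<nu> where "\<nu> c = \<i> * \<mu> / csqrt (\<kappa> c)" for c
  have sq_lim: "((\<lambda>c. csqrt (\<kappa> c)) \<longlongrightarrow> 1) at_top"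
    using isCont_tendsto_compose[OF continuous_at_csqrt \<kappa>_lim] by simp
  have \<nu>_lim: "(\<nu> \<longlongrightarrow> \<i> * \<mu>) at_top"
    unfolding \<nu>_def using tendsto_divide[OF tendsto_const[of "\<i> * \<mu>"] sq_lim] by simp
  \<comment> \<open>Apart from \<open>c > 0\<close>, each condition is open and holds in the limit
    \<open>\<kappa> = 1\<close>, \<open>\<nu> = \<i> \<mu>\<close>; the last one is the smallness
    that the perturbation argument asks for.\<close>
  have ev: "\<forall>\<^sub>F c in at_top. c > 0 \<and> \<kappa> c \<noteq> 0 \<and> Re (\<kappa> c * \<nu> c) < 0 \<and> D (\<nu> c) \<noteq> 0 \<and> 4 * C * (cmod (\<kappa> c - 1))^2 < 1"
  proof (intro eventually_conj)
    show "\<forall>\<^sub>F c in at_top. (c::real) > 0" by (rule eventually_gt_at_top)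
    show "\<forall>\<^sub>F c in at_top. \<kappa> c \<noteq> 0" using \<kappa>_lim by (rule tendsto_imp_eventually_ne) simp
    have "((\<lambda>c. Re (\<kappa> c * \<nu> c)) \<longlongrightarrow> Re (1 * (\<i> * \<mu>))) at_top"
      by (intro tendsto_intros \<kappa>_lim \<nu>_lim)
    then show "\<forall>\<^sub>F c in at_top. Re (\<kappa> c * \<nu> c) < 0" using neg1 by (rule order_tendstoD)
    have "((\<lambda>c. D (\<nu> c)) \<longlongrightarrow> D (\<i> * \<mu>)) at_top"
      unfolding D_def by (intro tendsto_intros \<nu>_lim) auto
    then show "\<forall>\<^sub>F c in at_top. D (\<nu> c) \<noteq> 0" using D0 by (rule tendsto_imp_eventually_ne)
    have "((\<lambda>c. 4 * C * (cmod (\<kappa> c - 1))^2) \<longlongrightarrow> 4 * C * (cmod (1 - 1))^2) at_top"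
      by (intro tendsto_intros \<kappa>_lim)
    then show "\<forall>\<^sub>F c in at_top. 4 * C * (cmod (\<kappa> c - 1))^2 < 1" by (rule order_tendstoD) simp
  qed
  \<comment> \<open>\<open>V c\<close> bounds \<open>(L2norm v)^2\<close> for data of norm at most
    1: \<open>4 C\<close> is the constant of the perturbed estimate, \<open>1 / c^2\<close> stems
    from the source \<open>\<i> f2 / c\<close> and \<open>4 m^2\<close> from
    \<open>- 2 m f1\<close>. It stays bounded as \<open>c\<close> grows.\<close>
  define V where "V c = 4 * C * (1 / c^2 + 4 * m^2)" for c :: real
  \<comment> \<open>The first summand bounds the squared distance of the upper components, the
    second, \<open>V c / (2 m c)^2\<close>, the square of the lower one. Altogether
    \<open>\<epsilon> c\<close> is of order \<open>1 / c^2\<close>.\<close>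
  define \<epsilon> where "\<epsilon> c = 2 * C * (1 / c^2 + (cmod (\<kappa> c - 1))^2 * V c) + V c / (4 * m^2) * (1 / c^2)" for c :: real
  have \<epsilon>_lim: "((\<lambda>c. sqrt (\<epsilon> c)) \<longlongrightarrow> 0) at_top"
  proof -
    have Vl: "(V \<longlongrightarrow> 4 * C * (0 + 4 * m^2)) at_top"
      unfolding V_def by (intro tendsto_intros inv_c)
    have "(\<epsilon> \<longlongrightarrow> 2 * C * (0 + (cmod (1 - 1))^2 * (4 * C * (0 + 4 * m^2))) + 4 * C * (0 + 4 * m^2) / (4 * m^2) * 0) at_top"
      unfolding \<epsilon>_def by (intro tendsto_intros inv_c Vl \<kappa>_lim) (use m0 in simp)
    then have "(\<epsilon> \<longlongrightarrow> 0) at_top" by simp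
    from tendsto_real_sqrt[OF this] show ?thesis by simp
  qed

  define S :: "(real \<Rightarrow> complex^2) \<Rightarrow> real \<Rightarrow> complex^2" where
    "S f x = vector [inv_graph (schr_shift_graph m \<alpha> \<beta> \<gamma> \<delta> z) (\<lambda>y. f y $ 1) x, 0]" for f x
  have main: "invertible_graph (G c) \<and>
      0 \<le> opnorm_diff (inv_graph (G c)) S \<and>
      opnorm_diff (inv_graph (G c)) S \<le> sqrt (\<epsilon> c)"
    if c: "c > 0" "\<kappa> c \<noteq> 0" "Re (\<kappa> c * \<nu> c) < 0" "D (\<nu> c) \<noteq> 0" "4 * C * (cmod (\<kappa> c - 1))^2 < 1" for c
  proof -
    have c0: "c \<noteq> 0" using c(1) by simp
    have \<nu>0: "\<nu> c \<noteq> 0" using \<open>\<mu> \<noteq> 0\<close> c(2) by (simp add: \<nu>_def)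
    have bc: "\<kappa> c * (\<nu> c)^2 = b"
      using c(2) \<mu>(2) by (simp add: \<nu>_def power_divide power_mult_distrib b_def)
    \<comment> \<open>The factor between the squared norms of \<open>v\<close> and of
      \<open>\<psi>2\<close>.\<close>
    define a where "a = (2 * m * c)^2"
    have a: "a > 0" using m0 c0 by (simp add: a_def)
    have sol: "line_sol \<alpha> \<beta> \<gamma> \<delta> (\<kappa> c) b (\<lambda>x. \<psi> x $ 1) (\<lambda>x. of_real (2 * m * c) * \<i> * \<psi> x $ 2)
        (\<lambda>x. \<i> / of_real c * \<eta> x $ 2) (\<lambda>x. - (2 * of_real m) * \<eta> x $ 1)"
      and L2: "L2 UNIV \<psi>" "L2 UNIV \<eta>"
      if "(\<psi>, \<eta>) \<in> G c" for \<psi> \<eta>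
      using dirac_graph_imp_line_sol[OF m0 c0 that[unfolded G_def]] unfolding \<kappa>_def b_def by blast+
    have bound: "(L2norm (\<lambda>x. \<psi> x $ 1))^2 + a * (L2norm (\<lambda>x. \<psi> x $ 2))^2 \<le> V c * (L2norm \<eta>)^2"
      if G: "(\<psi>, \<eta>) \<in> G c" for \<psi> \<eta>
    proof -
      have \<eta>: "L2 UNIV (\<lambda>x. \<eta> x $ 1)" "L2 UNIV (\<lambda>x. \<eta> x $ 2)"
        using L2(2)[OF G] by (simp_all add: L2_vec2_iff[of _ \<eta>])
      define N1 where "N1 = (L2norm (\<lambda>x. \<eta> x $ 1))^2"
      define N2 where "N2 = (L2norm (\<lambda>x. \<eta> x $ 2))^2"
      have "(L2norm (\<lambda>x. \<psi> x $ 1))^2 + (L2norm (\<lambda>x. of_real (2 * m * c) * \<i> * \<psi> x $ 2))^2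
          \<le> 4 * C * ((L2norm (\<lambda>x. \<i> / of_real c * \<eta> x $ 2))^2 + (L2norm (\<lambda>x. - (2 * of_real m) * \<eta> x $ 1))^2)"
        using line_sol_perturbed_estimate[OF C est less_imp_le[OF c(5)] sol[OF G] L2_UNIV_cmult[OF \<eta>(2)] L2_UNIV_cmult[OF \<eta>(1)]] .
      then have "(L2norm (\<lambda>x. \<psi> x $ 1))^2 + a * (L2norm (\<lambda>x. \<psi> x $ 2))^2 \<le> 4 * C * (1 / c^2 * N2 + 4 * m^2 * N1)"
        unfolding L2norm_cmult N1_def N2_def
        by (simp add: norm_mult norm_divide a_def power_mult_distrib power_divide)
      also have "\<dots> \<le> 4 * C * ((1 / c^2 + 4 * m^2) * (N1 + N2))"
      proof (rule mult_left_mono)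
        have "0 \<le> 1 / c^2 * N1" "0 \<le> 4 * m^2 * N2" by (simp_all add: N1_def N2_def)
        then show "1 / c^2 * N2 + 4 * m^2 * N1 \<le> (1 / c^2 + 4 * m^2) * (N1 + N2)"
          unfolding distrib_left distrib_right by linarith
      qed (use C in simp)
      also have "\<dots> = V c * (L2norm \<eta>)^2"
        by (simp add: V_def L2norm_vec2_squared[OF L2(2)[OF G]] N1_def N2_def)
      finally show ?thesis .
    qed
    have inv: "invertible_graph (G c)"
    proof (rule invertible_graphI)
      fix f :: "real \<Rightarrow> complex^2" assume f: "L2 UNIV f"
      have f12: "L2 UNIV (\<lambda>x. f x $ 1)" "L2 UNIV (\<lambda>x. f x $ 2)" using f by (simp_all add: L2_vec2_iff[of _ f])
      obtain u v where "line_sol \<alpha> \<beta> \<gamma> \<delta> (\<kappa> c) b u v (\<lambda>x. \<i> / of_real c * f x $ 2) (\<lambda>x. - (2 * of_real m) * f x $ 1)"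
        using line_sol_exists[OF c(3) \<nu>0 c(4)[unfolded D_def] L2_UNIV_cmult[OF f12(2)] L2_UNIV_cmult[OF f12(1)]]
        unfolding bc by blast
      then show "\<exists>\<psi> \<phi>. (\<psi>, \<phi>) \<in> G c \<and> ae_eq \<phi> f"
        using line_sol_imp_dirac_graph[OF m0 c0 f] unfolding \<kappa>_def b_def G_def ae_eq_def
        by (metis (mono_tags, lifting) AE_I2)
    next
      fix \<psi> \<eta> assume G: "(\<psi>, \<eta>) \<in> G c"
      show "L2 UNIV \<psi>" by (rule L2(1)[OF G])
      define P1 where "P1 = (L2norm (\<lambda>x. \<psi> x $ 1))^2"
      define P2 where "P2 = (L2norm (\<lambda>x. \<psi> x $ 2))^2"
      have "0 \<le> P1" "0 \<le> P2" by (simp_all add: P1_def P2_def)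
      \<comment> \<open>The sum of \<open>P1 \<le> P1 + a P2\<close> and
        \<open>P2 \<le> (P1 + a P2) / a\<close>.\<close>
      then have "P1 + P2 \<le> (1 + 1 / a) * (P1 + a * P2)" using a by (simp add: field_simps)
      also have "\<dots> \<le> (1 + 1 / a) * (V c * (L2norm \<eta>)^2)"
        using bound[OF G] a by (intro mult_left_mono) (simp_all add: P1_def P2_def)
      finally show "(L2norm \<psi>)^2 \<le> ((1 + 1 / a) * V c) * (L2norm \<eta>)^2"
        by (simp add: L2norm_vec2_squared[OF L2(1)[OF G]] P1_def P2_def mult.assoc)
    qed
    have diff: "L2norm (\<lambda>x. inv_graph (G c) f x - S f x) \<le> sqrt (\<epsilon> c)"
      if f: "L2 UNIV f" and f1: "L2norm f \<le> 1" for f :: "real \<Rightarrow> complex^2"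
    proof -
      have f12: "L2 UNIV (\<lambda>x. f x $ 1)" "L2 UNIV (\<lambda>x. f x $ 2)" using f by (simp_all add: L2_vec2_iff[of _ f])
      define \<psi> where "\<psi> = inv_graph (G c) f"
      define \<psi>0 where "\<psi>0 = inv_graph (schr_shift_graph m \<alpha> \<beta> \<gamma> \<delta> z) (\<lambda>y. f y $ 1)"
      obtain \<eta> where \<eta>: "(\<psi>, \<eta>) \<in> G c" "ae_eq \<eta> f"
        using inv_graph_mem[OF inv f] unfolding \<psi>_def by blast
      obtain \<eta>0 where \<eta>0: "(\<psi>0, \<eta>0) \<in> schr_shift_graph m \<alpha> \<beta> \<gamma> \<delta> z" "ae_eq \<eta>0 (\<lambda>y. f y $ 1)"
        using inv_graph_mem[OF schr f12(1)] unfolding \<psi>0_def by blast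
      define v where "v x = of_real (2 * m * c) * \<i> * \<psi> x $ 2" for x
      obtain v0 where v0: "line_sol \<alpha> \<beta> \<gamma> \<delta> 1 b \<psi>0 v0 (\<lambda>x. 0) (\<lambda>x. - (2 * of_real m) * \<eta>0 x)"
        using schr_graph_imp_line_sol(1)[OF m0 \<eta>0(1)] unfolding b_def by blast
      have N: "(L2norm f)^2 \<le> 1" using f1 L2norm_nonneg[of f] by (simp add: power_le_one)
      have \<eta>N: "L2norm \<eta> = L2norm f"
        using L2_UNIV_cong_AE(2)[OF L2(2)[OF \<eta>(1)] \<eta>(2)[unfolded ae_eq_def]] by (rule sym)
      have N2: "(L2norm (\<lambda>x. f x $ 2))^2 \<le> 1"
        using N zero_le_power2[of "L2norm (\<lambda>x. f x $ 1)"] unfolding L2norm_vec2_squared[OF f] by linarith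
      have "line_sol \<alpha> \<beta> \<gamma> \<delta> (\<kappa> c) b (\<lambda>x. \<psi> x $ 1) v (\<lambda>x. \<i> / of_real c * f x $ 2) (\<lambda>x. - (2 * of_real m) * f x $ 1)"
        unfolding v_def
        by (rule line_sol_cong_AE[OF sol[OF \<eta>(1)]]; use \<eta>(2)[unfolded ae_eq_def] in eventually_elim) simp_all
      \<comment> \<open>At \<open>\<kappa> = 1\<close> the Dirac solution is comparable with
        \<open>\<psi>0\<close>: both solve the same system with the same \<open>h\<close>, and their
        sources in the equation for \<open>u\<close> differ by a small term.\<close>
      then have s1: "line_sol \<alpha> \<beta> \<gamma> \<delta> 1 b (\<lambda>x. \<psi> x $ 1) v (\<lambda>x. \<i> / of_real c * f x $ 2 + (\<kappa> c - 1) * v x) (\<lambda>x. - (2 * of_real m) * f x $ 1)"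
        by (rule line_sol_change_kappa)
      have s0: "line_sol \<alpha> \<beta> \<gamma> \<delta> 1 b \<psi>0 v0 (\<lambda>x. 0) (\<lambda>x. - (2 * of_real m) * f x $ 1)"
        by (rule line_sol_cong_AE[OF v0]; use \<eta>0(2)[unfolded ae_eq_def] in eventually_elim) simp_all
      have \<psi>L: "L2 UNIV (\<lambda>x. \<psi> x $ 1)" "L2 UNIV (\<lambda>x. \<psi> x $ 2)"
        using L2(1)[OF \<eta>(1)] by (simp_all add: L2_vec2_iff[of _ \<psi>])
      have vL: "L2 UNIV v" unfolding v_def by (rule L2_UNIV_cmult[OF \<psi>L(2)])
      have vN: "(L2norm v)^2 = a * (L2norm (\<lambda>x. \<psi> x $ 2))^2"
        unfolding v_def L2norm_cmult by (simp add: norm_mult a_def power_mult_distrib)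
      have "0 \<le> V c" using C by (simp add: V_def)
      have vV: "(L2norm v)^2 \<le> V c"
      proof -
        have "(L2norm v)^2 \<le> V c * (L2norm f)^2"
          using bound[OF \<eta>(1)] zero_le_power2[of "L2norm (\<lambda>x. \<psi> x $ 1)"] unfolding vN \<eta>N by linarith
        also have "\<dots> \<le> V c * 1" by (rule mult_left_mono[OF N \<open>0 \<le> V c\<close>])
        finally show ?thesis by simp
      qed
      have gL: "L2 UNIV (\<lambda>x. \<i> / of_real c * f x $ 2 + (\<kappa> c - 1) * v x)"
        by (rule L2_UNIV_comb[OF f12(2) vL])
      have gN: "(L2norm (\<lambda>x. \<i> / of_real c * f x $ 2 + (\<kappa> c - 1) * v x))^2 \<le> 2 * (1 / c^2 + (cmod (\<kappa> c - 1))^2 * V c)"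
      proof -
        have "(L2norm (\<lambda>x. \<i> / of_real c * f x $ 2 + (\<kappa> c - 1) * v x))^2 \<le>
            2 * (cmod (\<i> / of_real c))^2 * (L2norm (\<lambda>x. f x $ 2))^2 + 2 * (cmod (\<kappa> c - 1))^2 * (L2norm v)^2"
          by (rule L2norm_comb[OF f12(2) vL])
        also have "\<dots> \<le> 2 * (cmod (\<i> / of_real c))^2 * 1 + 2 * (cmod (\<kappa> c - 1))^2 * V c"
          by (intro add_mono mult_left_mono N2 vV) auto
        also have "\<dots> = 2 * (1 / c^2 + (cmod (\<kappa> c - 1))^2 * V c)"
          by (simp add: norm_divide power_divide algebra_simps)
        finally show ?thesis .
      qed
      have "(L2norm (\<lambda>x. \<psi> x $ 1 - \<psi>0 x))^2 \<le> 2 * C * (1 / c^2 + (cmod (\<kappa> c - 1))^2 * V c)"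
      proof -
        \<comment> \<open>The \<open>h\<close> parts cancel in the difference, so only the source in
          the equation for \<open>u\<close> is left.\<close>
        have "(L2norm (\<lambda>x. \<psi> x $ 1 - \<psi>0 x))^2 + (L2norm (\<lambda>x. v x - v0 x))^2 \<le>
            C * ((L2norm (\<lambda>x. \<i> / of_real c * f x $ 2 + (\<kappa> c - 1) * v x))^2 + (L2norm (\<lambda>x. 0 :: complex))^2)"
          using est[OF line_sol_diff[OF s1 s0]] gL L2_0(1) by simp
        also have "\<dots> \<le> C * (2 * (1 / c^2 + (cmod (\<kappa> c - 1))^2 * V c))"
          unfolding L2_0(2) using gN C by (intro mult_left_mono) auto
        also have "\<dots> = 2 * C * (1 / c^2 + (cmod (\<kappa> c - 1))^2 * V c)" by (simp only: mult_ac)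
        finally show ?thesis using zero_le_power2[of "L2norm (\<lambda>x. v x - v0 x)"] by linarith
      qed
      moreover have "(L2norm (\<lambda>x. \<psi> x $ 2))^2 \<le> V c / (4 * m^2) * (1 / c^2)"
      proof -
        have "(L2norm (\<lambda>x. \<psi> x $ 2))^2 \<le> V c / a"
          using vV a unfolding vN by (simp add: pos_le_divide_eq mult.commute)
        then show ?thesis by (simp add: a_def power_mult_distrib)
      qed
      \<comment> \<open>The limit has lower component 0, so the whole of \<open>\<psi>2\<close>
        counts as error.\<close>
      moreover have "(L2norm (\<lambda>x. \<psi> x - vector [\<psi>0 x, 0]))^2 =
          (L2norm (\<lambda>x. \<psi> x $ 1 - \<psi>0 x))^2 + (L2norm (\<lambda>x. \<psi> x $ 2))^2"
      proof -
        have "L2 UNIV \<psi>0" by (rule schr_graph_imp_line_sol(2)[OF m0 \<eta>0(1)])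
        then have "L2 UNIV (\<lambda>x. \<psi> x $ 1 - \<psi>0 x)"
          using L2_UNIV_comb[OF \<psi>L(1), of \<psi>0 1 "- 1"] by simp
        then have "L2 UNIV (\<lambda>x. \<psi> x - vector [\<psi>0 x, 0])"
          using \<psi>L by (simp add: L2_vec2_iff[of _ "\<lambda>x. \<psi> x - vector [\<psi>0 x, 0]"] vector_2)
        from L2norm_vec2_squared[OF this] show ?thesis by (simp add: vector_2)
      qed
      ultimately have "(L2norm (\<lambda>x. \<psi> x - vector [\<psi>0 x, 0]))^2 \<le> \<epsilon> c"
        unfolding \<epsilon>_def by linarith
      then have "L2norm (\<lambda>x. \<psi> x - vector [\<psi>0 x, 0]) \<le> sqrt (\<epsilon> c)"
        by (rule real_le_rsqrt)
      then show ?thesis by (simp add: \<psi>_def \<psi>0_def S_def)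
    qed
    show ?thesis
      by (rule conjI[OF inv], rule conjI, rule opnorm_diff_bounds(1), erule (1) diff)
        (rule opnorm_diff_bounds(2), erule (1) diff)
  qed

  show ?thesis
    unfolding G_def[symmetric] S_def[symmetric]
  proof (intro conjI schr)
    show "\<forall>\<^sub>F c in at_top. invertible_graph (G c)"
      using ev by eventually_elim (use main in blast)
    show "((\<lambda>c. opnorm_diff (inv_graph (G c))
        S) \<longlongrightarrow> 0) at_top"
    proof (rule tendsto_sandwich[OF _ _ tendsto_const \<epsilon>_lim])
      show "\<forall>\<^sub>F c in at_top. 0 \<le> opnorm_diff (inv_graph (G c))
        S"
        using ev by eventually_elim (use main in blast)
      show "\<forall>\<^sub>F c in at_top. opnorm_diff (inv_graph (G c))
        S \<le> sqrt (\<epsilon> c)"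
        using ev by eventually_elim (use main in blast)
    qed
  qed
qed

end
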